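(* Let $n$ and $d$ be natural numbers with $4n-I(n) > d \geq 3n$. Then for any $d$-dimensional affine subspace $\mathcal{K}' \subset \mathcal{K}$ there exist independent $n$-chord diagrams such that the corresponding affine subspaces of $\mathcal{K}$ have non-generic (i.e. either non-transversal or empty) intersections with $\mathcal{K}'$.
   Context: $I(n)$ is the number of ones in the binary notation of $n$. $\mathcal{K}$ is the affine space of all $C^\infty$-smooth maps $\mathbb{R}^1\to\mathbb{R}^3$ coinciding with a fixed linear embedding outside some compact set in $\mathbb{R}^1$. A chord is an unordered pair $(a,b)$ of distinct points of $\mathbb{R}^1$; an $n$-chord diagram is an unordered collection of $n$ pairwise distinct chords $\{(a_1,b_1),\dots,(a_n,b_n)\}$. It is independent if the subalgebra of $C^0(\mathbb{R}^1,\mathbb{R}^1)$ consisting of all continuous functions $f$ satisfying $f(a_i)=f(b_i)$, $i=1,\dots,n$, has codimension exactly $n$ in $C^0(\mathbb{R}^1,\mathbb{R}^1)$. The affine subspace of $\mathcal{K}$ corresponding to an independent $n$-chord diagram $\{(a_i,b_i)\}$ is the subspace, of codimension $3n$, consisting of all maps $\varphi\in\mathcal{K}$ such that $\varphi(a_i)=\varphi(b_i)$ for $i=1,\dots,n$. Two affine subspaces of $\mathcal{K}$ are transversal if their direction vector spaces together span the direction vector space of $\mathcal{K}$. *)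

theory Defs
  imports "HOL-Analysis.Analysis" "HOL-Library.Function_Algebras"
begin

text \<open>
  Function spaces carry the pointwise real vector space structure, so that \<open>affine\<close>,
  \<open>subspace\<close>, \<open>span\<close> and \<open>independent\<close> apply to sets of functions.
\<close>

instantiation "fun" :: (type, real_vector) real_vector
begin

definition scaleR_fun :: "real \<Rightarrow> ('a \<Rightarrow> 'b) \<Rightarrow> 'a \<Rightarrow> 'b"
  where "scaleR_fun c f = (\<lambda>x. c *\<^sub>R f x)"

instance
  by standard (simp_all add: scaleR_fun_def fun_eq_iff scaleR_add_right scaleR_add_left)

end

definition direction :: "'v::real_vector set \<Rightarrow> 'v set"
  where "direction S = {x - y | x y. x \<in> S \<and> y \<in> S}"

text \<open>
  The library's \<open>dim\<close> and \<open>card\<close> are 0 in the infinite case, hence the explicit finite bases.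
\<close>

definition has_dimension :: "'v::real_vector set \<Rightarrow> nat \<Rightarrow> bool"
  where "has_dimension V d \<longleftrightarrow> (\<exists>B. finite B \<and> card B = d \<and> independent B \<and> span B = V)"

text \<open>
  For subspaces \<open>U \<subseteq> V\<close>: the cosets of the \<open>n\<close> elements of \<open>B\<close> form a basis of \<open>V / U\<close>.
\<close>

definition has_codimension :: "'v::real_vector set \<Rightarrow> 'v set \<Rightarrow> nat \<Rightarrow> bool"
  where "has_codimension U V n \<longleftrightarrow>
    (\<exists>B. B \<subseteq> V \<and> finite B \<and> card B = n \<and> independent B \<and>
         span B \<inter> U = {0} \<and> {b + u | b u. b \<in> span B \<and> u \<in> U} = V)"

definition affine_subspace_of_dim :: "nat \<Rightarrow> 'v::real_vector set \<Rightarrow> 'v set \<Rightarrow> bool"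
  where "affine_subspace_of_dim d S K \<longleftrightarrow>
    S \<subseteq> K \<and> S \<noteq> {} \<and> affine S \<and> has_dimension (direction S) d"

definition transversal_in :: "'v::real_vector set \<Rightarrow> 'v set \<Rightarrow> 'v set \<Rightarrow> bool"
  where "transversal_in K S T \<longleftrightarrow> span (direction S \<union> direction T) = direction K"

definition num_ones :: "nat \<Rightarrow> nat"
  where "num_ones n = card {i. bit n i}"

definition smooth :: "(real \<Rightarrow> 'v::real_normed_vector) \<Rightarrow> bool"
  where "smooth f \<longleftrightarrow>
    (\<forall>k x. ((\<lambda>g y. vector_derivative g (at y)) ^^ k) f differentiable (at x))"

definition knot_space :: "(real \<Rightarrow> real ^ 3) \<Rightarrow> (real \<Rightarrow> real ^ 3) set"
  where "knot_space e = {\<phi>. smooth \<phi> \<and> (\<exists>C. compact C \<and> (\<forall>t. t \<notin> C \<longrightarrow> \<phi> t = e t))}"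

definition is_chord :: "real set \<Rightarrow> bool"
  where "is_chord c \<longleftrightarrow> (\<exists>a b. a \<noteq> b \<and> c = {a, b})"

definition chord_diagram :: "nat \<Rightarrow> real set set \<Rightarrow> bool"
  where "chord_diagram n D \<longleftrightarrow> finite D \<and> card D = n \<and> (\<forall>c\<in>D. is_chord c)"

definition respects_chords :: "real set set \<Rightarrow> (real \<Rightarrow> 'b) \<Rightarrow> bool"
  where "respects_chords D f \<longleftrightarrow> (\<forall>a b. {a, b} \<in> D \<longrightarrow> f a = f b)"

definition continuous_functions :: "(real \<Rightarrow> real) set"
  where "continuous_functions = {f. continuous_on UNIV f}"

definition chord_subalgebra :: "real set set \<Rightarrow> (real \<Rightarrow> real) set"
  where "chord_subalgebra D = {f \<in> continuous_functions. respects_chords D f}"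

definition independent_chord_diagram :: "nat \<Rightarrow> real set set \<Rightarrow> bool"
  where "independent_chord_diagram n D \<longleftrightarrow>
    chord_diagram n D \<and> has_codimension (chord_subalgebra D) continuous_functions n"

definition chord_subspace :: "(real \<Rightarrow> real ^ 3) \<Rightarrow> real set set \<Rightarrow> (real \<Rightarrow> real ^ 3) set"
  where "chord_subspace e D = {\<phi> \<in> knot_space e. respects_chords D \<phi>}"

definition generic_intersection :: "'v::real_vector set \<Rightarrow> 'v set \<Rightarrow> 'v set \<Rightarrow> bool"
  where "generic_intersection K S T \<longleftrightarrow> transversal_in K S T \<and> S \<inter> T \<noteq> {}"

end

theory Submission
  imports Defs
begin

text \<open>
  Suppose that every independent diagram \<open>D\<close> meets \<open>K'\<close> transversally. Then, for every \<open>D\<close>, the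
  \<open>3n\<close> functionals \<open>\<psi> \<mapsto> \<psi>\<^sub>c(a\<^sub>i) - \<psi>\<^sub>c(b\<^sub>i)\<close> on the \<open>d\<close>-dimensional direction of \<open>K'\<close> are linearly
  independent. Chords are points \<open>(a, b)\<close> of the plane. For each binary digit \<open>2\<^sup>j\<close> of \<open>n\<close> take
  \<open>2\<^sup>j\<close> points at the leaves of a perfect binary tree, where each inner node carries an angle in a
  half circle that rotates its two subtrees about each other and exchanges them at the end; this is the
  cycle that detects the Stiefel-Whitney class of degree \<open>n - I(n)\<close> of the regular bundle over the
  configuration space of \<open>n\<close> points in the plane (Fuchs). Clusters are shrunk while they pass each
  other, so all these diagrams are forests, hence independent.

  The functionals now form an equivariant family of injective maps \<open>\<real>\<^sup>3\<^sup>n \<rightarrow> \<real>\<^sup>d\<close> over a cube of dimension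
  \<open>m = n - I(n)\<close> with glued faces. Adding one dimension to source and target and trivialising, up to
  permutations of the nodes, the complexified permutation bundle reduces this to a labelling, without
  zeros, of a triangulation of the glued cube times a projective space of dimension \<open>N = 4m + 3I(n)\<close>
  by vectors of \<open>\<real>\<^sup>N\<close>. The number of top simplices whose labels surround the origin has a parity that
  does not depend on the labelling. It is 0 for a labelling without zeros on a fine triangulation, and 1
  for an explicit model labelling.
\<close>

section \<open>Positive dependencies and parity\<close>

text \<open>Why 4n - I(n): let \<xi> be the permutation bundle of the n points over the cycle. The
  functionals embed 3\<xi> into a trivial bundle of rank d, so the quotient has the class
  w(-3\<xi>). The complexification of \<xi> is trivial, hence so is 4\<xi>, and w(-3\<xi>) =
  w(\<xi>). Its nonvanishing in degree n - I(n) forces d - 3n >= n - I(n). The parity count is an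
  elementary form of this argument: in the model labelling two copies of the nonconstant part of
  \<xi> are mapped identically, and the third goes into a complexified permutation bundle of the
  nodes, along lines that make half a turn. The geometric obstacle is that distinct points of the
  plane give distinct chords but not always independent ones: the four corners of a rectangle give a
  closed cycle of chords. The configurations must therefore avoid such coincidences of coordinates,
  with a margin that survives the induction over the depth of the tree. The shrinking factors and
  the tolerances \<open>eta\<close> provide it.\<close>

definition lin_indep :: "'k set \<Rightarrow> 'j set \<Rightarrow> ('j \<Rightarrow> 'k \<Rightarrow> real) \<Rightarrow> bool"
  where "lin_indep K J v \<longleftrightarrow>
    (\<forall>c. (\<forall>k\<in>K. (\<Sum>j\<in>J. c j * v j k) = 0) \<longrightarrow> (\<forall>j\<in>J. c j = 0))"

definition pos_dep :: "'k set \<Rightarrow> 'j set \<Rightarrow> ('j \<Rightarrow> 'k \<Rightarrow> real) \<Rightarrow> bool"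
  where "pos_dep K J v \<longleftrightarrow>
    (\<exists>c. (\<forall>j\<in>J. c j > 0) \<and> (\<forall>k\<in>K. (\<Sum>j\<in>J. c j * v j k) = 0))"

lemma nontrivial_kernel:
  fixes v :: "'j \<Rightarrow> 'k \<Rightarrow> real"
  assumes "finite K" "finite J" "card K < card J"
  shows "\<exists>c. (\<exists>j\<in>J. c j \<noteq> 0) \<and> (\<forall>k\<in>K. (\<Sum>j\<in>J. c j * v j k) = 0)"
  using assms
proof (induction K arbitrary: J v rule: finite_induct)
  case empty
  then have "J \<noteq> {}" by auto
  then show ?case by (intro exI[of _ "\<lambda>_. 1"]) auto
next
  case (insert k K)
  show ?case
  proof (cases "\<forall>j\<in>J. v j k = 0")
    case True
    obtain c where "\<exists>j\<in>J. c j \<noteq> 0" "\<forall>k\<in>K. (\<Sum>j\<in>J. c j * v j k) = 0"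
      using insert.IH[of J v] insert.prems insert.hyps by auto
    with True show ?thesis by (intro exI[of _ c]) auto
  next
    case False
    then obtain j0 where j0: "j0 \<in> J" "v j0 k \<noteq> 0" by blast
    \<comment> \<open>Gaussian elimination with pivot \<open>j0\<close>, whose coefficient is
      recovered in \<open>d\<close>.\<close>
    define w where "w j l = v j l - v j k / v j0 k * v j0 l" for j l
    have "card K < card (J - {j0})"
      using insert.prems insert.hyps j0 by simp
    then obtain c where c: "\<exists>j\<in>J - {j0}. c j \<noteq> 0"
        "\<forall>l\<in>K. (\<Sum>j\<in>J - {j0}. c j * w j l) = 0"
      using insert.IH[of "J - {j0}" w] insert.prems by auto
    define d where "d j = (if j = j0 then - (\<Sum>i\<in>J - {j0}. c i * v i k / v j0 k) else c j)" for j
    have sum_d: "(\<Sum>j\<in>J. d j * v j l) =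
        (\<Sum>j\<in>J - {j0}. c j * w j l)" for l
    proof -
      have "(\<Sum>j\<in>J. d j * v j l) = d j0 * v j0 l + (\<Sum>j\<in>J - {j0}. d j * v j l)"
        using insert.prems j0 by (simp add: sum.remove)
      also have "(\<Sum>j\<in>J - {j0}. d j * v j l) = (\<Sum>j\<in>J - {j0}. c j * v j l)"
        by (rule sum.cong) (auto simp: d_def)
      also have "d j0 * v j0 l + \<dots> = (\<Sum>j\<in>J - {j0}. c j * w j l)"
        by (simp add: d_def w_def sum_distrib_right sum_distrib_left sum_subtractf algebra_simps sum_negf)
      finally show ?thesis .
    qed
    have "w j k = 0" for j using j0 by (simp add: w_def)
    then have "(\<Sum>j\<in>J. d j * v j l) = 0" if "l \<in> insert k K" for l
      using that c(2) unfolding sum_d by auto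
    moreover have "\<exists>j\<in>J. d j \<noteq> 0" using c(1) by (auto simp: d_def)
    ultimately show ?thesis by blast
  qed
qed

text \<open>The relations among \<open>card K + 2\<close> vectors in general position form a plane,
  and the nonnegative ones a sector in it. If this sector is not 0, it has two boundary rays. On
  each of them exactly one coefficient is 0, and the two vectors left out there are the elements
  counted.\<close>

lemma even_card_pos_dep_facets:
  fixes v :: "'j \<Rightarrow> 'k \<Rightarrow> real"
  assumes fin: "finite K" "finite I" and card: "card I = card K + 2"
    and gp: "\<And>J. J \<subseteq> I \<Longrightarrow> card J \<le> card K \<Longrightarrow> lin_indep K J v"
  shows "even (card {i \<in> I. pos_dep K (I - {i}) v})"
proof -
  define S where "S = {i \<in> I. pos_dep K (I - {i}) v}"
  \<comment> \<open>Two zero coefficients leave a relation among \<open>card K\<close> vectors,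
    which is trivial by general position.\<close>
  have two_zeros: "c j = 0"
    if ker: "\<forall>k\<in>K. (\<Sum>j\<in>I. c j * v j k) = 0" and ab: "a \<in> I" "b \<in> I" "a \<noteq> b" "c a = 0" "c b = 0"
      and j: "j \<in> I" for c a b j
  proof -
    have "(\<Sum>j\<in>I - {a,b}. c j * v j k) = (\<Sum>j\<in>I. c j * v j k)" for k
      by (rule sum.mono_neutral_left) (use fin ab in auto)
    moreover have "card (I - {a,b}) \<le> card K"
      using fin ab card by (simp add: card_Diff_subset)
    ultimately have "\<forall>j\<in>I - {a,b}. c j = 0"
      using gp[of "I - {a,b}"] ker unfolding lin_indep_def by auto
    then show ?thesis using ab j by blast
  qed
  have sum_ext: "(\<Sum>j\<in>I. c j * v j k) = (\<Sum>j\<in>I - {a}. c j * v j k)" if "c a = 0" for c a k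
    by (rule sum.mono_neutral_right) (use fin that in auto)
  have "\<exists>i1. i1 \<noteq> i0 \<and> S = {i0, i1}" if i0S: "i0 \<in> S" for i0
  proof -
    have i0: "i0 \<in> I" using that by (simp add: S_def)
    obtain p' where p': "\<forall>j\<in>I - {i0}. p' j > 0" "\<forall>k\<in>K. (\<Sum>j\<in>I - {i0}. p' j * v j k) = 0"
      using i0S by (auto simp: S_def pos_dep_def)
    define p where "p = p'(i0 := 0)"
    have p0: "p i0 = 0" and ppos: "p j > 0" if "j \<in> I" "j \<noteq> i0" for j
      using that p' by (auto simp: p_def)
    have p0: "p i0 = 0" by (simp add: p_def)
    have pker: "\<forall>k\<in>K. (\<Sum>j\<in>I. p j * v j k) = 0"
    proof
      fix k assume "k \<in> K"
      have "(\<Sum>j\<in>I. p j * v j k) = (\<Sum>j\<in>I - {i0}. p j * v j k)"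
        using sum_ext p0 .
      also have "\<dots> = (\<Sum>j\<in>I - {i0}. p' j * v j k)"
        by (rule sum.cong) (auto simp: p_def)
      finally show "(\<Sum>j\<in>I. p j * v j k) = 0" using p' \<open>k \<in> K\<close> by simp
    qed
    have ne: "I - {i0} \<noteq> {}"
    proof
      assume "I - {i0} = {}"
      then have "card I \<le> card {i0}" by (intro card_mono) auto
      then show False using card by simp
    qed
    then obtain a where a: "a \<in> I" "a \<noteq> i0" by blast
    \<comment> \<open>A nonzero relation that vanishes at \<open>a\<close> is not a multiple of
      \<open>p\<close>; together they span the plane of relations.\<close>
    have "card K < card (I - {a})" using card a fin by simp
    then obtain n' where n': "\<exists>j\<in>I - {a}. n' j \<noteq> 0" "\<forall>k\<in>K. (\<Sum>j\<in>I - {a}. n' j * v j k) = 0"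
      using nontrivial_kernel[of K "I - {a}" v] fin by auto
    define n where "n = n'(a := 0)"
    have nker: "\<forall>k\<in>K. (\<Sum>j\<in>I. n j * v j k) = 0"
    proof
      fix k assume "k \<in> K"
      have "(\<Sum>j\<in>I. n j * v j k) = (\<Sum>j\<in>I - {a}. n j * v j k)"
        using sum_ext[of n a] by (simp add: n_def)
      also have "\<dots> = (\<Sum>j\<in>I - {a}. n' j * v j k)"
        by (rule sum.cong) (auto simp: n_def)
      finally show "(\<Sum>j\<in>I. n j * v j k) = 0" using n' \<open>k \<in> K\<close> by simp
    qed
    have ni0: "n i0 \<noteq> 0"
    proof
      assume "n i0 = 0"
      moreover obtain z where "z \<in> I" "z \<noteq> a" "n' z \<noteq> 0" using n'(1) by blast
      ultimately show False
        using two_zeros[OF nker, of i0 a z] a i0 by (simp add: n_def)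
    qed
    define m where "m j = n j / n i0" for j
    have m0: "m i0 = 1" using ni0 by (simp add: m_def)
    have mker: "\<forall>k\<in>K. (\<Sum>j\<in>I. m j * v j k) = 0"
    proof
      fix k assume "k \<in> K"
      have "(\<Sum>j\<in>I. m j * v j k) = (\<Sum>j\<in>I. n j * v j k) / n i0"
        by (simp add: m_def sum_divide_distrib)
      then show "(\<Sum>j\<in>I. m j * v j k) = 0" using nker \<open>k \<in> K\<close> by simp
    qed
    have comb: "\<forall>k\<in>K. (\<Sum>j\<in>I. (x * c j + y * d j) * v j k) = 0"
      if "\<forall>k\<in>K. (\<Sum>j\<in>I. c j * v j k) = 0" "\<forall>k\<in>K. (\<Sum>j\<in>I. d j * v j k) = 0" for x y c d
    proof
      fix k assume "k \<in> K"
      have "(\<Sum>j\<in>I. (x * c j + y * d j) * v j k) = x * (\<Sum>j\<in>I. c j * v j k) + y * (\<Sum>j\<in>I. d j * v j k)"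
        by (simp add: sum_distrib_left sum.distrib algebra_simps)
      then show "(\<Sum>j\<in>I. (x * c j + y * d j) * v j k) = 0" using that \<open>k \<in> K\<close> by simp
    qed
    \<comment> \<open>On the line \<open>m + t * p\<close> coordinate \<open>j\<close> is
      nonnegative exactly for \<open>t \<ge> r j\<close>, so the maximum \<open>s\<close> is where
      the line enters the sector.\<close>
    define r where "r j = - m j / p j" for j
    define s where "s = Max (r ` (I - {i0}))"
    have "s \<in> r ` (I - {i0})" unfolding s_def by (rule Max_in) (use fin ne in auto)
    then obtain i1 where i1: "i1 \<in> I" "i1 \<noteq> i0" "s = r i1" by auto
    have s_ge: "r j \<le> s" if "j \<in> I" "j \<noteq> i0" for j
      unfolding s_def by (rule Max_ge) (use fin that in auto)
    define q where "q j = 1 * m j + s * p j" for j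
    have qker: "\<forall>k\<in>K. (\<Sum>j\<in>I. q j * v j k) = 0" unfolding q_def by (rule comb[OF mker pker])
    have q0: "q i0 = 1" by (simp add: q_def m0 p0)
    have q1: "q i1 = 0" using ppos[OF i1(1,2)] i1(3) by (simp add: q_def r_def)
    have qpos: "q j > 0" if "j \<in> I" "j \<noteq> i1" for j
    proof (cases "j = i0")
      case False
      have "q j \<noteq> 0" using two_zeros[OF qker, of j i1 i0] that i1 i0 q0 q1 by auto
      moreover have "q j \<ge> 0"
        using s_ge[OF that(1) False] ppos[OF that(1) False] by (simp add: q_def r_def field_simps)
      ultimately show ?thesis by simp
    qed (simp add: q0)
    have "i1 \<in> S"
      unfolding S_def pos_dep_def using i1 qpos qker sum_ext[of q i1] q1 by auto
    moreover have "i2 = i1" if i2: "i2 \<in> S" "i2 \<noteq> i0" for i2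
    proof -
      have i2I: "i2 \<in> I" using i2 by (simp add: S_def)
      obtain c' where c': "\<forall>j\<in>I - {i2}. c' j > 0" "\<forall>k\<in>K. (\<Sum>j\<in>I - {i2}. c' j * v j k) = 0"
        using i2 by (auto simp: S_def pos_dep_def)
      define c where "c j = (if j = i2 then 0 else c' j / c' i0)" for j
      have c'i0: "c' i0 > 0" using c' i0 i2 by auto
      have cpos: "c j > 0" if "j \<in> I" "j \<noteq> i2" for j using that c' c'i0 by (simp add: c_def)
      have c0: "c i0 = 1" using c'i0 i2 by (simp add: c_def)
      have c2: "c i2 = 0" by (simp add: c_def)
      have cker: "\<forall>k\<in>K. (\<Sum>j\<in>I. c j * v j k) = 0"
      proof
        fix k assume "k \<in> K"
        have "(\<Sum>j\<in>I. c j * v j k) = (\<Sum>j\<in>I - {i2}. c j * v j k)"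
          using sum_ext[of c i2] c2 by simp
        also have "\<dots> = (\<Sum>j\<in>I - {i2}. c' j * v j k / c' i0)"
          by (rule sum.cong) (auto simp: c_def)
        finally show "(\<Sum>j\<in>I. c j * v j k) = 0" 
          using c' \<open>k \<in> K\<close> by (simp flip: sum_divide_distrib)
      qed
      \<comment> \<open>Any relation with coefficient 1 at \<open>i0\<close> lies on this line. The
        zero at \<open>i2\<close> gives \<open>t \<le> s\<close>, nonnegativity at \<open>i1\<close>
        gives \<open>t \<ge> s\<close>.\<close>
      define t where "t = (c i2 - m i2) / p i2"
      have p2: "p i2 > 0" using ppos i2I i2 by simp
      define d where "d j = 1 * (1 * c j + (-1) * m j) + (-t) * p j" for j
      have "\<forall>k\<in>K. (\<Sum>j\<in>I. d j * v j k) = 0"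
        unfolding d_def by (rule comb[OF comb[OF cker mker] pker])
      moreover have "d i0 = 0" by (simp add: d_def c0 m0 p0)
      moreover have "d i2 = 0" using p2 by (simp add: d_def t_def)
      ultimately have "d j = 0" if "j \<in> I" for j
        using two_zeros[of d i0 i2 j] that i0 i2I i2 by auto
      then have c_eq: "c j = m j + t * p j" if "j \<in> I" for j
        using that by (simp add: d_def algebra_simps)
      have "t = r i2" using c2 by (simp add: t_def r_def)
      then have "t \<le> s" using s_ge i2I i2 by simp
      have "c i1 \<ge> 0" using cpos[OF i1(1)] c2 by (cases "i1 = i2") auto
      then have "m i1 + t * p i1 \<ge> 0" using c_eq i1 by simp
      then have "- m i1 / p i1 \<le> t" using ppos[OF i1(1,2)] by (subst pos_divide_le_eq) auto
      then have "t \<ge> s" using i1(3) by (simp add: r_def)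
      then have "c i1 = 0" using c_eq[OF i1(1)] q1 \<open>t \<le> s\<close> by (simp add: q_def)
      then show ?thesis using cpos[OF i1(1)] by auto
    qed
    ultimately show ?thesis using i1(2) that by blast
  qed
  note pair = this
  show ?thesis unfolding S_def[symmetric]
  proof (cases "S = {}")
    case False
    then obtain i0 where "i0 \<in> S" by blast
    with pair obtain i1 where "i1 \<noteq> i0" "S = {i0, i1}" by meson
    then show "even (card S)" by simp
  qed simp
qed

lemma even_card_involution:
  assumes "finite S" "\<And>x. x \<in> S \<Longrightarrow> f x \<in> S \<and> f (f x) = x \<and> f x \<noteq> x"
  shows "even (card S)"
  using assms
proof (induction "card S" arbitrary: S rule: less_induct)
  case less
  show ?case
  proof (cases "S = {}")
    case False
    then obtain x where x: "x \<in> S" by blast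
    let ?T = "S - {x, f x}"
    have fx: "f x \<in> S" "f x \<noteq> x" using less.prems(2)[OF x] by auto
    have "card {x, f x} \<le> card S" by (rule card_mono) (use less.prems(1) x fx in auto)
    moreover have "card ?T = card S - card {x, f x}"
      by (rule card_Diff_subset) (use x fx in auto)
    ultimately have card: "card S = card ?T + 2" using fx by auto
    have "f y \<in> ?T \<and> f (f y) = y \<and> f y \<noteq> y" if "y \<in> ?T" for y
      using less.prems(2)[of y] less.prems(2)[OF x] that by auto
    then have "even (card ?T)" using less.hyps[of ?T] card less.prems(1) by simp
    then show ?thesis using card by simp
  qed simp
qed

lemma pos_dep_reindex:
  assumes "bij_betw h J J'"
  shows "pos_dep K J' v \<longleftrightarrow> pos_dep K J (\<lambda>j. v (h j))"
proof
  assume "pos_dep K J' v"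
  then obtain c where c: "\<forall>j\<in>J'. c j > 0" "\<forall>k\<in>K. (\<Sum>j\<in>J'. c j * v j k) = 0"
    unfolding pos_dep_def by blast
  have "(\<Sum>j\<in>J. c (h j) * v (h j) k) = (\<Sum>j\<in>J'. c j * v j k)" for k
    by (rule sum.reindex_bij_betw[OF assms])
  with c assms show "pos_dep K J (\<lambda>j. v (h j))"
    unfolding pos_dep_def by (intro exI[of _ "\<lambda>j. c (h j)"]) (auto dest: bij_betwE)
next
  assume "pos_dep K J (\<lambda>j. v (h j))"
  then obtain c where c: "\<forall>j\<in>J. c j > 0" "\<forall>k\<in>K. (\<Sum>j\<in>J. c j * v (h j) k) = 0"
    unfolding pos_dep_def by blast
  let ?g = "inv_into J h"
  have gh: "?g (h j) = j" if "j \<in> J" for j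
    using assms that by (simp add: bij_betw_def)
  have gJ: "?g j \<in> J" if "j \<in> J'" for j
    using assms that by (metis bij_betw_def inv_into_into)
  have "(\<Sum>j\<in>J'. c (?g j) * v j k) = (\<Sum>j\<in>J. c j * v (h j) k)" for k
    unfolding sum.reindex_bij_betw[OF assms, symmetric] by (rule sum.cong) (auto simp: gh)
  with c gJ show "pos_dep K J' v"
    unfolding pos_dep_def by (intro exI[of _ "\<lambda>j. c (?g j)"]) auto
qed

text \<open>The hypothesis covers permutations and sign changes of the target coordinates, which is
  how labels change under the antipode and across glued faces.\<close>

lemma pos_dep_transfer:
  assumes "pos_dep K J v"
    and rel: "\<And>k. k \<in> K \<Longrightarrow> \<exists>k'\<in>K. \<exists>s. \<forall>j\<in>J. w j k = s * v j k'"
  shows "pos_dep K J w"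
proof -
  obtain c where c: "\<forall>j\<in>J. c j > 0" "\<forall>k\<in>K. (\<Sum>j\<in>J. c j * v j k) = 0"
    using assms(1) unfolding pos_dep_def by blast
  have "(\<Sum>j\<in>J. c j * w j k) = 0" if "k \<in> K" for k
  proof -
    from rel[OF that] obtain k' s where "k' \<in> K" "\<forall>j\<in>J. w j k = s * v j k'" by blast
    then have "(\<Sum>j\<in>J. c j * w j k) = s * (\<Sum>j\<in>J. c j * v j k')"
      by (simp add: sum_distrib_left algebra_simps)
    then show ?thesis using c \<open>k' \<in> K\<close> by simp
  qed
  then show ?thesis using c unfolding pos_dep_def by blast
qed

text \<open>
  Relabel one rank \<open>r\<close> at a time. A chain together with both of its rank-\<open>r\<close> labels has an even
  number of facets that surround the origin, and every facet missing another rank is shared by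
  exactly two chains.
\<close>

theorem parity_invariance:
  fixes L :: "bool \<Rightarrow> 'c \<Rightarrow> nat \<Rightarrow> 'k \<Rightarrow> real"
  assumes fin: "finite K" "finite \<C>" and N: "card K = N"
    and inv: "\<And>i C. i \<le> N \<Longrightarrow> C \<in> \<C> \<Longrightarrow> \<phi> i C \<in> \<C> \<and> \<phi> i (\<phi> i C) = C \<and> \<phi> i C \<noteq> C"
    and rel: "\<And>i C k. i \<le> N \<Longrightarrow> C \<in> \<C> \<Longrightarrow> k \<in> K \<Longrightarrow>
      \<exists>k'\<in>K. \<exists>s. \<forall>b. \<forall>j\<le>N. j \<noteq> i \<longrightarrow> L b (\<phi> i C) j k = s * L b C j k'"
    and gp: "\<And>C J. C \<in> \<C> \<Longrightarrow> J \<subseteq> {..N} \<times> UNIV \<Longrightarrow> card J \<le> N \<Longrightarrow> lin_indep K J (\<lambda>(j, b). L b C j)"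
  shows "even (card {C \<in> \<C>. pos_dep K {..N} (L True C)} + card {C \<in> \<C>. pos_dep K {..N} (L False C)})"
proof -
  define H where "H r C j = (if j < r then L True C j else L False C j)" for r C j
  define cnt where "cnt r = card {C \<in> \<C>. pos_dep K {..N} (H r C)}" for r
  have step: "even (cnt r + cnt (Suc r))" if r: "r \<le> N" for r
  proof -
    \<comment> \<open>As \<open>r < r\<close> fails, the image contains \<open>(r, False)\<close>;
      with \<open>(r, True)\<close> there are N + 2 labels. Removing \<open>(r, True)\<close> leaves
      the labels \<open>H r\<close>, removing \<open>(r, False)\<close> leaves
      \<open>H (Suc r)\<close>.\<close>
    define I where "I = (\<lambda>j. (j, j < r)) ` {..N} \<union> {(r, True)}"
    have inj: "inj_on (\<lambda>j. (j, j < r)) {..N}" by (rule inj_onI) simp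
    have rn: "(r, True) \<notin> (\<lambda>j. (j, j < r)) ` {..N}" by auto
    have finI: "finite I" by (simp add: I_def)
    have cardI: "card I = card K + 2"
      using rn card_image[OF inj] by (simp add: I_def N)
    have Isub: "I \<subseteq> {..N} \<times> UNIV" using r by (auto simp: I_def)
    define F where "F C i = pos_dep K (I - {i}) (\<lambda>(j, b). L b C j)" for C i
    have evC: "even (card {i \<in> I. F C i})" if "C \<in> \<C>" for C
      unfolding F_def
      by (rule even_card_pos_dep_facets[OF fin(1) finI cardI]) (use gp[OF that] Isub N in auto)
    have evi: "even (card {C \<in> \<C>. F C i})" if i: "i \<in> I - {(r, True), (r, False)}" for i
    proof (rule even_card_involution[where f = "\<phi> (fst i)"])
      fix C assume C: "C \<in> {C \<in> \<C>. F C i}"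
      have le: "fst i \<le> N" using i Isub by auto
      have ne: "fst p \<noteq> fst i" "fst p \<le> N" if "p \<in> I - {i}" for p
        using that i Isub by (auto simp: I_def)
      have "F (\<phi> (fst i) C) i" unfolding F_def
      proof (rule pos_dep_transfer)
        show "pos_dep K (I - {i}) (\<lambda>(j, b). L b C j)" using C by (simp add: F_def)
        fix k assume "k \<in> K"
        then obtain k' s where "k' \<in> K"
          "\<forall>b. \<forall>j\<le>N. j \<noteq> fst i \<longrightarrow> L b (\<phi> (fst i) C) j k = s * L b C j k'"
          using rel[OF le, of C k] C by blast
        then show "\<exists>k'\<in>K. \<exists>s. \<forall>j\<in>I - {i}. (case j of (j, b) \<Rightarrow> L b (\<phi> (fst i) C) j) k =
            s * (case j of (j, b) \<Rightarrow> L b C j) k'"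
          using ne by (intro bexI[of _ k'] exI[of _ s]) (auto split: prod.split)
      qed
      then show "\<phi> (fst i) C \<in> {C \<in> \<C>. F C i} \<and> \<phi> (fst i) (\<phi> (fst i) C) = C \<and> \<phi> (fst i) C \<noteq> C"
        using inv[OF le, of C] C by simp
    qed (use fin in simp)
    have count: "card {x \<in> A. P x} = (\<Sum>x\<in>A. of_bool (P x))" if "finite A" for A :: "'z set" and P
      using that by (simp add: Int_def)
    have "(\<Sum>C\<in>\<C>. card {i \<in> I. F C i}) = (\<Sum>C\<in>\<C>. \<Sum>i\<in>I. of_bool (F C i))"
      by (rule sum.cong) (use finI in \<open>auto simp: Int_def\<close>)
    also have "\<dots> = (\<Sum>i\<in>I. \<Sum>C\<in>\<C>. of_bool (F C i))" by (rule sum.swap)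
    also have "\<dots> = (\<Sum>i\<in>I. card {C \<in> \<C>. F C i})"
      by (rule sum.cong) (use fin in \<open>auto simp: Int_def\<close>)
    also have "\<dots> = (\<Sum>i\<in>I - {(r, True), (r, False)}. card {C \<in> \<C>. F C i}) +
        (\<Sum>i\<in>{(r, True), (r, False)}. card {C \<in> \<C>. F C i})"
      by (rule sum.subset_diff) (use finI r in \<open>auto simp: I_def\<close>)
    finally have tot: "(\<Sum>C\<in>\<C>. card {i \<in> I. F C i}) =
       (\<Sum>i\<in>I - {(r, True), (r, False)}. card {C \<in> \<C>. F C i}) +
        (card {C \<in> \<C>. F C (r, True)} + card {C \<in> \<C>. F C (r, False)})" by simp
    have "even (\<Sum>C\<in>\<C>. card {i \<in> I. F C i})" by (rule dvd_sum) (use evC in simp)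
    moreover have "even (\<Sum>i\<in>I - {(r, True), (r, False)}. card {C \<in> \<C>. F C i})"
      by (rule dvd_sum) (use evi in simp)
    ultimately have ev: "even (card {C \<in> \<C>. F C (r, True)} + card {C \<in> \<C>. F C (r, False)})"
      using tot by simp
    have b1: "bij_betw (\<lambda>j. (j, j < r)) {..N} (I - {(r, True)})"
      using rn inj by (auto simp: bij_betw_def I_def)
    have b2: "bij_betw (\<lambda>j. (j, j < Suc r)) {..N} (I - {(r, False)})"
    proof (rule bij_betw_imageI)
      show "(\<lambda>j. (j, j < Suc r)) ` {..N} = I - {(r, False)}"
        using r by (auto simp: I_def image_iff less_Suc_eq)
    qed (rule inj_onI, simp)
    have "F C (r, True) \<longleftrightarrow> pos_dep K {..N} (H r C)" for C
    proof -
      have "(\<lambda>j. L (j < r) C j) = H r C" by (auto simp: fun_eq_iff H_def)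
      then show ?thesis unfolding F_def pos_dep_reindex[OF b1] by simp
    qed
    moreover have "F C (r, False) \<longleftrightarrow> pos_dep K {..N} (H (Suc r) C)" for C
    proof -
      have "(\<lambda>j. L (j < Suc r) C j) = H (Suc r) C" by (auto simp: fun_eq_iff H_def)
      then show ?thesis unfolding F_def pos_dep_reindex[OF b2] by simp
    qed
    ultimately show ?thesis using ev by (simp add: cnt_def)
  qed
  have "even (cnt 0 + cnt r)" if "r \<le> Suc N" for r
    using that
  proof (induction r)
    case (Suc r)
    then show ?case using step[of r] by (auto simp: even_add)
  qed simp
  then have "even (cnt 0 + cnt (Suc N))" by simp
  moreover have "pos_dep K {..N} (H (Suc N) C) \<longleftrightarrow> pos_dep K {..N} (L True C)" for C
    unfolding pos_dep_def by (simp add: H_def)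
  moreover have "pos_dep K {..N} (H 0 C) \<longleftrightarrow> pos_dep K {..N} (L False C)" for C
    unfolding pos_dep_def by (simp add: H_def)
  ultimately show ?thesis by (simp add: cnt_def add.commute)
qed

section \<open>General position by small perturbations\<close>

lemma avoid_linear_zeros:
  fixes P0 :: "'i \<Rightarrow> real" and \<Lambda> \<Lambda>' :: "('i \<Rightarrow> real) set"
  assumes "finite \<Lambda>" "finite \<Lambda>'" "\<And>l. l \<in> \<Lambda> \<Longrightarrow> \<exists>M. (\<Sum>i\<in>I. M i * l i) \<noteq> 0" and e: "e > 0"
  shows "\<exists>P. (\<forall>l\<in>\<Lambda>'. \<bar>(\<Sum>i\<in>I. P i * l i) - (\<Sum>i\<in>I. P0 i * l i)\<bar> < e) \<and> (\<forall>l\<in>\<Lambda>. (\<Sum>i\<in>I. P i * l i) \<noteq> 0)"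
  using assms(1,3)
proof (induction \<Lambda> rule: finite_induct)
  case empty
  show ?case by (rule exI[of _ P0]) (use e in auto)
next
  case (insert l \<Lambda>)
  define ev where "ev P f = (\<Sum>i\<in>I. P i * f i :: real)" for P f
  obtain P where P: "\<forall>f\<in>\<Lambda>'. \<bar>ev P f - ev P0 f\<bar> < e" "\<forall>f\<in>\<Lambda>. ev P f \<noteq> 0"
    using insert unfolding ev_def by auto
  \<comment> \<open>A short step along \<open>M\<close> makes \<open>l\<close> nonzero, and the
    finitely many open conditions reached so far survive it.\<close>
  obtain M where M: "ev M l \<noteq> 0" using insert.prems unfolding ev_def by blast
  have split: "ev (\<lambda>i. P i + s * M i) f = ev P f + s * ev M f" for s f
    by (simp add: ev_def sum.distrib sum_distrib_left algebra_simps)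
  have lim: "((\<lambda>s. ev P f + s * ev M f) \<longlongrightarrow> ev P f) (at_right 0)" for f
  proof -
    have "((\<lambda>s. ev P f + s * ev M f) \<longlongrightarrow> ev P f + 0 * ev M f) (at_right 0)"
      by (intro tendsto_intros)
    then show ?thesis by simp
  qed
  have "\<forall>\<^sub>F s in at_right 0. \<forall>f\<in>\<Lambda>'. \<bar>ev P f + s * ev M f - ev P0 f\<bar> < e"
  proof (rule eventually_ball_finite[OF assms(2)], rule ballI)
    fix f assume "f \<in> \<Lambda>'"
    have "((\<lambda>s. \<bar>ev P f + s * ev M f - ev P0 f\<bar>) \<longlongrightarrow> \<bar>ev P f - ev P0 f\<bar>) (at_right 0)"
      by (intro tendsto_rabs tendsto_diff lim tendsto_const)
    then show "\<forall>\<^sub>F s in at_right 0. \<bar>ev P f + s * ev M f - ev P0 f\<bar> < e"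
      by (rule order_tendstoD) (use P \<open>f \<in> \<Lambda>'\<close> in auto)
  qed
  moreover have "\<forall>\<^sub>F s in at_right 0. \<forall>f\<in>\<Lambda>. ev P f + s * ev M f \<noteq> 0"
    by (rule eventually_ball_finite[OF insert.hyps(1)]) (use P(2) tendsto_imp_eventually_ne[OF lim] in blast)
  moreover have "\<forall>\<^sub>F s in at_right (0::real). ev P l + s * ev M l \<noteq> 0"
  proof (cases "ev P l = 0")
    case True
    then show ?thesis using M by (auto simp: eventually_at_filter)
  qed (rule tendsto_imp_eventually_ne[OF lim])
  ultimately have "\<forall>\<^sub>F s in at_right 0. (\<forall>f\<in>\<Lambda>'. \<bar>ev P f + s * ev M f - ev P0 f\<bar> < e) \<and>
      (\<forall>f\<in>insert l \<Lambda>. ev P f + s * ev M f \<noteq> 0)"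
    by eventually_elim auto
  from eventually_happens'[OF trivial_limit_at_right_real this]
  obtain s where "(\<forall>f\<in>\<Lambda>'. \<bar>ev P f + s * ev M f - ev P0 f\<bar> < e) \<and> (\<forall>f\<in>insert l \<Lambda>. ev P f + s * ev M f \<noteq> 0)"
    by (rule exE)
  then show ?case unfolding split[symmetric] unfolding ev_def by (intro exI[of _ "\<lambda>i. P i + s * M i"])
qed

text \<open>The parameters \<open>P s\<close> belong to the slot \<open>s\<close> and are shared by
  all chains; separate parameters for each chain would destroy the agreement of labels on common
  facets. The slots are treated one by one: for each chain and each small set of old slots, the new
  label has to avoid a hyperplane through the old labels.\<close>

lemma generic_labels:
  fixes g :: "'c \<Rightarrow> 's \<Rightarrow> 'i \<Rightarrow> 'k \<Rightarrow> real"
  assumes fin: "finite K" "finite \<C>" and e: "e > 0"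
    and S: "finite S" "\<And>C s k. C \<in> \<C> \<Longrightarrow> s \<in> S \<Longrightarrow> k \<in> K \<Longrightarrow> 
      \<exists>M. \<forall>k'\<in>K. (\<Sum>i\<in>I. M i * g C s i k') = of_bool (k' = k)"
  shows "\<exists>P. (\<forall>C\<in>\<C>. \<forall>s\<in>S. \<forall>k\<in>K. \<bar>(\<Sum>i\<in>I. P s i * g C s i k) - (\<Sum>i\<in>I. P0 i * g C s i k)\<bar> < e) \<and>
     (\<forall>C\<in>\<C>. \<forall>J\<subseteq>S. card J \<le> card K \<longrightarrow> lin_indep K J (\<lambda>s k. \<Sum>i\<in>I. P s i * g C s i k))"
  using S
proof (induction S rule: finite_induct)
  case empty
  show ?case by (auto simp: lin_indep_def)
next
  case (insert s S)
  then obtain P where P: "\<forall>C\<in>\<C>. \<forall>s\<in>S. \<forall>k\<in>K. \<bar>(\<Sum>i\<in>I. P s i * g C s i k) - (\<Sum>i\<in>I. P0 i * g C s i k)\<bar> < e"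
    "\<And>C J. C \<in> \<C> \<Longrightarrow> J \<subseteq> S \<Longrightarrow> card J \<le> card K \<Longrightarrow> lin_indep K J (\<lambda>s k. \<Sum>i\<in>I. P s i * g C s i k)"
    by auto
  define lab where "lab C s k = (\<Sum>i\<in>I. P s i * g C s i k)" for C s k
  define X where "X = \<C> \<times> {J. J \<subseteq> S \<and> card J < card K}"
  have finX: "finite X" unfolding X_def using fin insert.hyps by auto
  \<comment> \<open>Fewer than \<open>card K\<close> old labels lie in a hyperplane;
    \<open>a x\<close> is a covector defining it.\<close>
  have "\<exists>a. (\<exists>k\<in>K. a k \<noteq> 0) \<and> (\<forall>j\<in>snd x. (\<Sum>k\<in>K. a k * lab (fst x) j k) = 0)" if "x \<in> X" for x
  proof (rule nontrivial_kernel)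
    show "finite (snd x)" using that insert.hyps by (auto simp: X_def dest: finite_subset)
  qed (use that fin in \<open>auto simp: X_def\<close>)
  then obtain a where a: "\<And>x. x \<in> X \<Longrightarrow> \<exists>k\<in>K. a x k \<noteq> 0"
    "\<And>x j. x \<in> X \<Longrightarrow> j \<in> snd x \<Longrightarrow> (\<Sum>k\<in>K. a x k * lab (fst x) j k) = 0"
    by metis
  define l where "l x i = (\<Sum>k\<in>K. a x k * g (fst x) s i k)" for x i
  have l_sum: "(\<Sum>i\<in>I. M i * l x i) = (\<Sum>k\<in>K. a x k * (\<Sum>i\<in>I. M i * g (fst x) s i k))" for M x
    unfolding l_def sum_distrib_left by (subst sum.swap) (simp add: algebra_simps)
  have "\<exists>M. (\<Sum>i\<in>I. M i * f i) \<noteq> 0" if "f \<in> l ` X" for f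
  proof -
    from that obtain x where x: "x \<in> X" "f = l x" by blast
    obtain k where k: "k \<in> K" "a x k \<noteq> 0" using a x by blast
    have "fst x \<in> \<C>" using x by (auto simp: X_def)
    then obtain M where M: "\<forall>k'\<in>K. (\<Sum>i\<in>I. M i * g (fst x) s i k') = of_bool (k' = k)"
      using insert.prems[of "fst x" s k] k by auto
    have "(\<Sum>i\<in>I. M i * f i) = (\<Sum>k'\<in>K. a x k' * of_bool (k' = k))"
      unfolding x(2) l_sum using M by simp
    also have "\<dots> = a x k" using k fin by (simp add: of_bool_def if_distrib cong: if_cong)
    finally show ?thesis using k by metis
  qed
  then obtain Q where Q: "\<forall>f\<in>(\<lambda>(C, k) i. g C s i k) ` (\<C> \<times> K). \<bar>(\<Sum>i\<in>I. Q i * f i) - (\<Sum>i\<in>I. P0 i * f i)\<bar> < e"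
    "\<forall>f\<in>l ` X. (\<Sum>i\<in>I. Q i * f i) \<noteq> 0"
    using avoid_linear_zeros[of "l ` X" "(\<lambda>(C, k) i. g C s i k) ` (\<C> \<times> K)" I e P0] finX fin e by auto
  define P' where "P' = P(s := Q)"
  have lab_old: "(\<Sum>i\<in>I. P' j i * g C j i k) = lab C j k" if "j \<in> S" for C j k
    using that insert.hyps by (auto simp: P'_def lab_def)
  have "lin_indep K J (\<lambda>s k. \<Sum>i\<in>I. P' s i * g C s i k)"
    if C: "C \<in> \<C>" and J: "J \<subseteq> insert s S" "card J \<le> card K" for C J
  proof -
    define J' where "J' = J - {s}"
    have finJ: "finite J" using J insert.hyps by (auto intro: finite_subset)
    have J'S: "J' \<subseteq> S" using J by (auto simp: J'_def)
    have "card J' \<le> card K" using J finJ unfolding J'_def by (meson card_Diff1_le le_trans)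
    then have indJ': "lin_indep K J' (lab C)" using P(2)[OF C J'S] by (simp add: lab_def[abs_def])
    show ?thesis unfolding lin_indep_def
    proof (intro allI impI)
      fix c assume ker: "\<forall>k\<in>K. (\<Sum>j\<in>J. c j * (\<Sum>i\<in>I. P' j i * g C j i k)) = 0"
      have J'_sum: "(\<Sum>j\<in>J'. c j * (\<Sum>i\<in>I. P' j i * g C j i k)) = (\<Sum>j\<in>J'. c j * lab C j k)" for k
        by (rule sum.cong) (use lab_old J'S in auto)
      have cs: "c s = 0" if sJ: "s \<in> J"
      proof -
        have "card J' < card K"
          using J sJ finJ unfolding J'_def by (metis card_Diff1_less le_trans less_le_not_le linorder_not_le)
        then have x: "(C, J') \<in> X" using C J'S by (simp add: X_def)
        have "0 = (\<Sum>k\<in>K. a (C,J') k * (\<Sum>j\<in>J. c j * (\<Sum>i\<in>I. P' j i * g C j i k)))" using ker by simp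
        also have "\<dots> = (\<Sum>k\<in>K. a (C,J') k * (c s * (\<Sum>i\<in>I. Q i * g C s i k)))
            + (\<Sum>k\<in>K. a (C,J') k * (\<Sum>j\<in>J'. c j * lab C j k))"
          unfolding sum.remove[OF finJ sJ] J'_sum[symmetric]
          by (simp add: J'_def P'_def algebra_simps sum.distrib)
        also have "(\<Sum>k\<in>K. a (C,J') k * (c s * (\<Sum>i\<in>I. Q i * g C s i k))) = c s * (\<Sum>i\<in>I. Q i * l (C,J') i)"
          unfolding l_sum by (simp add: sum_distrib_left mult.left_commute)
        also have "(\<Sum>k\<in>K. a (C,J') k * (\<Sum>j\<in>J'. c j * lab C j k)) =
            (\<Sum>j\<in>J'. c j * (\<Sum>k\<in>K. a (C,J') k * lab C j k))"
          unfolding sum_distrib_left by (subst sum.swap) (simp add: mult.left_commute)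
        also have "\<dots> = 0" using a(2)[OF x] by simp
        finally show ?thesis using Q(2) x by auto
      qed
      have "\<forall>k\<in>K. (\<Sum>j\<in>J'. c j * lab C j k) = 0"
      proof
        fix k assume "k \<in> K"
        then have "0 = (\<Sum>j\<in>J. c j * (\<Sum>i\<in>I. P' j i * g C j i k))" using ker by simp
        also have "\<dots> = (\<Sum>j\<in>J'. c j * (\<Sum>i\<in>I. P' j i * g C j i k))"
          by (rule sum.mono_neutral_right) (use finJ cs J'_def in auto)
        finally show "(\<Sum>j\<in>J'. c j * lab C j k) = 0" using J'_sum by simp
      qed
      then have "\<forall>j\<in>J'. c j = 0" using indJ' unfolding lin_indep_def by blast
      then show "\<forall>j\<in>J. c j = 0" using cs by (auto simp: J'_def)
    qed
  qed
  moreover have "\<forall>C\<in>\<C>. \<forall>j\<in>insert s S. \<forall>k\<in>K.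
      \<bar>(\<Sum>i\<in>I. P' j i * g C j i k) - (\<Sum>i\<in>I. P0 i * g C j i k)\<bar> < e"
    using P(1) Q(1) by (auto simp: P'_def)
  ultimately show ?case by blast
qed

section \<open>Stability of positive dependencies, by compactness\<close>

lemma finite_bounded_subseq:
  fixes x :: "nat \<Rightarrow> 'j \<Rightarrow> real"
  assumes "finite J" "\<And>n j. j \<in> J \<Longrightarrow> \<bar>x n j\<bar> \<le> B"
  shows "\<exists>r l. strict_mono (r :: nat \<Rightarrow> nat) \<and> (\<forall>j\<in>J. (\<lambda>n. x (r n) j) \<longlonglongrightarrow> l j)"
  using assms
proof (induction J rule: finite_induct)
  case empty
  show ?case by (rule exI[of _ id]) (auto simp: strict_mono_def)
next
  case (insert j J)
  then obtain r l where r: "strict_mono (r :: nat \<Rightarrow> nat)" "\<forall>j\<in>J. (\<lambda>n. x (r n) j) \<longlonglongrightarrow> l j"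
    by auto
  have "x (r n) j \<in> {-B..B}" for n using insert.prems[of j "r n"] by (auto simp: abs_le_iff)
  then obtain m q where q: "strict_mono (q :: nat \<Rightarrow> nat)" "((\<lambda>n. x (r n) j) \<circ> q) \<longlonglongrightarrow> m"
    using compact_Icc[of "-B" B] unfolding compact_def by (metis (no_types, lifting))
  have "(\<lambda>n. x ((r \<circ> q) n) i) \<longlonglongrightarrow> (l(j := m)) i" if "i \<in> insert j J" for i
  proof (cases "i = j")
    case True
    then show ?thesis using q(2) by (simp add: o_def)
  next
    case False
    then show ?thesis
      using that r(2) LIMSEQ_subseq_LIMSEQ[OF _ q(1), of "\<lambda>n. x (r n) i" "l i"] by (simp add: o_def)
  qed
  then show ?case using strict_mono_o[OF r(1) q(1)] by blast
qed

lemma tendsto_of_inverse_Suc_bound: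
  assumes "\<And>n. \<bar>f n - (l::real)\<bar> < inverse (real (Suc n))"
  shows "f \<longlonglongrightarrow> l"
proof (rule LIM_zero_cancel, rule Lim_null_comparison[OF _ LIMSEQ_inverse_real_of_nat])
  show "\<forall>\<^sub>F n in sequentially. norm (f n - l) \<le> inverse (real (Suc n))"
    using assms by (intro always_eventually) (simp add: less_imp_le)
qed

text \<open>Divided by their l1-norms \<open>s\<close>, the relations have a subsequence that
  converges to a relation of norm 1. As \<open>s\<close> is positive, weak inequalities for the
  coefficients pass to the limit.\<close>

lemma kernel_limit:
  fixes v :: "'j \<Rightarrow> 'k \<Rightarrow> real"
  assumes J: "finite J" and w: "\<And>n j k. j \<in> J \<Longrightarrow> k \<in> K \<Longrightarrow> \<bar>w n j k - v j k\<bar> < inverse (real (Suc n))"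
    and nz: "\<And>n. \<exists>j\<in>J. c n j \<noteq> 0" and ker: "\<And>n k. k \<in> K \<Longrightarrow> (\<Sum>j\<in>J. c n j * w n j k) = 0"
  shows "\<exists>s d l. (\<forall>n. s n > 0) \<and> (\<forall>j\<in>J. (\<lambda>n. c (d n) j / s n) \<longlonglongrightarrow> l j) \<and>
    (\<exists>j\<in>J. l j \<noteq> 0) \<and> (\<forall>k\<in>K. (\<Sum>j\<in>J. l j * v j k) = 0)"
proof -
  define s where "s n = (\<Sum>j\<in>J. \<bar>c n j\<bar>)" for n
  have s: "s n > 0" for n
  proof -
    obtain j where "j \<in> J" "c n j \<noteq> 0" using nz by blast
    then show ?thesis unfolding s_def by (intro sum_pos2[of J j]) (use J in auto)
  qed
  define d where "d n j = c n j / s n" for n j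
  have d1: "(\<Sum>j\<in>J. \<bar>d n j\<bar>) = 1" for n
    using s[of n] by (simp add: d_def s_def abs_divide flip: sum_divide_distrib)
  have dker: "(\<Sum>j\<in>J. d n j * w n j k) = 0" if "k \<in> K" for n k
    using ker[OF that, of n] by (simp add: d_def flip: sum_divide_distrib)
  have "\<bar>d n j\<bar> \<le> 1" if "j \<in> J" for n j
    using d1[of n] member_le_sum[of j J "\<lambda>j. \<bar>d n j\<bar>"] J that by auto
  then obtain r l where r: "strict_mono (r :: nat \<Rightarrow> nat)" "\<forall>j\<in>J. (\<lambda>n. d (r n) j) \<longlonglongrightarrow> l j"
    using finite_bounded_subseq[of J d 1] J by blast
  have "(\<lambda>n. \<Sum>j\<in>J. \<bar>d (r n) j\<bar>) \<longlonglongrightarrow> (\<Sum>j\<in>J. \<bar>l j\<bar>)" using r(2) by (intro tendsto_intros) auto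
  then have "(\<Sum>j\<in>J. \<bar>l j\<bar>) = 1" using d1 by (simp add: LIMSEQ_const_iff)
  then have "\<exists>j\<in>J. l j \<noteq> 0" by (metis abs_zero sum.neutral zero_neq_one)
  moreover have "(\<Sum>j\<in>J. l j * v j k) = 0" if "k \<in> K" for k
  proof -
    have "(\<lambda>n. w (r n) j k) \<longlonglongrightarrow> v j k" if "j \<in> J" for j
      using LIMSEQ_subseq_LIMSEQ[OF tendsto_of_inverse_Suc_bound[OF w[OF that \<open>k \<in> K\<close>]] r(1)] by (simp add: o_def)
    then have "(\<lambda>n. \<Sum>j\<in>J. d (r n) j * w (r n) j k) \<longlonglongrightarrow> (\<Sum>j\<in>J. l j * v j k)"
      using r(2) by (intro tendsto_sum tendsto_mult) auto
    then show ?thesis using dker[OF that] by (simp add: LIMSEQ_const_iff)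
  qed
  ultimately show ?thesis
    using s r(2) unfolding d_def by (intro exI[of _ "\<lambda>n. s (r n)"] exI[of _ r] exI[of _ l] conjI) auto
qed

lemma not_pos_dep_robust:
  fixes v :: "'j \<Rightarrow> 'k \<Rightarrow> real"
  assumes fin: "finite J" "J \<noteq> {}"
    and none: "\<And>c. (\<forall>j\<in>J. c j \<ge> 0) \<Longrightarrow> (\<forall>k\<in>K. (\<Sum>j\<in>J. c j * v j k) = 0) \<Longrightarrow> \<forall>j\<in>J. c j = 0"
  shows "\<exists>e>0. \<forall>w. (\<forall>j\<in>J. \<forall>k\<in>K. \<bar>w j k - v j k\<bar> < e) \<longrightarrow> \<not> pos_dep K J w"
proof (rule ccontr)
  assume "\<not> ?thesis"
  then have "\<exists>w. (\<forall>j\<in>J. \<forall>k\<in>K. \<bar>w j k - v j k\<bar> < inverse (real (Suc n))) \<and> pos_dep K J w" for n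
    by (metis inverse_positive_iff_positive of_nat_0_less_iff zero_less_Suc)
  then obtain w where w: "\<And>n j k. j \<in> J \<Longrightarrow> k \<in> K \<Longrightarrow> \<bar>w n j k - v j k\<bar> < inverse (real (Suc n))"
    "\<And>n. pos_dep K J (w n)" by metis
  from w(2) obtain c where c: "\<And>n j. j \<in> J \<Longrightarrow> c n j > 0" "\<And>n k. k \<in> K \<Longrightarrow> (\<Sum>j\<in>J. c n j * w n j k) = 0"
    unfolding pos_dep_def by metis
  have nz: "\<exists>j\<in>J. c n j \<noteq> 0" for n using c(1) fin(2) by (metis all_not_in_conv less_irrefl)
  have "\<exists>s d l. (\<forall>n. s n > 0) \<and> (\<forall>j\<in>J. (\<lambda>n. c (d n) j / s n) \<longlonglongrightarrow> l j) \<and>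
    (\<exists>j\<in>J. l j \<noteq> 0) \<and> (\<forall>k\<in>K. (\<Sum>j\<in>J. l j * v j k) = 0)"
    by (rule kernel_limit[where w = w, OF fin(1) w(1) nz c(2)])
  then obtain s d l where l: "\<forall>n. s n > 0" "\<forall>j\<in>J. (\<lambda>n. c (d n) j / s n) \<longlonglongrightarrow> l j"
    "\<exists>j\<in>J. l j \<noteq> 0" "\<forall>k\<in>K. (\<Sum>j\<in>J. l j * v j k) = 0" by (elim exE conjE)
  have "l j \<ge> 0" if "j \<in> J" for j
    by (rule LIMSEQ_le_const[OF bspec[OF l(2) that]]) (use l(1) c(1)[OF that] in \<open>auto simp: less_imp_le\<close>)
  then show False using none l(3,4) by blast
qed

text \<open>Suitably scaled relations of nearby vectors converge to a nonzero multiple of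
  \<open>p\<close>; divided by the factor, they are eventually positive.\<close>

lemma pos_dep_robust:
  fixes v :: "'j \<Rightarrow> 'k \<Rightarrow> real"
  assumes fin: "finite J" "finite K" "card K < card J"
    and ppos: "\<And>j. j \<in> J \<Longrightarrow> p j > 0"
    and uniq: "\<And>c. (\<forall>k\<in>K. (\<Sum>j\<in>J. c j * v j k) = 0) \<Longrightarrow> \<exists>s. \<forall>j\<in>J. c j = s * p j"
  shows "\<exists>e>0. \<forall>w. (\<forall>j\<in>J. \<forall>k\<in>K. \<bar>w j k - v j k\<bar> < e) \<longrightarrow> pos_dep K J w"
proof (rule ccontr)
  assume "\<not> ?thesis"
  then have "\<exists>w. (\<forall>j\<in>J. \<forall>k\<in>K. \<bar>w j k - v j k\<bar> < inverse (real (Suc n))) \<and> \<not> pos_dep K J w" for n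
    by (metis inverse_positive_iff_positive of_nat_0_less_iff zero_less_Suc)
  then obtain w where w: "\<And>n j k. j \<in> J \<Longrightarrow> k \<in> K \<Longrightarrow> \<bar>w n j k - v j k\<bar> < inverse (real (Suc n))"
    "\<And>n. \<not> pos_dep K J (w n)" by metis
  have "\<exists>c. (\<exists>j\<in>J. c j \<noteq> 0) \<and> (\<forall>k\<in>K. (\<Sum>j\<in>J. c j * w n j k) = 0)" for n
    by (rule nontrivial_kernel) (use fin in auto)
  then obtain c where c: "\<And>n. \<exists>j\<in>J. c n j \<noteq> 0" "\<And>n k. k \<in> K \<Longrightarrow> (\<Sum>j\<in>J. c n j * w n j k) = 0"
    by metis
  have "\<exists>s d l. (\<forall>n. s n > 0) \<and> (\<forall>j\<in>J. (\<lambda>n. c (d n) j / s n) \<longlonglongrightarrow> l j) \<and>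
    (\<exists>j\<in>J. l j \<noteq> 0) \<and> (\<forall>k\<in>K. (\<Sum>j\<in>J. l j * v j k) = 0)"
    by (rule kernel_limit[where w = w, OF fin(1) w(1) c])
  then obtain s d l where l: "\<forall>n. s n > 0" "\<forall>j\<in>J. (\<lambda>n. c (d n) j / s n) \<longlonglongrightarrow> l j"
    "\<exists>j\<in>J. l j \<noteq> 0" "\<forall>k\<in>K. (\<Sum>j\<in>J. l j * v j k) = 0" by (elim exE conjE)
  obtain t where t: "\<forall>j\<in>J. l j = t * p j" using uniq l(4) by blast
  have "t \<noteq> 0" using t l(3) by auto
  have "\<forall>\<^sub>F n in sequentially. \<forall>j\<in>J. c (d n) j / s n / t > 0"
  proof (rule eventually_ball_finite[OF fin(1)], rule ballI)
    fix j assume j: "j \<in> J"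
    have "(\<lambda>n. c (d n) j / s n / t) \<longlonglongrightarrow> l j / t" using bspec[OF l(2) j] \<open>t \<noteq> 0\<close> by (intro tendsto_divide) auto
    moreover have "l j / t > 0" using t j \<open>t \<noteq> 0\<close> ppos by simp
    ultimately show "\<forall>\<^sub>F n in sequentially. c (d n) j / s n / t > 0" by (rule order_tendstoD)
  qed
  then obtain n where n: "\<forall>j\<in>J. c (d n) j / s n / t > 0" using eventually_happens' sequentially_bot by blast
  have "\<forall>k\<in>K. (\<Sum>j\<in>J. c (d n) j / s n / t * w (d n) j k) = 0"
    using c(2) by (simp flip: sum_divide_distrib)
  then have "pos_dep K J (w (d n))"
    using n unfolding pos_dep_def by (intro exI[of _ "\<lambda>j. c (d n) j / s n / t"]) auto
  then show False using w(2) by blast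
qed

section \<open>Chains in a glued product complex\<close>

text \<open>\<open>T\<close> coordinates run through the cube of rotation parameters. The others are
  homogeneous coordinates of the projective space: \<open>D v\<close> is mapped by the model into
  the plane that rotates at \<open>v\<close>, \<open>E\<close> is the added dimension, and
  \<open>X\<close> holds what the model maps identically.\<close>

datatype ('v, 'x) coord = is_T: T 'v | D 'v | E | X 'x

definition neg_at :: "('v, 'x) coord \<Rightarrow> int \<Rightarrow> int"
  where "neg_at c z = (if is_T c then z else - z)"

definition swap_next :: "nat \<Rightarrow> nat \<Rightarrow> nat"
  where "swap_next i k = (if k = i then Suc i else if k = Suc i then i else k)"

lemma swap_next_involutive [simp]: "swap_next i (swap_next i k) = k"
  by (simp add: swap_next_def)

text \<open>The two faces of the cube in direction \<open>v\<close> are identified by means of the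
  permutation \<open>\<sigma> v\<close> of the nodes and of the signed permutation of the auxiliary
  coordinates given by \<open>\<sigma>X v\<close> and \<open>\<epsilon> v\<close>. In the
  application \<open>\<sigma> v\<close> exchanges the two subtrees below \<open>v\<close>.\<close>

locale gluing =
  fixes V :: "'v set" and Xs :: "'x set"
    and \<sigma> :: "'v \<Rightarrow> 'v \<Rightarrow> 'v" and \<sigma>X :: "'v \<Rightarrow> 'x \<Rightarrow> 'x" and \<epsilon> :: "'v \<Rightarrow> 'x \<Rightarrow> int"
  assumes finV: "finite V" and V_ne: "V \<noteq> {}" and finX: "finite Xs"
    and \<sigma>_V: "\<And>v w. v \<in> V \<Longrightarrow> w \<in> V \<Longrightarrow> \<sigma> v w \<in> V"
    and \<sigma>_\<sigma>: "\<And>v w. \<sigma> v (\<sigma> v w) = w" and \<sigma>_self: "\<And>v. \<sigma> v v = v"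
    and \<sigma>X_X: "\<And>v x. v \<in> V \<Longrightarrow> x \<in> Xs \<Longrightarrow> \<sigma>X v x \<in> Xs"
    and \<sigma>X_\<sigma>X: "\<And>v x. \<sigma>X v (\<sigma>X v x) = x"
    and \<epsilon>_cases: "\<And>v x. \<epsilon> v x = 1 \<or> \<epsilon> v x = -1" and \<epsilon>_\<sigma>X: "\<And>v x. \<epsilon> v (\<sigma>X v x) = \<epsilon> v x"
begin

definition Co :: "('v, 'x) coord set"
  where "Co = T ` V \<union> D ` V \<union> {E} \<union> X ` Xs"

definition N :: nat
  where "N = card Xs + 2 * card V"

fun perm :: "'v \<Rightarrow> ('v, 'x) coord \<Rightarrow> ('v, 'x) coord" where
  "perm v (T w) = T (\<sigma> v w)"
| "perm v (D w) = D (\<sigma> v w)"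
| "perm v E = E"
| "perm v (X x) = X (\<sigma>X v x)"

fun sg :: "'v \<Rightarrow> ('v, 'x) coord \<Rightarrow> int" where
  "sg v (T w) = 1"
| "sg v (D w) = (if w = v then -1 else 1)"
| "sg v E = 1"
| "sg v (X x) = \<epsilon> v x"

text \<open>Meant for \<open>y (T v)\<close> equal to 0 or \<open>2 * K\<close>; being an involution
  on all integers, it also carries along the edge that ends in the face.\<close>

definition glue :: "int \<Rightarrow> 'v \<Rightarrow> (('v, 'x) coord \<Rightarrow> int) \<Rightarrow> ('v, 'x) coord \<Rightarrow> int"
  where "glue K v y c = (if c = T v then 2 * K - y c else sg v c * y (perm v c))"

lemma finite_Co: "finite Co"
  using finV finX by (simp add: Co_def)

lemma card_Co: "card Co = Suc N"
proof -
  have "card (T ` V \<union> D ` V \<union> {E} \<union> X ` Xs :: ('v, 'x) coord set) =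
      card (T ` V :: ('v, 'x) coord set) + card (D ` V :: ('v, 'x) coord set) + 1 + card (X ` Xs :: ('v, 'x) coord set)"
    using finV finX by (subst card_Un_disjoint; (subst card_Un_disjoint)?; (subst card_Un_disjoint)?; auto)
  also have "\<dots> = card V + card V + 1 + card Xs"
    by (simp add: card_image inj_on_def)
  finally show ?thesis by (simp add: Co_def N_def)
qed

lemma N_pos: "N > 0"
  using finV V_ne by (simp add: N_def card_gt_0_iff)

lemma perm_perm [simp]: "perm v (perm v c) = c"
  by (cases c) (auto simp: \<sigma>_\<sigma> \<sigma>X_\<sigma>X)

lemma perm_Co: "v \<in> V \<Longrightarrow> c \<in> Co \<Longrightarrow> perm v c \<in> Co"
  by (auto simp: Co_def \<sigma>_V \<sigma>X_X)

lemma perm_Co_iff: "v \<in> V \<Longrightarrow> perm v c \<in> Co \<longleftrightarrow> c \<in> Co"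
  using perm_Co[of v c] perm_Co[of v "perm v c"] by auto

lemma perm_eq_T_iff [simp]: "perm v c = T v \<longleftrightarrow> c = T v"
  by (metis perm.simps(1) perm_perm \<sigma>_self)

lemma perm_eq_E_iff [simp]: "perm v c = E \<longleftrightarrow> c = E"
  by (cases c) auto

lemma is_T_perm [simp]: "is_T (perm v c) = is_T c"
  by (cases c) auto

lemma sg_cases: "sg v c = 1 \<or> sg v c = -1"
  by (cases c) (auto simp: \<epsilon>_cases)

lemma sg_sq [simp]: "sg v c * (sg v c * z) = z"
  using sg_cases[of v c] by auto

lemma sg_perm [simp]: "sg v (perm v c) = sg v c"
  by (cases c) (auto simp: \<epsilon>_\<sigma>X \<sigma>_self, metis \<sigma>_\<sigma> \<sigma>_self)

lemma sg_T: "is_T c \<Longrightarrow> sg v c = 1"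
  by (cases c) auto

lemma glue_glue [simp]: "glue K v (glue K v y) = y"
  by (auto simp: glue_def fun_eq_iff)

type_synonym ('a, 'b) chain = "(('a, 'b) coord \<Rightarrow> nat) \<times> (('a, 'b) coord \<Rightarrow> int) \<times> (('a, 'b) coord \<Rightarrow> int)"

text \<open>
  A chain of cells of dimensions \<open>0, \<dots>, N\<close>: the coordinate \<open>c\<close> moves from \<open>lo c\<close> to \<open>hi c\<close> at time
  \<open>\<tau> c\<close>. Even values of a \<open>T\<close>-coordinate are grid points, odd values are the edges between them; the
  other coordinates are signs. Normalising the sign of \<open>E\<close> picks one of each pair of antipodal chains.
\<close>

definition chains :: "int \<Rightarrow> ('v, 'x) chain set"
  where "chains K = {(\<tau>, lo, hi). bij_betw \<tau> Co {..N} \<and>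
    (\<forall>c. c \<notin> Co \<longrightarrow> \<tau> c = Suc N \<and> lo c = 0 \<and> hi c = 0) \<and>
    (\<forall>c\<in>Co. is_T c \<longrightarrow> even (lo c) \<and> 0 \<le> lo c \<and> lo c \<le> 2 * K \<and> \<bar>hi c - lo c\<bar> = 1 \<and>
       0 \<le> hi c \<and> hi c \<le> 2 * K \<and> \<tau> c \<noteq> 0) \<and>
    (\<forall>c\<in>Co. \<not> is_T c \<longrightarrow> lo c = 0 \<and> \<bar>hi c\<bar> = 1) \<and> hi E = 1}"

fun vertex :: "('v, 'x) chain \<Rightarrow> nat \<Rightarrow> ('v, 'x) coord \<Rightarrow> int" where
  "vertex (\<tau>, lo, hi) j c = (if \<tau> c \<le> j then hi c else lo c)"

definition moved :: "(('v, 'x) coord \<Rightarrow> nat) \<Rightarrow> nat \<Rightarrow> ('v, 'x) coord"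
  where "moved \<tau> i = inv_into Co \<tau> i"

text \<open>The other chain through the facet that misses rank \<open>i\<close>. At inner ranks two
  successive moves are exchanged. A \<open>T\<close> coordinate cannot come first, since then all
  sphere coordinates would be 0, so at rank 0 its edge is entered from the other end instead. At
  rank N the last move goes the other way; if it leaves the interval, the chain continues behind the
  glued face, and for \<open>E\<close> the antipode restores \<open>hi E = 1\<close>.\<close>

fun flip :: "int \<Rightarrow> nat \<Rightarrow> ('v, 'x) chain \<Rightarrow> ('v, 'x) chain" where
  "flip K i (\<tau>, lo, hi) =
    (if i < N then
       (if i = 0 \<and> is_T (moved \<tau> 1) then (\<tau>, lo(moved \<tau> 1 := 2 * hi (moved \<tau> 1) - lo (moved \<tau> 1)), hi)
        else (\<lambda>c. swap_next i (\<tau> c), lo, hi))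
     else
       (let a = moved \<tau> N in
        if a = E then (\<tau>, lo, \<lambda>c. if c = E then hi c else neg_at c (hi c))
        else if is_T a \<and> \<not> (0 \<le> 2 * lo a - hi a \<and> 2 * lo a - hi a \<le> 2 * K) then
          (let v = (THE v. a = T v) in (\<lambda>c. \<tau> (perm v c), glue K v lo, glue K v hi))
        else (\<tau>, lo, hi(a := 2 * lo a - hi a))))"

lemma moved_time:
  assumes "bij_betw \<tau> Co {..N}"
  shows "c \<in> Co \<Longrightarrow> moved \<tau> (\<tau> c) = c" "i \<le> N \<Longrightarrow> moved \<tau> i \<in> Co" "i \<le> N \<Longrightarrow> \<tau> (moved \<tau> i) = i"
  using assms unfolding moved_def
  by (auto simp: bij_betw_def inv_into_into f_inv_into_f inv_into_f_f)

lemma moved_eqI: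
  assumes "bij_betw \<tau> Co {..N}" "c \<in> Co" "\<tau> c = i"
  shows "moved \<tau> i = c"
  using moved_time(1)[OF assms(1,2)] assms(3) by simp

lemma chainsD:
  assumes "(\<tau>, lo, hi) \<in> chains K"
  shows "bij_betw \<tau> Co {..N}" "c \<notin> Co \<Longrightarrow> \<tau> c = Suc N \<and> lo c = 0 \<and> hi c = 0"
    "c \<in> Co \<Longrightarrow> is_T c \<Longrightarrow> even (lo c) \<and> 0 \<le> lo c \<and> lo c \<le> 2 * K \<and> \<bar>hi c - lo c\<bar> = 1 \<and> 0 \<le> hi c \<and> hi c \<le> 2 * K \<and> \<tau> c \<noteq> 0"
    "c \<in> Co \<Longrightarrow> \<not> is_T c \<Longrightarrow> lo c = 0 \<and> \<bar>hi c\<bar> = 1" "hi E = 1"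
  using assms unfolding chains_def by auto

lemma chainsI:
  assumes "bij_betw \<tau> Co {..N}" "\<And>c. c \<notin> Co \<Longrightarrow> \<tau> c = Suc N \<and> lo c = 0 \<and> hi c = 0"
    "\<And>c. c \<in> Co \<Longrightarrow> is_T c \<Longrightarrow> even (lo c) \<and> 0 \<le> lo c \<and> lo c \<le> 2 * K \<and> \<bar>hi c - lo c\<bar> = 1 \<and> 0 \<le> hi c \<and> hi c \<le> 2 * K \<and> \<tau> c \<noteq> 0"
    "\<And>c. c \<in> Co \<Longrightarrow> \<not> is_T c \<Longrightarrow> lo c = 0 \<and> \<bar>hi c\<bar> = 1" "hi E = 1"
  shows "(\<tau>, lo, hi) \<in> chains K"
  using assms unfolding chains_def by auto

lemma finite_chains: "finite (chains K)"
proof -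
  let ?A = "{f. \<forall>c. (c \<in> Co \<longrightarrow> f c \<in> {..N}) \<and> (c \<notin> Co \<longrightarrow> f c = Suc N)}"
  let ?B = "{f. \<forall>c. (c \<in> Co \<longrightarrow> f c \<in> {-1..max 1 (2 * K)}) \<and> (c \<notin> Co \<longrightarrow> f c = 0)}"
  have "chains K \<subseteq> ?A \<times> ?B \<times> ?B"
  proof
    fix C assume C: "C \<in> chains K"
    obtain \<tau> lo hi where eq: "C = (\<tau>, lo, hi)" by (cases C) auto
    note d = chainsD[OF C[unfolded eq]]
    have "\<tau> c \<le> N" if "c \<in> Co" for c using bij_betwE[OF d(1)] that by blast
    moreover have "- 1 \<le> lo c \<and> lo c \<le> max 1 (2 * K) \<and> - 1 \<le> hi c \<and> hi c \<le> max 1 (2 * K)" if "c \<in> Co" for c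
      using d(3)[OF that] d(4)[OF that] by (cases "is_T c") auto
    ultimately show "C \<in> ?A \<times> ?B \<times> ?B" using d(2) by (auto simp: eq)
  qed
  moreover have "finite (?A \<times> ?B \<times> ?B)"
    by (intro finite_cartesian_product finite_set_of_finite_funs finite_Co) auto
  ultimately show ?thesis by (rule finite_subset)
qed

text \<open>The common facet appears in the other chain unchanged, negated or glued; each
  alternative yields an instance of the hypothesis \<open>rel\<close> of
  \<open>parity_invariance\<close>.\<close>

definition flip_ok :: "int \<Rightarrow> nat \<Rightarrow> ('v, 'x) chain \<Rightarrow> bool"
  where "flip_ok K i C \<longleftrightarrow> flip K i C \<in> chains K \<and> flip K i (flip K i C) = C \<and> flip K i C \<noteq> C \<and>
    ((\<forall>j\<le>N. j \<noteq> i \<longrightarrow> vertex (flip K i C) j = vertex C j) \<or>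
     (\<forall>j\<le>N. j \<noteq> i \<longrightarrow> vertex (flip K i C) j = (\<lambda>c. neg_at c (vertex C j c)) \<and> vertex C j E = 0) \<or>
     (\<exists>v\<in>V. \<forall>j\<le>N. j \<noteq> i \<longrightarrow> vertex (flip K i C) j = glue K v (vertex C j) \<and>
        vertex C j (T v) \<in> {0, 2 * K}))"

lemma flip_ok_first:
  assumes C: "(\<tau>, lo, hi) \<in> chains K" and T: "is_T (moved \<tau> 1)"
  shows "flip_ok K 0 (\<tau>, lo, hi)"
proof -
  note d = chainsD[OF C]
  define b where "b = moved \<tau> 1"
  have b: "b \<in> Co" "\<tau> b = 1" using moved_time(2,3)[OF d(1), of 1] N_pos by (auto simp: b_def)
  have Tb: "is_T b" using T by (simp add: b_def)
  have b1: "moved \<tau> (Suc 0) = b" by (simp add: b_def)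
  define lo' where "lo' = lo(b := 2 * hi b - lo b)"
  have f: "flip K 0 (\<tau>, lo, hi) = (\<tau>, lo', hi)"
    using T N_pos by (simp add: b_def lo'_def)
  \<comment> \<open>\<open>hi b\<close> is odd, hence strictly between the even bounds 0 and
    \<open>2 * K\<close>, and both its neighbours are grid points.\<close>
  have odd: "even (2 * hi b - lo b)" "\<bar>hi b - (2 * hi b - lo b)\<bar> = 1" "2 * hi b - lo b \<noteq> lo b"
    "0 \<le> 2 * hi b - lo b" "2 * hi b - lo b \<le> 2 * K"
    using d(3)[OF b(1) Tb] by (auto simp: abs_if split: if_splits) presburger+
  have mem: "(\<tau>, lo', hi) \<in> chains K"
  proof (rule chainsI)
    show "c \<in> Co \<Longrightarrow> is_T c \<Longrightarrow> even (lo' c) \<and> 0 \<le> lo' c \<and> lo' c \<le> 2 * K \<and> \<bar>hi c - lo' c\<bar> = 1 \<and> 0 \<le> hi c \<and> hi c \<le> 2 * K \<and> \<tau> c \<noteq> 0" for c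
      using d(3)[of c] odd by (simp add: lo'_def)
    show "c \<in> Co \<Longrightarrow> \<not> is_T c \<Longrightarrow> lo' c = 0 \<and> \<bar>hi c\<bar> = 1" for c
      using d(4)[of c] Tb by (auto simp: lo'_def)
    show "c \<notin> Co \<Longrightarrow> \<tau> c = Suc N \<and> lo' c = 0 \<and> hi c = 0" for c
      using d(2)[of c] b by (auto simp: lo'_def)
  qed (use d in auto)
  have ff: "flip K 0 (\<tau>, lo', hi) = (\<tau>, lo, hi)"
    using Tb N_pos b1 by (auto simp: lo'_def)
  have "lo' \<noteq> lo" using odd(3) by (auto simp: lo'_def fun_eq_iff)
  moreover have "\<forall>j\<le>N. j \<noteq> 0 \<longrightarrow> vertex (\<tau>, lo', hi) j = vertex (\<tau>, lo, hi) j"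
    using b by (auto simp: fun_eq_iff lo'_def)
  ultimately show ?thesis unfolding flip_ok_def f ff using mem by blast
qed

lemma flip_ok_swap:
  assumes C: "(\<tau>, lo, hi) \<in> chains K" and i: "i < N" "\<not> (i = 0 \<and> is_T (moved \<tau> 1))"
  shows "flip_ok K i (\<tau>, lo, hi)"
proof -
  note d = chainsD[OF C]
  define \<tau>' where "\<tau>' = (\<lambda>c. swap_next i (\<tau> c))"
  have f: "flip K i (\<tau>, lo, hi) = (\<tau>', lo, hi)" using i by (auto simp: \<tau>'_def)
  have "bij_betw (swap_next i) {..N} {..N}"
    by (rule bij_betw_byWitness[where f' = "swap_next i"]) (use i in \<open>auto simp: swap_next_def\<close>)
  from bij_betw_trans[OF d(1) this] have bij: "bij_betw \<tau>' Co {..N}" by (simp add: \<tau>'_def o_def)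
  have T0: "\<tau>' c \<noteq> 0" if "c \<in> Co" "is_T c" for c
  proof
    assume "\<tau>' c = 0"
    with d(3)[OF that] have "i = 0" "\<tau> c = 1" by (auto simp: \<tau>'_def swap_next_def split: if_splits)
    then show False using moved_eqI[OF d(1) that(1)] i that by auto
  qed
  have mem: "(\<tau>', lo, hi) \<in> chains K"
  proof (rule chainsI[OF bij])
    show "c \<in> Co \<Longrightarrow> is_T c \<Longrightarrow> even (lo c) \<and> 0 \<le> lo c \<and> lo c \<le> 2 * K \<and> \<bar>hi c - lo c\<bar> = 1 \<and> 0 \<le> hi c \<and> hi c \<le> 2 * K \<and> \<tau>' c \<noteq> 0" for c
      using d(3)[of c] T0 by blast
    show "c \<notin> Co \<Longrightarrow> \<tau>' c = Suc N \<and> lo c = 0 \<and> hi c = 0" for c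
      using d(2)[of c] i by (auto simp: \<tau>'_def swap_next_def)
  qed (use d in auto)
  have "\<not> (i = 0 \<and> is_T (moved \<tau>' 1))"
  proof
    assume A: "i = 0 \<and> is_T (moved \<tau>' 1)"
    have "moved \<tau> 0 \<in> Co" "\<tau> (moved \<tau> 0) = 0" using moved_time(2,3)[OF d(1), of 0] by auto
    moreover from this have "moved \<tau>' 1 = moved \<tau> 0"
      using A by (intro moved_eqI[OF bij]) (auto simp: \<tau>'_def swap_next_def)
    ultimately show False using d(3)[of "moved \<tau> 0"] A by auto
  qed
  then have ff: "flip K i (\<tau>', lo, hi) = (\<tau>, lo, hi)" using i by (auto simp: \<tau>'_def)
  have "\<tau>' (moved \<tau> i) \<noteq> \<tau> (moved \<tau> i)"
    using moved_time(3)[OF d(1), of i] i by (simp add: \<tau>'_def swap_next_def)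
  then have "\<tau>' \<noteq> \<tau>" by metis
  moreover have "\<forall>j\<le>N. j \<noteq> i \<longrightarrow> vertex (\<tau>', lo, hi) j = vertex (\<tau>, lo, hi) j"
    by (auto simp: fun_eq_iff \<tau>'_def swap_next_def)
  ultimately show ?thesis unfolding flip_ok_def f ff using mem by blast
qed

lemma flip_ok_last_hi:
  assumes C: "(\<tau>, lo, hi) \<in> chains K" and a: "a = moved \<tau> N" "a \<noteq> E"
    and range: "is_T a \<Longrightarrow> 0 \<le> 2 * lo a - hi a \<and> 2 * lo a - hi a \<le> 2 * K"
  shows "flip_ok K N (\<tau>, lo, hi)"
proof -
  note d = chainsD[OF C]
  have aCo: "a \<in> Co" "\<tau> a = N" using moved_time(2,3)[OF d(1), of N] a by auto
  define hi' where "hi' = hi(a := 2 * lo a - hi a)"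
  have f: "flip K N (\<tau>, lo, hi) = (\<tau>, lo, hi')"
    using a range by (auto simp: hi'_def Let_def)
  have ff: "flip K N (\<tau>, lo, hi') = (\<tau>, lo, hi)"
    using a range d(3)[OF aCo(1)] by (auto simp: hi'_def Let_def)
  have mem: "(\<tau>, lo, hi') \<in> chains K"
  proof (rule chainsI)
    show "c \<in> Co \<Longrightarrow> is_T c \<Longrightarrow> even (lo c) \<and> 0 \<le> lo c \<and> lo c \<le> 2 * K \<and> \<bar>hi' c - lo c\<bar> = 1 \<and> 0 \<le> hi' c \<and> hi' c \<le> 2 * K \<and> \<tau> c \<noteq> 0" for c
      using d(3)[of c] range by (auto simp: hi'_def abs_minus_commute)
    show "c \<in> Co \<Longrightarrow> \<not> is_T c \<Longrightarrow> lo c = 0 \<and> \<bar>hi' c\<bar> = 1" for c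
      using d(4)[of c] by (auto simp: hi'_def)
    show "c \<notin> Co \<Longrightarrow> \<tau> c = Suc N \<and> lo c = 0 \<and> hi' c = 0" for c
      using d(2)[of c] aCo by (auto simp: hi'_def)
    show "hi' E = 1" using d(5) a by (simp add: hi'_def)
  qed (use d in auto)
  have "2 * lo a - hi a \<noteq> hi a" using d(3)[OF aCo(1)] d(4)[OF aCo(1)] by (cases "is_T a") auto
  then have "hi' \<noteq> hi" by (auto simp: hi'_def fun_eq_iff)
  moreover have "\<forall>j\<le>N. j \<noteq> N \<longrightarrow> vertex (\<tau>, lo, hi') j = vertex (\<tau>, lo, hi) j"
    using aCo by (auto simp: fun_eq_iff hi'_def)
  ultimately show ?thesis unfolding flip_ok_def f ff using mem by blast
qed

lemma flip_ok_last_E: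
  assumes C: "(\<tau>, lo, hi) \<in> chains K" and a: "moved \<tau> N = E"
  shows "flip_ok K N (\<tau>, lo, hi)"
proof -
  note d = chainsD[OF C]
  have aCo: "E \<in> Co" "\<tau> E = N" using moved_time(2,3)[OF d(1), of N] a by auto
  define hi' where "hi' = (\<lambda>c. if c = E then hi c else neg_at c (hi c))"
  have f: "flip K N (\<tau>, lo, hi) = (\<tau>, lo, hi')" using a by (simp add: hi'_def)
  have ff: "flip K N (\<tau>, lo, hi') = (\<tau>, lo, hi)" using a by (auto simp: hi'_def neg_at_def)
  have mem: "(\<tau>, lo, hi') \<in> chains K"
    by (rule chainsI) (use d in \<open>auto simp: hi'_def neg_at_def\<close>)
  \<comment> \<open>A sphere coordinate other than \<open>E\<close> makes the antipodal chain a
    different one.\<close>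
  obtain v where v: "v \<in> V" using V_ne by blast
  then have "\<bar>hi (D v)\<bar> = 1" using d(4)[of "D v"] by (simp add: Co_def)
  then have "hi' (D v) \<noteq> hi (D v)" by (auto simp: hi'_def neg_at_def)
  then have "hi' \<noteq> hi" by metis
  moreover have "vertex (\<tau>, lo, hi') j = (\<lambda>c. neg_at c (vertex (\<tau>, lo, hi) j c)) \<and> vertex (\<tau>, lo, hi) j E = 0"
    if "j \<le> N" "j \<noteq> N" for j
  proof
    have lo0: "lo c = 0" if "\<not> is_T c" for c using that d(2)[of c] d(4)[of c] by (cases "c \<in> Co") auto
    show "vertex (\<tau>, lo, hi) j E = 0" using aCo that lo0[of E] by auto
    show "vertex (\<tau>, lo, hi') j = (\<lambda>c. neg_at c (vertex (\<tau>, lo, hi) j c))"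
      using that aCo lo0 by (auto simp: fun_eq_iff hi'_def neg_at_def)
  qed
  ultimately show ?thesis unfolding flip_ok_def f ff using mem by blast
qed

lemma flip_ok_last_glue:
  assumes K: "K \<ge> 1" and C: "(\<tau>, lo, hi) \<in> chains K" and a: "moved \<tau> N = T v"
    and range: "\<not> (0 \<le> 2 * lo (T v) - hi (T v) \<and> 2 * lo (T v) - hi (T v) \<le> 2 * K)"
  shows "flip_ok K N (\<tau>, lo, hi)"
proof -
  note d = chainsD[OF C]
  have aCo: "T v \<in> Co" "\<tau> (T v) = N" using moved_time(2,3)[OF d(1), of N] a by auto
  then have v: "v \<in> V" by (auto simp: Co_def)
  define \<tau>' where "\<tau>' = (\<lambda>c. \<tau> (perm v c))"
  have f: "flip K N (\<tau>, lo, hi) = (\<tau>', glue K v lo, glue K v hi)"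
    using a range by (simp add: Let_def \<tau>'_def del: not_le)
  have "bij_betw (perm v) Co Co"
    by (rule bij_betw_byWitness[where f' = "perm v"]) (use perm_Co v in auto)
  from bij_betw_trans[OF this d(1)] have bij: "bij_betw \<tau>' Co {..N}" by (simp add: \<tau>'_def o_def)
  have lohi: "even (lo (T v)) \<and> 0 \<le> lo (T v) \<and> lo (T v) \<le> 2 * K \<and> \<bar>hi (T v) - lo (T v)\<bar> = 1 \<and> 0 \<le> hi (T v) \<and> hi (T v) \<le> 2 * K"
    using d(3)[OF aCo(1)] by simp
  \<comment> \<open>An even \<open>lo\<close> with a neighbour outside the interval is an end of the
    interval.\<close>
  then have lo_cases: "lo (T v) = 0 \<or> lo (T v) = 2 * K" using range by presburger
  have mem: "(\<tau>', glue K v lo, glue K v hi) \<in> chains K"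
  proof (rule chainsI[OF bij])
    fix c
    show "glue K v lo c = 0 \<and> \<bar>glue K v hi c\<bar> = 1" if "c \<in> Co" "\<not> is_T c"
      using d(4)[of "perm v c"] that perm_Co[OF v that(1)] sg_cases[of v c]
      by (auto simp: glue_def)
    show "\<tau>' c = Suc N \<and> glue K v lo c = 0 \<and> glue K v hi c = 0" if "c \<notin> Co"
      using d(2)[of "perm v c"] that aCo(1) by (auto simp: \<tau>'_def glue_def perm_Co_iff[OF v])
    show "even (glue K v lo c) \<and> 0 \<le> glue K v lo c \<and> glue K v lo c \<le> 2 * K \<and> \<bar>glue K v hi c - glue K v lo c\<bar> = 1 \<and>
        0 \<le> glue K v hi c \<and> glue K v hi c \<le> 2 * K \<and> \<tau>' c \<noteq> 0" if "c \<in> Co" "is_T c"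
    proof (cases "c = T v")
      case True
      then show ?thesis using lohi aCo N_pos by (auto simp: glue_def \<tau>'_def \<sigma>_self)
    next
      case False
      then show ?thesis
        using d(3)[of "perm v c"] that perm_Co[OF v that(1)] by (auto simp: glue_def \<tau>'_def sg_T)
    qed
  next
    show "glue K v hi E = 1" using d(5) by (simp add: glue_def)
  qed
  have a': "moved \<tau>' N = T v" using aCo by (intro moved_eqI[OF bij]) (auto simp: \<tau>'_def \<sigma>_self)
  have range': "\<not> (0 \<le> 2 * glue K v lo (T v) - glue K v hi (T v) \<and> 2 * glue K v lo (T v) - glue K v hi (T v) \<le> 2 * K)"
    using range by (auto simp: glue_def)
  have ff: "flip K N (\<tau>', glue K v lo, glue K v hi) = (\<tau>, lo, hi)"
    using a' range' by (simp add: Let_def \<tau>'_def del: not_le)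
  have "glue K v lo (T v) \<noteq> lo (T v)" using lo_cases K by (auto simp: glue_def)
  then have "glue K v lo \<noteq> lo" by metis
  moreover have "vertex (\<tau>', glue K v lo, glue K v hi) j = glue K v (vertex (\<tau>, lo, hi) j) \<and>
     vertex (\<tau>, lo, hi) j (T v) \<in> {0, 2 * K}"
    if "j \<le> N" "j \<noteq> N" for j
    using that aCo lo_cases by (auto simp: fun_eq_iff glue_def \<tau>'_def \<sigma>_self)
  ultimately show ?thesis unfolding flip_ok_def f ff using mem v by blast
qed

lemma flip_ok:
  assumes "K \<ge> 1" "C \<in> chains K" "i \<le> N"
  shows "flip_ok K i C"
proof -
  obtain \<tau> lo hi where C: "C = (\<tau>, lo, hi)" by (cases C) auto
  note mem = assms(2)[unfolded C]
  show ?thesis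
  proof (cases "i < N")
    case True
    then show ?thesis
      using flip_ok_first[OF mem] flip_ok_swap[OF mem True] C by blast
  next
    case False
    then have i: "i = N" using assms by simp
    show ?thesis
    proof (cases "moved \<tau> N")
      case (T v)
      then show ?thesis
        using flip_ok_last_glue[OF assms(1) mem T] flip_ok_last_hi[OF mem] unfolding C i by auto
    qed (use flip_ok_last_hi[OF mem] flip_ok_last_E[OF mem] in \<open>auto simp: C i\<close>)
  qed
qed

end

section \<open>Counting for a model labelling\<close>

text \<open>For K >= 2 the vector (\<open>turn K False t\<close>, \<open>turn K True t\<close>) is
  (1, 0) up to 2, then (0, 1), and (-1, 0) from 2K on: a polygonal half turn that moves only on the
  edges from 2 to 3 and from 2K - 1 to 2K. The first of them touches neither end.\<close>

definition turn :: "int \<Rightarrow> bool \<Rightarrow> int \<Rightarrow> real"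
  where "turn K b t =
    (if b then of_bool (2 < t \<and> t < 2 * K) else if t \<le> 2 then 1 else if t < 2 * K then 0 else -1)"

context gluing
begin

definition Kt :: "('x + 'v \<times> bool) set"
  where "Kt = Inl ` Xs \<union> Inr ` (V \<times> UNIV)"

lemma finite_Kt: "finite Kt"
  using finV finX by (simp add: Kt_def)

lemma card_Kt: "card Kt = N"
proof -
  have "card Kt = card (Inl ` Xs :: ('x + 'v \<times> bool) set) + card (Inr ` (V \<times> UNIV) :: ('x + 'v \<times> bool) set)"
    unfolding Kt_def by (rule card_Un_disjoint) (use finV finX in auto)
  also have "\<dots> = card Xs + card V * 2"
    by (simp add: card_image card_cartesian_product)
  finally show ?thesis by (simp add: N_def)
qed

definition special :: "(('v, 'x) coord \<Rightarrow> int) \<Rightarrow> bool"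
  where "special y \<longleftrightarrow> (\<forall>v\<in>V. y (T v) = 2 \<or> y (T v) = 3)"

text \<open>
  In the \<open>v\<close>-plane, \<open>turn\<close> makes the \<open>D v\<close>-axis sweep a half turn as \<open>T v\<close> runs through its
  interval, so a target point off the axes is reached once up to sign. The heights \<open>h\<close> break the
  ties between the planes in the cube \<open>special\<close>, away from the glued faces.
\<close>

fun offset :: "(('v, 'x) coord \<Rightarrow> real) \<Rightarrow> (('v, 'x) coord \<Rightarrow> int) \<Rightarrow> 'x + 'v \<times> bool \<Rightarrow> real" where
  "offset h y (Inl x) = (if special y then h (X x) else 0)"
| "offset h y (Inr (v, b)) = (if special y then if b then h (T v) else h (D v) - h (T v) else 1)"

text \<open>\<open>E\<close> homogenises an inhomogeneous linear system: its linear part sends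
  \<open>X\<close> identically and \<open>D v\<close> along the rotating direction, its right-hand
  side is \<open>offset\<close>. The labels surround the origin where this system has a
  solution.\<close>

fun model :: "(('v, 'x) coord \<Rightarrow> real) \<Rightarrow> int \<Rightarrow> (('v, 'x) coord \<Rightarrow> int) \<Rightarrow> 'x + 'v \<times> bool \<Rightarrow> real" where
  "model h K y (Inl x) = y (X x) - y E * offset h y (Inl x)"
| "model h K y (Inr (v, b)) = turn K b (y (T v)) * y (D v) - y E * offset h y (Inr (v, b))"

text \<open>In the surviving chain the barycentric position of each coordinate is proportional to
  its height. The condition \<open>h (D v) > h (T v)\<close> lets \<open>D v\<close> move before
  \<open>T v\<close> and makes both offsets in the \<open>v\<close>-plane positive.\<close>

definition heights :: "(('v, 'x) coord \<Rightarrow> real) \<Rightarrow> bool"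
  where "heights h \<longleftrightarrow> inj_on h Co \<and> (\<forall>c\<in>Co. h c > 0) \<and> h E = 1 \<and> (\<forall>v\<in>V. h (D v) > h (T v))"

lemma heights_exist: "\<exists>h. heights h"
proof -
  obtain r :: "('v, 'x) coord \<Rightarrow> nat" where r: "inj_on r Co"
    using finite_imp_inj_to_nat_seg[OF finite_Co] by blast
  define h where "h c = (case c of E \<Rightarrow> 1 | T v \<Rightarrow> 1 / (real (r c) + 2) | _ \<Rightarrow> real (r c) + 2)" for c
  have "inj_on h Co"
  proof (rule inj_onI)
    fix a b assume ab: "a \<in> Co" "b \<in> Co" "h a = h b"
    have T1: "h c < 1 \<longleftrightarrow> is_T c" for c by (cases c) (auto simp: h_def)
    have "is_T a \<longleftrightarrow> is_T b" using T1[of a] T1[of b] ab(3) by simp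
    then have "r a = r b \<or> a = b"
      using ab(3) by (cases a; cases b) (auto simp: h_def)
    then show "a = b" using inj_onD[OF r] ab by blast
  qed
  moreover have "h c > 0" for c by (cases c) (auto simp: h_def)
  moreover have "h (D v) > h (T w)" for v w
  proof -
    have "h (T w) < 1" "h (D v) > 1" by (auto simp: h_def)
    then show ?thesis by simp
  qed
  ultimately show ?thesis unfolding heights_def by (intro exI[of _ h]) (auto simp: h_def)
qed

text \<open>The total weight of the vertices at which a coordinate with time \<open>t\<close> has
  already moved. For weights of sum 1 it is the barycentric position of this coordinate between
  \<open>lo\<close> and \<open>hi\<close>.\<close>

definition tail :: "(nat \<Rightarrow> real) \<Rightarrow> nat \<Rightarrow> real"
  where "tail c t = (\<Sum>j\<le>N. c j * of_bool (t \<le> j))"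

lemma tail_mono: "(\<And>j. j \<le> N \<Longrightarrow> c j \<ge> 0) \<Longrightarrow> s \<le> t \<Longrightarrow> tail c t \<le> tail c s"
  unfolding tail_def by (intro sum_mono mult_left_mono) auto

lemma tail_nonneg: "(\<And>j. j \<le> N \<Longrightarrow> c j \<ge> 0) \<Longrightarrow> tail c t \<ge> 0"
  unfolding tail_def by (intro sum_nonneg) auto

lemma tail_Suc: "t \<le> N \<Longrightarrow> tail c t = c t + tail c (Suc t)"
proof -
  assume t: "t \<le> N"
  have "tail c t - tail c (Suc t) = (\<Sum>j\<le>N. c j * of_bool (j = t))"
    unfolding tail_def sum_subtractf[symmetric] by (rule sum.cong) auto
  also have "\<dots> = c t" using t by (simp add: of_bool_def if_distrib cong: if_cong)
  finally show ?thesis by simp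
qed

lemma tail_end: "tail c (Suc N) = 0"
  by (simp add: tail_def)

lemma tail_eq_0D:
  assumes "\<And>j. j \<le> N \<Longrightarrow> c j \<ge> 0" "tail c t = 0" "t \<le> j" "j \<le> N"
  shows "c j = 0"
proof -
  have "\<forall>j\<in>{..N}. c j * of_bool (t \<le> j) = 0"
    using assms(1,2) unfolding tail_def by (subst (asm) sum_nonneg_eq_0_iff) auto
  then show ?thesis using assms(3,4) by auto
qed

lemma sum_vertex:
  assumes "lo a = 0"
  shows "(\<Sum>j\<le>N. c j * of_int (vertex (\<tau>, lo, hi) j a)) = hi a * tail c (\<tau> a)"
  unfolding tail_def sum_distrib_left by (rule sum.cong) (use assms in auto)

text \<open>\<open>D v\<close> is 0 until it moves, and the maximum is the time from which both
  \<open>D v\<close> and \<open>T v\<close> have moved.\<close>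

lemma sum_vertex_turn:
  assumes "lo (D v) = 0"
  shows "(\<Sum>j\<le>N. c j * (turn K b (vertex (\<tau>, lo, hi) j (T v)) * of_int (vertex (\<tau>, lo, hi) j (D v)))) =
    hi (D v) * (turn K b (lo (T v)) * (tail c (\<tau> (D v)) - tail c (max (\<tau> (D v)) (\<tau> (T v)))) +
      turn K b (hi (T v)) * tail c (max (\<tau> (D v)) (\<tau> (T v))))"
  unfolding tail_def sum_subtractf[symmetric] sum_distrib_left sum.distrib[symmetric]
  by (rule sum.cong) (use assms in auto)

lemma Co_intros [simp]: "v \<in> V \<Longrightarrow> T v \<in> Co" "v \<in> V \<Longrightarrow> D v \<in> Co" "E \<in> Co" "x \<in> Xs \<Longrightarrow> X x \<in> Co"
  by (auto simp: Co_def)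

text \<open>An edge is flat for \<open>turn\<close> or one of the two quarter turns; in the later
  one \<open>lo\<close> is the end \<open>2 * K\<close>, since grid points are even.\<close>

lemma turn_cases:
  assumes "(\<tau>, lo, hi) \<in> chains K" "K \<ge> 2" "v \<in> V"
  shows "(\<forall>b. turn K b (lo (T v)) = turn K b (hi (T v))) \<and>
      (turn K False (lo (T v)) = 0 \<and> turn K True (lo (T v)) = 1 \<or> turn K False (lo (T v)) = 1 \<and> turn K True (lo (T v)) = 0)
    \<or> turn K False (lo (T v)) = -1 \<and> turn K True (lo (T v)) = 0 \<and> turn K False (hi (T v)) = 0 \<and> turn K True (hi (T v)) = 1
    \<or> lo (T v) = 2 \<and> hi (T v) = 3"
proof -
  have c: "even (lo (T v))" "0 \<le> lo (T v)" "lo (T v) \<le> 2 * K" "\<bar>hi (T v) - lo (T v)\<bar> = 1" "0 \<le> hi (T v)" "hi (T v) \<le> 2 * K"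
    using chainsD(3)[OF assms(1), of "T v"] assms(3) by auto
  then obtain l where l: "lo (T v) = 2 * l" by (elim evenE)
  have hi: "hi (T v) = 2 * l + 1 \<or> hi (T v) = 2 * l - 1" using c(4) l by linarith
  consider "l \<le> 0" | "l = 1" | "2 \<le> l" "l < K" | "l = K" using c(3) l by linarith
  then show ?thesis
    using hi assms(2) c by cases (auto simp: turn_def l, presburger+)
qed

lemma model_turn_2_3 [simp]:
  assumes "K \<ge> 2"
  shows "turn K False 2 = 1" "turn K True 2 = 0" "turn K False 3 = 0" "turn K True 3 = 1"
  using assms by (auto simp: turn_def)

lemma model_equations:
  assumes C: "(\<tau>, lo, hi) \<in> chains K"
    and ker: "\<forall>k\<in>Kt. (\<Sum>j\<le>N. c j * model h K (vertex (\<tau>, lo, hi) j) k) = 0"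
  shows "x \<in> Xs \<Longrightarrow> hi (X x) * tail c (\<tau> (X x)) =
      (\<Sum>j\<le>N. c j * of_bool (\<tau> E \<le> j) * offset h (vertex (\<tau>, lo, hi) j) (Inl x))"
    and "v \<in> V \<Longrightarrow> hi (D v) * (turn K b (lo (T v)) * (tail c (\<tau> (D v)) - tail c (max (\<tau> (D v)) (\<tau> (T v)))) +
      turn K b (hi (T v)) * tail c (max (\<tau> (D v)) (\<tau> (T v)))) =
      (\<Sum>j\<le>N. c j * of_bool (\<tau> E \<le> j) * offset h (vertex (\<tau>, lo, hi) j) (Inr (v, b)))"
proof -
  note d = chainsD[OF C]
  have lo0: "lo a = 0" if "a \<in> Co" "\<not> is_T a" for a using d(4) that by blast
  have yE: "real_of_int (vertex (\<tau>, lo, hi) j E) = of_bool (\<tau> E \<le> j)" for j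
    using d(5) lo0[of E] by simp
  show "hi (X x) * tail c (\<tau> (X x)) =
      (\<Sum>j\<le>N. c j * of_bool (\<tau> E \<le> j) * offset h (vertex (\<tau>, lo, hi) j) (Inl x))" if x: "x \<in> Xs"
  proof -
    have "0 = (\<Sum>j\<le>N. c j * model h K (vertex (\<tau>, lo, hi) j) (Inl x))"
      using bspec[OF ker, of "Inl x"] x by (simp add: Kt_def)
    also have "\<dots> = (\<Sum>j\<le>N. c j * of_int (vertex (\<tau>, lo, hi) j (X x))) -
      (\<Sum>j\<le>N. c j * of_bool (\<tau> E \<le> j) * offset h (vertex (\<tau>, lo, hi) j) (Inl x))"
      unfolding model.simps yE sum_subtractf[symmetric] by (rule sum.cong) (auto simp: algebra_simps)
    finally show ?thesis using sum_vertex[of lo "X x" c \<tau> hi] lo0[of "X x"] x by simp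
  qed
  show "hi (D v) * (turn K b (lo (T v)) * (tail c (\<tau> (D v)) - tail c (max (\<tau> (D v)) (\<tau> (T v)))) +
      turn K b (hi (T v)) * tail c (max (\<tau> (D v)) (\<tau> (T v)))) =
      (\<Sum>j\<le>N. c j * of_bool (\<tau> E \<le> j) * offset h (vertex (\<tau>, lo, hi) j) (Inr (v, b)))"
    if v: "v \<in> V"
  proof -
    have "0 = (\<Sum>j\<le>N. c j * model h K (vertex (\<tau>, lo, hi) j) (Inr (v, b)))"
      using bspec[OF ker, of "Inr (v, b)"] v by (simp add: Kt_def)
    also have "\<dots> = (\<Sum>j\<le>N. c j * (turn K b (vertex (\<tau>, lo, hi) j (T v)) * of_int (vertex (\<tau>, lo, hi) j (D v)))) -
      (\<Sum>j\<le>N. c j * of_bool (\<tau> E \<le> j) * offset h (vertex (\<tau>, lo, hi) j) (Inr (v, b)))"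
      unfolding model.simps yE sum_subtractf[symmetric] by (rule sum.cong) (auto simp: algebra_simps)
    finally show ?thesis using sum_vertex_turn[of lo v c K b \<tau> hi] lo0[of "D v"] v by simp
  qed
qed

text \<open>With no weight from the time of \<open>E\<close> on, the system is homogeneous. Along
  one edge the rotating direction stays in a quadrant, so nonnegative weights cannot cancel and the
  tails at all sphere coordinates vanish.\<close>

lemma model_kernel_tail_E:
  assumes C: "(\<tau>, lo, hi) \<in> chains K" and K: "K \<ge> 2"
    and pos: "\<And>j. j \<le> N \<Longrightarrow> c j \<ge> 0"
    and ker: "\<forall>k\<in>Kt. (\<Sum>j\<le>N. c j * model h K (vertex (\<tau>, lo, hi) j) k) = 0"
    and E0: "tail c (\<tau> E) = 0" and j: "j \<le> N"
  shows "c j = 0"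
proof -
  note d = chainsD[OF C]
  have cE: "c j * of_bool (\<tau> E \<le> j) * z = 0" if "j \<le> N" for j z
    using tail_eq_0D[of c, OF pos E0 _ that] by auto
  have tail0: "tail c (\<tau> a) = 0" if a: "a \<in> Co" "\<not> is_T a" for a
  proof (cases a)
    case (X x)
    then have x: "x \<in> Xs" using a by (auto simp: Co_def)
    have "hi (X x) * tail c (\<tau> (X x)) = 0"
      using model_equations(1)[OF C ker x] cE by simp
    then show ?thesis using d(4)[OF a] X by auto
  next
    case (D v)
    then have v: "v \<in> V" using a by (auto simp: Co_def)
    let ?A = "tail c (\<tau> (D v)) - tail c (max (\<tau> (D v)) (\<tau> (T v)))"
    let ?B = "tail c (max (\<tau> (D v)) (\<tau> (T v)))"
    have A: "?A \<ge> 0" using tail_mono[of c, OF pos, where t = "max (\<tau> (D v)) (\<tau> (T v))" and s = "\<tau> (D v)"] by simp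
    have B: "?B \<ge> 0" by (rule tail_nonneg[of c, OF pos])
    have eq: "turn K b (lo (T v)) * ?A + turn K b (hi (T v)) * ?B = 0" for b
      using model_equations(2)[OF C ker v, of b] cE d(4)[OF a] D by auto
    show ?thesis
      using turn_cases[OF C K v] eq[of True] eq[of False] A B K unfolding D
      by (elim disjE conjE) (auto simp: algebra_simps)
  qed (use E0 a in auto)
  \<comment> \<open>A sphere coordinate moves at time 0, and \<open>tail c 0\<close> is the total
    weight.\<close>
  have "tail c 0 = 0"
    using tail0[of "moved \<tau> 0"] moved_time(2,3)[OF d(1), of 0] d(3)[of "moved \<tau> 0"] by auto
  then show ?thesis using tail_eq_0D[of c, OF pos, of 0 j] j by simp
qed

text \<open>The equations in the \<open>v\<close>-plane have two positive right-hand sides, so both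
  entries of the weighted direction would have the sign of \<open>hi (D v)\<close>. On a flat edge
  one entry is 0, and on the later quarter turn the signs are opposite.\<close>

lemma model_kernel_bad:
  assumes h: "heights h" and C: "(\<tau>, lo, hi) \<in> chains K" and K: "K \<ge> 2"
    and pos: "\<And>j. j \<le> N \<Longrightarrow> c j \<ge> 0"
    and ker: "\<forall>k\<in>Kt. (\<Sum>j\<le>N. c j * model h K (vertex (\<tau>, lo, hi) j) k) = 0"
    and v: "v \<in> V" "\<not> (lo (T v) = 2 \<and> hi (T v) = 3)"
  shows "tail c (\<tau> E) = 0"
proof (rule ccontr)
  assume ne: "tail c (\<tau> E) \<noteq> 0"
  note d = chainsD[OF C]
  let ?A = "tail c (\<tau> (D v)) - tail c (max (\<tau> (D v)) (\<tau> (T v)))"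
  let ?B = "tail c (max (\<tau> (D v)) (\<tau> (T v)))"
  have A: "?A \<ge> 0" using tail_mono[of c, OF pos, where t = "max (\<tau> (D v)) (\<tau> (T v))" and s = "\<tau> (D v)"] by simp
  have B: "?B \<ge> 0" by (rule tail_nonneg[of c, OF pos])
  obtain j where j: "j \<le> N" "c j * of_bool (\<tau> E \<le> j) \<noteq> 0"
    using ne unfolding tail_def by (meson atMost_iff sum.not_neutral_contains_not_neutral)
  have Q: "(\<Sum>j\<le>N. c j * of_bool (\<tau> E \<le> j) *
      offset h (vertex (\<tau>, lo, hi) j) (Inr (v, b))) > 0" for b
  proof (rule sum_pos2[of _ j])
    have q: "offset h (vertex (\<tau>, lo, hi) j) (Inr (v, b)) > 0" for j
      using h v(1) by (auto simp: heights_def)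
    show "0 < c j * of_bool (\<tau> E \<le> j) *
      offset h (vertex (\<tau>, lo, hi) j) (Inr (v, b))"
      using q[of j] pos[OF j(1)] j(2) by (intro mult_pos_pos) auto
    show "0 \<le> c i * of_bool (\<tau> E \<le> i) *
      offset h (vertex (\<tau>, lo, hi) i) (Inr (v, b))" if "i \<in> {..N}" for i
      using q[of i] pos[of i] that by (intro mult_nonneg_nonneg) auto
  qed (use j in auto)
  have eq: "hi (D v) * (turn K b (lo (T v)) * ?A + turn K b (hi (T v)) * ?B) > 0" for b
    using model_equations(2)[OF C ker v(1), of b] Q[of b] by simp
  have "hi (D v) = 1 \<or> hi (D v) = -1" using d(4)[of "D v"] v(1) by (auto simp: abs_if split: if_splits)
  then show False
    using turn_cases[OF C K v(1)] v(2) eq[of True] eq[of False] A B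
    by (elim disjE conjE) auto
qed

text \<open>The one chain whose model labels surround the origin lists the coordinates by decreasing height.\<close>

definition sorted_chain :: "(('v, 'x) coord \<Rightarrow> real) \<Rightarrow> ('v, 'x) chain"
  where "sorted_chain h =
    (\<lambda>c. if c \<in> Co then card {c' \<in> Co. h c' > h c} else Suc N,
     \<lambda>c. if c \<in> Co \<and> is_T c then 2 else 0,
     \<lambda>c. if c \<in> Co then if is_T c then 3 else 1 else 0)"

lemma model_kernel_good:
  assumes C: "(\<tau>, lo, hi) \<in> chains K" and K: "K \<ge> 2"
    and ker: "\<forall>k\<in>Kt. (\<Sum>j\<le>N. c j * model h K (vertex (\<tau>, lo, hi) j) k) = 0"
    and good: "\<And>v. v \<in> V \<Longrightarrow> lo (T v) = 2 \<and> hi (T v) = 3"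
  shows "x \<in> Xs \<Longrightarrow> hi (X x) * tail c (\<tau> (X x)) = h (X x) * tail c (\<tau> E)"
    and "v \<in> V \<Longrightarrow> hi (D v) * (tail c (\<tau> (D v)) - tail c (max (\<tau> (D v)) (\<tau> (T v)))) = (h (D v) - h (T v)) * tail c (\<tau> E)"
    and "v \<in> V \<Longrightarrow> hi (D v) * tail c (max (\<tau> (D v)) (\<tau> (T v))) = h (T v) * tail c (\<tau> E)"
proof -
  \<comment> \<open>All \<open>T\<close> values are 2 or 3, so \<open>offset\<close> is the same at
    every vertex.\<close>
  have sp: "special (vertex (\<tau>, lo, hi) j)" for j using good by (auto simp: special_def)
  have E: "(\<Sum>j\<le>N. c j * of_bool (\<tau> E \<le> j) * z) = z * tail c (\<tau> E)" for z
    unfolding tail_def sum_distrib_left by (rule sum.cong) auto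
  show "x \<in> Xs \<Longrightarrow> hi (X x) * tail c (\<tau> (X x)) = h (X x) * tail c (\<tau> E)"
    using model_equations(1)[OF C ker] by (simp only: sp offset.simps if_True if_False E)
  show "v \<in> V \<Longrightarrow> hi (D v) * (tail c (\<tau> (D v)) - tail c (max (\<tau> (D v)) (\<tau> (T v)))) = (h (D v) - h (T v)) * tail c (\<tau> E)"
    using model_equations(2)[OF C ker, of v False] good[of v] K by (simp only: sp offset.simps if_True if_False E) simp
  show "v \<in> V \<Longrightarrow> hi (D v) * tail c (max (\<tau> (D v)) (\<tau> (T v))) = h (T v) * tail c (\<tau> E)"
    using model_equations(2)[OF C ker, of v True] good[of v] K by (simp only: sp offset.simps if_True if_False E) simp
qed

lemma bij_rank:
  assumes "bij_betw \<tau> Co {..N}" "c \<in> Co"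
  shows "card {c' \<in> Co. \<tau> c' < \<tau> c} = \<tau> c"
proof -
  have "bij_betw \<tau> {c' \<in> Co. \<tau> c' < \<tau> c} {..<\<tau> c}"
  proof (rule bij_betw_imageI)
    show "inj_on \<tau> {c' \<in> Co. \<tau> c' < \<tau> c}"
      using assms by (auto simp: bij_betw_def inj_on_def)
    have le: "\<tau> c \<le> N" using assms by (auto dest: bij_betwE)
    have "t \<in> \<tau> ` {c' \<in> Co. \<tau> c' < \<tau> c}" if "t < \<tau> c" for t
      using moved_time(2,3)[OF assms(1), of t] le that by (intro image_eqI[of _ _ "moved \<tau> t"]) auto
    then show "\<tau> ` {c' \<in> Co. \<tau> c' < \<tau> c} = {..<\<tau> c}" by auto
  qed
  from bij_betw_same_card[OF this] show ?thesis by simp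
qed

text \<open>The tails are proportional to the heights. As tails do not increase with time, the
  heights determine the order of the moves, and positivity determines the signs
  \<open>hi\<close>.\<close>

lemma model_kernel_unique_chain:
  assumes h: "heights h" and C: "C \<in> chains K" and K: "K \<ge> 2"
    and pos: "\<And>j. j \<le> N \<Longrightarrow> c j \<ge> 0"
    and ker: "\<forall>k\<in>Kt. (\<Sum>j\<le>N. c j * model h K (vertex C j) k) = 0"
    and nz: "j \<le> N" "c j \<noteq> 0"
  shows "C = sorted_chain h"
proof -
  obtain \<tau> lo hi where eq: "C = (\<tau>, lo, hi)" by (cases C) auto
  note C = C[unfolded eq] and ker = ker[unfolded eq]
  note d = chainsD[OF C]
  have E0: "tail c (\<tau> E) > 0"
    using model_kernel_tail_E[OF C K pos ker] nz tail_nonneg[of c, OF pos, of "\<tau> E"] by force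
  have good: "lo (T v) = 2 \<and> hi (T v) = 3" if "v \<in> V" for v
    using model_kernel_bad[OF h C K pos ker that] E0 by force
  note g = model_kernel_good[OF C K ker]
  have hpos: "h a > 0" if "a \<in> Co" for a using h that by (auto simp: heights_def)
  have sgn1: "hi a = 1 \<and> tail c t > 0" if "\<bar>hi a\<bar> = 1" "hi a * tail c t = z" "z > 0" for a t z
    using that tail_nonneg[of c, OF pos, of t] by (auto simp: abs_if split: if_splits)
  have X1: "hi (X x) = 1 \<and> tail c (\<tau> (X x)) = h (X x) * tail c (\<tau> E)" if "x \<in> Xs" for x
    using sgn1[OF _ g(1)[OF good that]] d(4)[of "X x"] that E0 hpos g(1)[OF good that] by auto
  have DT: "hi (D v) = 1 \<and> \<tau> (D v) < \<tau> (T v) \<and> tail c (\<tau> (T v)) = h (T v) * tail c (\<tau> E) \<and>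
      tail c (\<tau> (D v)) = h (D v) * tail c (\<tau> E)" if v: "v \<in> V" for v
  proof -
    have D1: "hi (D v) = 1" using sgn1[OF _ g(3)[OF good v]] d(4)[of "D v"] v E0 hpos by auto
    have "(h (D v) - h (T v)) * tail c (\<tau> E) > 0" using h v E0 by (auto simp: heights_def)
    then have lt: "\<tau> (D v) < \<tau> (T v)" using g(2)[OF good v] by (cases "\<tau> (D v) < \<tau> (T v)") (auto simp: max_def)
    then show ?thesis using g(2,3)[OF good v] D1 by (simp add: max_def algebra_simps)
  qed
  have tail: "tail c (\<tau> a) = h a * tail c (\<tau> E)" if "a \<in> Co" for a
    using that X1 DT h by (cases a) (auto simp: Co_def heights_def)
  have less: "h a > h b" if "a \<in> Co" "b \<in> Co" "\<tau> a < \<tau> b" for a b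
  proof -
    have "h b * tail c (\<tau> E) \<le> h a * tail c (\<tau> E)"
      using tail_mono[of c, OF pos, where s = "\<tau> a" and t = "\<tau> b"] that(3) unfolding tail[OF that(1)] tail[OF that(2)] by simp
    then have "h b \<le> h a" using E0 by simp
    moreover have "h a \<noteq> h b" using h that by (auto simp: heights_def dest: inj_onD)
    ultimately show ?thesis by simp
  qed
  have "\<tau> a = card {c' \<in> Co. h c' > h a}" if a: "a \<in> Co" for a
  proof -
    have "h b > h a \<longleftrightarrow> \<tau> b < \<tau> a" if b: "b \<in> Co" for b
      using less[OF a b] less[OF b a] bij_betw_imp_inj_on[OF d(1), THEN inj_onD, of a b] a b
      by (metis less_asym linorder_neqE_nat less_irrefl)
    then have "{c' \<in> Co. h c' > h a} = {c' \<in> Co. \<tau> c' < \<tau> a}" by blast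
    then show ?thesis using bij_rank[OF d(1) a] by simp
  qed
  then have "\<tau> = (\<lambda>c. if c \<in> Co then card {c' \<in> Co. h c' > h c} else Suc N)"
    using d(2) by (auto simp: fun_eq_iff)
  moreover have "lo = (\<lambda>c. if c \<in> Co \<and> is_T c then 2 else 0)"
  proof
    fix a show "lo a = (if a \<in> Co \<and> is_T a then 2 else 0)"
      using good d(2)[of a] d(4)[of a] by (cases a) (auto simp: Co_def)
  qed
  moreover have "hi = (\<lambda>c. if c \<in> Co then if is_T c then 3 else 1 else 0)"
  proof
    fix a show "hi a = (if a \<in> Co then if is_T a then 3 else 1 else 0)"
      using good d(2)[of a] d(5) X1 DT by (cases a) (auto simp: Co_def)
  qed
  ultimately show ?thesis by (simp add: eq sorted_chain_def)
qed

lemma sorted_chain: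
  assumes h: "heights h" and K: "K \<ge> 2"
  shows "sorted_chain h \<in> chains K"
    and "\<exists>p. (\<forall>j\<le>N. p j > 0) \<and>
      (\<forall>c. (\<forall>k\<in>Kt. (\<Sum>j\<le>N. c j * model h K (vertex (sorted_chain h) j) k) = 0) \<longrightarrow> (\<exists>s. \<forall>j\<le>N. c j = s * p j))"
proof -
  define \<tau> where "\<tau> c = (if c \<in> Co then card {c' \<in> Co. h c' > h c} else Suc N)" for c
  define lo :: "('v, 'x) coord \<Rightarrow> int" where "lo = (\<lambda>c. if c \<in> Co \<and> is_T c then 2 else 0)"
  define hi :: "('v, 'x) coord \<Rightarrow> int" where "hi = (\<lambda>c. if c \<in> Co then if is_T c then 3 else 1 else 0)"
  have eq: "sorted_chain h = (\<tau>, lo, hi)" by (auto simp: sorted_chain_def \<tau>_def lo_def hi_def fun_eq_iff)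
  have less: "\<tau> a < \<tau> b" if "a \<in> Co" "b \<in> Co" "h a > h b" for a b
  proof -
    have "{c' \<in> Co. h c' > h a} \<subset> {c' \<in> Co. h c' > h b}" using that by auto
    then show ?thesis unfolding \<tau>_def using that finite_Co by (simp add: psubset_card_mono)
  qed
  have inj: "inj_on \<tau> Co"
  proof (rule inj_onI)
    fix a b assume ab: "a \<in> Co" "b \<in> Co" "\<tau> a = \<tau> b"
    then have "h a = h b" using less[of a b] less[of b a] by force
    then show "a = b" using h ab by (auto simp: heights_def dest: inj_onD)
  qed
  have "\<tau> a \<le> N" if "a \<in> Co" for a
  proof -
    have "{c' \<in> Co. h c' > h a} \<subset> Co" using that by auto
    then have "card {c' \<in> Co. h c' > h a} < card Co" using finite_Co by (rule psubset_card_mono[rotated])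
    then show ?thesis using that card_Co by (simp add: \<tau>_def)
  qed
  then have "\<tau> ` Co \<subseteq> {..N}" by auto
  moreover have "card (\<tau> ` Co) = card {..N}" using card_image[OF inj] card_Co by simp
  ultimately have bij: "bij_betw \<tau> Co {..N}" using inj by (simp add: bij_betw_def card_subset_eq)
  have DT: "\<tau> (D v) < \<tau> (T v)" if "v \<in> V" for v
    using less[of "D v" "T v"] h that by (simp add: heights_def)
  have C: "(\<tau>, lo, hi) \<in> chains K"
  proof (rule chainsI[OF bij])
    fix a assume a: "a \<in> Co" "is_T a"
    then obtain v where "a = T v" "v \<in> V" by (auto simp: Co_def)
    then show "even (lo a) \<and> 0 \<le> lo a \<and> lo a \<le> 2 * K \<and> \<bar>hi a - lo a\<bar> = 1 \<and> 0 \<le> hi a \<and> hi a \<le> 2 * K \<and> \<tau> a \<noteq> 0"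
      using a K DT[of v] by (auto simp: lo_def hi_def)
  qed (auto simp: lo_def hi_def \<tau>_def)
  then show "sorted_chain h \<in> chains K" by (simp add: eq)
  \<comment> \<open>The weights whose tails are the heights.\<close>
  define p where "p j = (if j < N then h (moved \<tau> j) - h (moved \<tau> (Suc j)) else h (moved \<tau> j))" for j
  have hpos: "h a > 0" if "a \<in> Co" for a using h that by (auto simp: heights_def)
  have "p j > 0" if j: "j \<le> N" for j
  proof (cases "j < N")
    case True
    have "\<not> h (moved \<tau> j) < h (moved \<tau> (Suc j))" "h (moved \<tau> j) \<noteq> h (moved \<tau> (Suc j))"
      using less[of "moved \<tau> (Suc j)" "moved \<tau> j"] moved_time(2,3)[OF bij, of j] moved_time(2,3)[OF bij, of "Suc j"] True h
      by (auto simp: heights_def dest!: inj_onD)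
    then show ?thesis using True by (simp add: p_def)
  qed (use moved_time(2)[OF bij j] hpos in \<open>simp add: p_def\<close>)
  moreover have "\<exists>s. \<forall>j\<le>N. c j = s * p j"
    if ker: "\<forall>k\<in>Kt. (\<Sum>j\<le>N. c j * model h K (vertex (sorted_chain h) j) k) = 0" for c
  proof -
    note g = model_kernel_good[OF C K ker[unfolded eq]]
    have good: "lo (T v) = 2 \<and> hi (T v) = 3" if "v \<in> V" for v using that by (simp add: lo_def hi_def)
    have hi1: "hi a = 1" if "a \<in> Co" "\<not> is_T a" for a using that by (simp add: hi_def)
    have tail: "tail c (\<tau> a) = h a * tail c (\<tau> E)" if "a \<in> Co" for a
    proof (cases a)
      case (T v)
      then have v: "v \<in> V" using that by (auto simp: Co_def)
      then show ?thesis using g(3)[OF good v] DT[OF v] hi1[of "D v"] T by (simp add: max_def)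
    next
      case (D v)
      then have v: "v \<in> V" using that by (auto simp: Co_def)
      then show ?thesis using g(2,3)[OF good v] DT[OF v] hi1[of "D v"] D by (simp add: max_def algebra_simps)
    next
      case (X x)
      then have x: "x \<in> Xs" using that by (auto simp: Co_def)
      then show ?thesis using g(1)[OF good x] hi1[of "X x"] X by simp
    qed (use h in \<open>auto simp: heights_def\<close>)
    have "c j = tail c (\<tau> E) * p j" if j: "j \<le> N" for j
    proof -
      have t: "tail c i = h (moved \<tau> i) * tail c (\<tau> E)" if "i \<le> N" for i
        using tail[of "moved \<tau> i"] moved_time(2,3)[OF bij that] by simp
      show ?thesis
      proof (cases "j < N")
        case True
        then show ?thesis using t[of j] t[of "Suc j"] tail_Suc[OF j, of c] by (simp add: p_def algebra_simps)
      next
        case False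
        then have "j = N" using j by simp
        then show ?thesis using t[of j] tail_Suc[OF j, of c] by (simp add: p_def tail_end mult.commute)
      qed
    qed
    then show ?thesis by blast
  qed
  ultimately show "\<exists>p. (\<forall>j\<le>N. p j > 0) \<and>
      (\<forall>c. (\<forall>k\<in>Kt. (\<Sum>j\<le>N. c j * model h K (vertex (sorted_chain h) j) k) = 0) \<longrightarrow> (\<exists>s. \<forall>j\<le>N. c j = s * p j))"
    by blast
qed

section \<open>Nonvanishing and symmetry of the model labels\<close>

definition vertices :: "int \<Rightarrow> (('v, 'x) coord \<Rightarrow> int) set"
  where "vertices K = {y. (\<forall>c. c \<notin> Co \<longrightarrow> y c = 0) \<and> (\<forall>v\<in>V. 0 \<le> y (T v) \<and> y (T v) \<le> 2 * K) \<and>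
     (\<forall>c\<in>Co. \<not> is_T c \<longrightarrow> \<bar>y c\<bar> \<le> 1) \<and> (\<exists>c\<in>Co. \<not> is_T c \<and> y c \<noteq> 0)}"

lemma vertex_in_vertices:
  assumes "C \<in> chains K"
  shows "vertex C j \<in> vertices K"
proof -
  obtain \<tau> lo hi where eq: "C = (\<tau>, lo, hi)" by (cases C) auto
  note d = chainsD[OF assms[unfolded eq]]
  have m: "moved \<tau> 0 \<in> Co" "\<tau> (moved \<tau> 0) = 0" using moved_time(2,3)[OF d(1), of 0] by auto
  then have nT: "\<not> is_T (moved \<tau> 0)" using d(3) by blast
  then have "hi (moved \<tau> 0) \<noteq> 0" using d(4)[OF m(1)] by auto
  then have "\<exists>c\<in>Co. \<not> is_T c \<and> vertex C j c \<noteq> 0"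
    using m nT by (intro bexI[of _ "moved \<tau> 0"]) (auto simp: eq)
  then show ?thesis
    using d(2,3,4) by (auto simp: vertices_def eq)
qed

text \<open>If \<open>y E\<close> is not 0, the offset survives in a coordinate where
  \<open>turn\<close> is 0. Without zero labels, matrices acting on the labels can move them in all
  directions, which the perturbation to general position requires.\<close>

lemma model_nonzero:
  assumes h: "heights h" and y: "y \<in> vertices K" and K: "K \<ge> 2"
  shows "\<exists>k\<in>Kt. model h K y k \<noteq> 0"
proof (cases "y E = 0")
  case True
  obtain c where c: "c \<in> Co" "\<not> is_T c" "y c \<noteq> 0" using y by (auto simp: vertices_def)
  show ?thesis
  proof (cases c)
    case (D v)
    then have v: "v \<in> V" using c by (auto simp: Co_def)
    have "turn K False (y (T v)) \<noteq> 0 \<or> turn K True (y (T v)) \<noteq> 0" by (auto simp: turn_def)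
    then obtain b where "turn K b (y (T v)) \<noteq> 0" by blast
    then have "model h K y (Inr (v, b)) \<noteq> 0" using c D True by simp
    then show ?thesis using v by (intro bexI[of _ "Inr (v, b)"]) (auto simp: Kt_def)
  next
    case (X x)
    then have "x \<in> Xs" using c by (auto simp: Co_def)
    moreover have "model h K y (Inl x) \<noteq> 0" using c X True by simp
    ultimately show ?thesis by (intro bexI[of _ "Inl x"]) (auto simp: Kt_def)
  qed (use c True in auto)
next
  case False
  obtain v where v: "v \<in> V" using V_ne by blast
  have "turn K False (y (T v)) = 0 \<or> turn K True (y (T v)) = 0" by (auto simp: turn_def)
  then obtain b where "turn K b (y (T v)) = 0" by blast
  moreover have "h (T v) > 0" "h (D v) > h (T v)" using h v by (auto simp: heights_def)
  ultimately have "model h K y (Inr (v, b)) \<noteq> 0" using False by auto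
  then show ?thesis using v by (intro bexI[of _ "Inr (v, b)"]) (auto simp: Kt_def)
qed

lemma model_neg: "model h K (\<lambda>c. neg_at c (y c)) k = - model h K y k"
proof -
  have "special (\<lambda>c. neg_at c (y c)) = special y" by (simp add: special_def neg_at_def)
  then show ?thesis by (cases "(h, K, y, k)" rule: model.cases) (auto simp: neg_at_def)
qed

definition permK :: "'v \<Rightarrow> 'x + 'v \<times> bool \<Rightarrow> 'x + 'v \<times> bool"
  where "permK v k = (case k of Inl x \<Rightarrow> Inl (\<sigma>X v x) | Inr (w, b) \<Rightarrow> Inr (\<sigma> v w, b))"

definition sgK :: "'v \<Rightarrow> 'x + 'v \<times> bool \<Rightarrow> real"
  where "sgK v k = (case k of Inl x \<Rightarrow> of_int (\<epsilon> v x) | Inr _ \<Rightarrow> 1)"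

lemma permK_Kt: "v \<in> V \<Longrightarrow> k \<in> Kt \<Longrightarrow> permK v k \<in> Kt"
  by (auto simp: Kt_def permK_def \<sigma>_V \<sigma>X_X)

text \<open>The half turn absorbs the sign of \<open>D v\<close>, as \<open>turn\<close> has
  opposite values at 0 and \<open>2 * K\<close>. On these faces \<open>special\<close> fails, so the
  offset has the constant values 0 and 1 and respects the permutation.\<close>

lemma model_glue:
  assumes v: "v \<in> V" and K: "K \<ge> 2" and y: "y (T v) \<in> {0, 2 * K}"
  shows "model h K (glue K v y) k = sgK v k * model h K y (permK v k)"
proof -
  have ns: "\<not> special y" "\<not> special (glue K v y)"
  proof -
    have "y (T v) \<noteq> 2 \<and> y (T v) \<noteq> 3" "2 * K - y (T v) \<noteq> 2 \<and> 2 * K - y (T v) \<noteq> 3"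
      using y K by (auto, presburger+)
    then show "\<not> special y" "\<not> special (glue K v y)"
      using v by (auto simp: special_def glue_def intro!: bexI[of _ v])
  qed
  have \<epsilon>: "real_of_int (\<epsilon> v x) * real_of_int (\<epsilon> v x) = 1" for x using \<epsilon>_cases[of v x] by auto
  have turn: "turn K b (2 * K - y (T v)) = - turn K b (y (T v))" for b
    using y K by (auto simp: turn_def)
  have "\<sigma> v w = v \<longleftrightarrow> w = v" for w by (metis \<sigma>_\<sigma> \<sigma>_self)
  then show ?thesis using ns turn
    by (cases k) (auto simp: glue_def permK_def sgK_def \<sigma>_self \<epsilon>)
qed

end

section \<open>Equivariant families of linear maps\<close>

lemma uniform_eps_finite:
  assumes "finite A" "\<And>x. x \<in> A \<Longrightarrow> \<exists>e>0. \<forall>w. (\<forall>j\<in>J. \<forall>k\<in>K. \<bar>w j k - v x j k\<bar> < e) \<longrightarrow> Q x w"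
  shows "\<exists>e>(0::real). \<forall>x\<in>A. \<forall>w. (\<forall>j\<in>J. \<forall>k\<in>K. \<bar>w j k - v x j k\<bar> < e) \<longrightarrow> Q x w"
proof -
  from assms(2) obtain e where e: "\<And>x. x \<in> A \<Longrightarrow> e x > 0"
    "\<And>x w. x \<in> A \<Longrightarrow> (\<forall>j\<in>J. \<forall>k\<in>K. \<bar>w j k - v x j k\<bar> < e x) \<Longrightarrow> Q x w" by metis
  define e0 where "e0 = Min (insert 1 (e ` A))"
  have "e0 > 0" unfolding e0_def using assms(1) e(1) by (subst Min_gr_iff) auto
  moreover have "e0 \<le> e x" if "x \<in> A" for x unfolding e0_def using assms(1) that by (intro Min_le) auto
  ultimately show ?thesis using e(2) by (meson order_less_le_trans)
qed

definition cube :: "('v \<Rightarrow> real) set"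
  where "cube = {t. \<forall>v. 0 \<le> t v \<and> t v \<le> 1}"

context gluing
begin

definition U :: "('v, 'x) coord set"
  where "U = {c \<in> Co. \<not> is_T c}"

lemma finite_U: "finite U"
  using finite_Co by (simp add: U_def)

lemma bij_perm_U: "v \<in> V \<Longrightarrow> bij_betw (perm v) U U"
  by (rule bij_betw_byWitness[where f' = "perm v"]) (use perm_Co in \<open>auto simp: U_def\<close>)

definition pt :: "int \<Rightarrow> (('v, 'x) coord \<Rightarrow> int) \<Rightarrow> 'v \<Rightarrow> real"
  where "pt K y v = y (T v) / (2 * K)"

definition end_swap :: "'v \<Rightarrow> ('v \<Rightarrow> real) \<Rightarrow> 'v \<Rightarrow> real"
  where "end_swap v t w = (if w = v then 1 else t (\<sigma> v w))"

lemma pt_glue: "K > 0 \<Longrightarrow> y (T v) = 0 \<Longrightarrow> pt K (glue K v y) = end_swap v (pt K y)"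
  by (auto simp: fun_eq_iff pt_def glue_def end_swap_def)

lemma pt_cube:
  assumes "y \<in> vertices K" "K > 0"
  shows "pt K y \<in> cube"
proof -
  have "0 \<le> y (T v) \<and> y (T v) \<le> 2 * K" for v
  proof (cases "v \<in> V")
    case True
    then show ?thesis using assms by (simp add: vertices_def)
  next
    case False
    then have "T v \<notin> Co" by (auto simp: Co_def)
    then show ?thesis using assms by (simp add: vertices_def)
  qed
  then have "0 \<le> real_of_int (y (T v)) \<and> real_of_int (y (T v)) \<le> 2 * real_of_int K" for v
    by (metis of_int_0_le_iff of_int_le_iff of_int_mult of_int_numeral)
  then show ?thesis using assms(2) by (auto simp: cube_def pt_def divide_simps)
qed

lemma pt_vertex_close:
  assumes "C \<in> chains K" "K > 0" "v \<in> V"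
  shows "\<bar>pt K (vertex C j) v - pt K (vertex C 0) v\<bar> \<le> 1 / (2 * K)"
proof -
  obtain \<tau> lo hi where eq: "C = (\<tau>, lo, hi)" by (cases C) auto
  have "\<bar>hi (T v) - lo (T v)\<bar> = 1" using chainsD(3)[OF assms(1)[unfolded eq], of "T v"] assms(3) by simp
  then have "\<bar>vertex C j (T v) - vertex C 0 (T v)\<bar> \<le> 1" by (auto simp: eq)
  then have "\<bar>real_of_int (vertex C j (T v)) - real_of_int (vertex C 0 (T v))\<bar> \<le> 1" by linarith
  then show ?thesis using assms(2) by (simp add: pt_def abs_divide divide_right_mono flip: diff_divide_distrib)
qed

lemma vertex_signs:
  assumes "C \<in> chains K" "a \<in> U"
  shows "\<exists>s. \<bar>s\<bar> = 1 \<and> (\<forall>j. real_of_int (vertex C j a) = s * \<bar>real_of_int (vertex C j a)\<bar>)"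
proof -
  obtain \<tau> lo hi where eq: "C = (\<tau>, lo, hi)" by (cases C) auto
  have "lo a = 0" "\<bar>hi a\<bar> = 1" using chainsD(4)[OF assms(1)[unfolded eq], of a] assms(2) by (auto simp: U_def)
  then show ?thesis by (intro exI[of _ "real_of_int (hi a)"]) (auto simp: eq abs_if split: if_splits)
qed

text \<open>
  On a fine grid a chain stays close to a single parameter \<open>t\<close>, and its sign vectors lie in one
  orthant. A nonnegative relation among the labels thus yields, in the limit, a kernel vector of \<open>F t\<close>.
\<close>

lemma fine_chains_no_kernel:
  fixes F :: "('v \<Rightarrow> real) \<Rightarrow> ('v, 'x) coord \<Rightarrow> 'k \<Rightarrow> real"
  assumes cont: "\<And>s t c k. (\<And>n. s n \<in> cube) \<Longrightarrow> t \<in> cube \<Longrightarrow> (\<And>v. (\<lambda>n. s n v) \<longlonglongrightarrow> t v) \<Longrightarrow>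
      c \<in> U \<Longrightarrow> k \<in> Ks \<Longrightarrow> (\<lambda>n. F (s n) c k) \<longlonglongrightarrow> F t c k"
    and inj: "\<And>t u. t \<in> cube \<Longrightarrow> (\<And>k. k \<in> Ks \<Longrightarrow> (\<Sum>c\<in>U. u c * F t c k) = 0) \<Longrightarrow> \<forall>c\<in>U. u c = 0"
  shows "\<exists>K\<ge>2. \<forall>C\<in>chains K. \<forall>c. (\<forall>j\<in>{..N}. c j \<ge> 0) \<longrightarrow>
     (\<forall>k\<in>Ks. (\<Sum>j\<le>N. c j * (\<Sum>a\<in>U. of_int (vertex C j a) * F (pt K (vertex C j)) a k)) = 0) \<longrightarrow> (\<forall>j\<in>{..N}. c j = 0)"
proof (rule ccontr)
  assume neg: "\<not> ?thesis"
  define Kn where "Kn n = int n + 2" for n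
  define Z where "Z K C c \<longleftrightarrow>
     (\<forall>k\<in>Ks. (\<Sum>j\<le>N. c j * (\<Sum>a\<in>U. of_int (vertex C j a) * F (pt K (vertex C j)) a k)) = 0)" for K C c
  have "\<exists>C c. C \<in> chains (Kn n) \<and> (\<forall>j\<in>{..N}. c j \<ge> 0) \<and> Z (Kn n) C c \<and> \<not> (\<forall>j\<in>{..N}. c j = 0)" for n
  proof -
    have "Kn n \<ge> 2" by (simp add: Kn_def)
    then show ?thesis using neg[folded Z_def] by blast
  qed
  then obtain C c where C: "\<And>n. C n \<in> chains (Kn n)" and pos': "\<And>n. \<forall>j\<in>{..N}. c n j \<ge> 0"
    and ker': "\<And>n. Z (Kn n) (C n) (c n)" and nz': "\<And>n. \<not> (\<forall>j\<in>{..N}. c n j = 0)" by metis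
  have pos: "c n j \<ge> 0" if "j \<le> N" for n j using pos'[of n] that by simp
  have ker: "(\<Sum>j\<le>N. c n j * (\<Sum>a\<in>U. of_int (vertex (C n) j a) * F (pt (Kn n) (vertex (C n) j)) a k)) = 0"
    if "k \<in> Ks" for n k using ker'[of n] that unfolding Z_def by blast
  have nz: "\<exists>j\<le>N. c n j \<noteq> 0" for n using nz'[of n] by auto
  define y where "y n j a = real_of_int (vertex (C n) j a)" for n j a
  define t where "t n j = pt (Kn n) (vertex (C n) j)" for n j
  have K0: "Kn n > 0" for n by (simp add: Kn_def)
  have t_cube: "t n j \<in> cube" for n j
    unfolding t_def by (rule pt_cube[OF vertex_in_vertices[OF C] K0])
  \<comment> \<open>Weights and vertices are normalised jointly: the limit \<open>l\<close> records
    their products, and no limit of the vertices themselves is taken.\<close>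
  define S where "S n = (\<Sum>p\<in>{..N} \<times> U. c n (fst p) * \<bar>y n (fst p) (snd p)\<bar>)" for n
  have S: "S n > 0" for n
  proof -
    obtain j where j: "j \<le> N" "c n j \<noteq> 0" using nz by blast
    obtain a where "a \<in> Co" "\<not> is_T a" "vertex (C n) j a \<noteq> 0"
      using vertex_in_vertices[OF C, of n j] by (auto simp: vertices_def)
    then have a: "a \<in> U" "y n j a \<noteq> 0" by (auto simp: U_def y_def)
    have "c n j > 0" using pos[of j n] j by simp
    then show ?thesis unfolding S_def
      by (intro sum_pos2[of _ "(j, a)"]) (use finite_U j a pos in \<open>auto intro: mult_nonneg_nonneg\<close>)
  qed
  define w where "w n p = c n (fst p) * y n (fst p) (snd p) / S n" for n p
  have w1: "(\<Sum>p\<in>{..N} \<times> U. \<bar>w n p\<bar>) = 1" for n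
  proof -
    have "(\<Sum>p\<in>{..N} \<times> U. \<bar>w n p\<bar>) = (\<Sum>p\<in>{..N} \<times> U. c n (fst p) * \<bar>y n (fst p) (snd p)\<bar> / S n)"
      by (rule sum.cong) (use S[of n] pos in \<open>auto simp: w_def abs_divide abs_mult\<close>)
    also have "\<dots> = 1" using S[of n] by (simp add: S_def flip: sum_divide_distrib)
    finally show ?thesis .
  qed
  have "\<bar>w n p\<bar> \<le> 1" if "p \<in> {..N} \<times> U" for n p
    unfolding w1[of n, symmetric] by (rule member_le_sum[OF that, of "\<lambda>p. \<bar>w n p\<bar>"]) (use finite_U in auto)
  then obtain r l where r: "strict_mono (r :: nat \<Rightarrow> nat)" "\<forall>p\<in>{..N} \<times> U. (\<lambda>n. w (r n) p) \<longlonglongrightarrow> l p"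
    using finite_bounded_subseq[of "{..N} \<times> U" w 1] finite_U by blast
  have "\<bar>t (r n) 0 v\<bar> \<le> 1" for n v using t_cube[of "r n" 0] by (auto simp: cube_def)
  then obtain q t0 where q: "strict_mono (q :: nat \<Rightarrow> nat)" "\<forall>v\<in>V. (\<lambda>n. t (r (q n)) 0 v) \<longlonglongrightarrow> t0 v"
    using finite_bounded_subseq[of V "\<lambda>n v. t (r n) 0 v" 1] finV by blast
  define s where "s n = r (q n)" for n
  have s: "strict_mono s" using strict_mono_o[OF r(1) q(1)] by (simp add: s_def[abs_def] o_def)
  have wl: "(\<lambda>n. w (s n) p) \<longlonglongrightarrow> l p" if "p \<in> {..N} \<times> U" for p
    using LIMSEQ_subseq_LIMSEQ[OF bspec[OF r(2) that] q(1)] by (simp add: s_def o_def)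
  define t1 where "t1 v = (if v \<in> V then t0 v else 0)" for v
  have t0: "(\<lambda>n. t (s n) 0 v) \<longlonglongrightarrow> t1 v" if "v \<in> V" for v
    using q(2) that by (simp add: s_def t1_def)
  have t1_cube: "t1 \<in> cube"
  proof -
    have "0 \<le> t0 v \<and> t0 v \<le> 1" if "v \<in> V" for v
      using t0[OF that] t_cube that
      by (auto simp: cube_def t1_def intro: LIMSEQ_le_const LIMSEQ_le_const2)
    then show ?thesis by (auto simp: cube_def t1_def)
  qed
  have tj: "(\<lambda>n. t (s n) j v) \<longlonglongrightarrow> t1 v" if v: "v \<in> V" for j v
  proof -
    have K_lim: "(\<lambda>n. 1 / (2 * real_of_int (Kn n))) \<longlonglongrightarrow> 0"
    proof (rule Lim_null_comparison[OF _ LIMSEQ_inverse_real_of_nat])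
      show "\<forall>\<^sub>F n in sequentially. norm (1 / (2 * real_of_int (Kn n))) \<le> inverse (real (Suc n))"
        by (intro always_eventually) (auto simp: Kn_def divide_simps)
    qed
    have "(\<lambda>n. t (s n) j v - t (s n) 0 v) \<longlonglongrightarrow> 0"
    proof (rule Lim_null_comparison)
      show "\<forall>\<^sub>F n in sequentially. norm (t (s n) j v - t (s n) 0 v) \<le> 1 / (2 * real_of_int (Kn (s n)))"
        using pt_vertex_close[OF C K0 v] by (intro always_eventually) (simp add: t_def)
      show "(\<lambda>n. 1 / (2 * real_of_int (Kn (s n)))) \<longlonglongrightarrow> 0"
        using LIMSEQ_subseq_LIMSEQ[OF K_lim s] by (simp add: o_def)
    qed
    from tendsto_add[OF this t0[OF v]] show ?thesis by simp
  qed
  have tj_all: "(\<lambda>n. t (s n) j v) \<longlonglongrightarrow> t1 v" for j v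
  proof (cases "v \<in> V")
    case False
    then have "T v \<notin> Co" by (auto simp: Co_def)
    then have "t n j v = 0" for n
      using vertex_in_vertices[OF C, of n j] by (simp add: t_def pt_def vertices_def)
    then show ?thesis using False by (simp add: t1_def)
  qed (rule tj)
  have Fl: "(\<lambda>n. F (t (s n) j) a k) \<longlonglongrightarrow> F t1 a k" if "a \<in> U" "k \<in> Ks" for j a k
    by (rule cont[OF t_cube t1_cube tj_all that])
  define u where "u a = (\<Sum>j\<le>N. l (j, a))" for a
  have "(\<Sum>a\<in>U. u a * F t1 a k) = 0" if k: "k \<in> Ks" for k
  proof -
    have z: "(\<Sum>j\<le>N. \<Sum>a\<in>U. w n (j, a) * F (t n j) a k) = 0" for n
    proof -
      have "(\<Sum>j\<le>N. \<Sum>a\<in>U. w n (j, a) * F (t n j) a k) =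
          (\<Sum>j\<le>N. c n j * (\<Sum>a\<in>U. of_int (vertex (C n) j a) * F (pt (Kn n) (vertex (C n) j)) a k)) / S n"
        unfolding sum_distrib_left sum_divide_distrib by (simp add: w_def t_def y_def algebra_simps)
      then show ?thesis using ker[OF k, of n] by simp
    qed
    have "(\<lambda>n. \<Sum>j\<le>N. \<Sum>a\<in>U. w (s n) (j, a) * F (t (s n) j) a k) \<longlonglongrightarrow> (\<Sum>j\<le>N. \<Sum>a\<in>U. l (j, a) * F t1 a k)"
      using wl Fl k by (intro tendsto_sum tendsto_mult) auto
    then have "(\<Sum>j\<le>N. \<Sum>a\<in>U. l (j, a) * F t1 a k) = 0" using z by (simp add: LIMSEQ_const_iff)
    then show ?thesis unfolding u_def sum_distrib_right by (subst sum.swap)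
  qed
  then have u0: "\<forall>a\<in>U. u a = 0" using inj[OF t1_cube] by blast
  \<comment> \<open>Equal signs within a chain exclude cancellation, so \<open>u\<close> has l1-norm
    1 in the limit.\<close>
  have abs_eq: "(\<Sum>a\<in>U. \<bar>\<Sum>j\<le>N. w n (j, a)\<bar>) = 1" for n
  proof -
    have "\<bar>\<Sum>j\<le>N. w n (j, a)\<bar> = (\<Sum>j\<le>N. \<bar>w n (j, a)\<bar>)" if a: "a \<in> U" for a
    proof -
      obtain e where e: "\<bar>e\<bar> = 1" "\<And>j. y n j a = e * \<bar>y n j a\<bar>"
        using vertex_signs[OF C a, of n] unfolding y_def by blast
      have "w n (j, a) = e * \<bar>w n (j, a)\<bar>" if "j \<le> N" for j
        using pos[OF that, of n] S[of n] e(2)[of j] by (simp add: w_def abs_mult abs_divide)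
      then have "(\<Sum>j\<le>N. w n (j, a)) = e * (\<Sum>j\<le>N. \<bar>w n (j, a)\<bar>)"
        unfolding sum_distrib_left by (intro sum.cong) auto
      then show ?thesis using e(1) by (simp add: abs_mult sum_nonneg)
    qed
    then have "(\<Sum>a\<in>U. \<bar>\<Sum>j\<le>N. w n (j, a)\<bar>) = (\<Sum>a\<in>U. \<Sum>j\<le>N. \<bar>w n (j, a)\<bar>)" by simp
    also have "\<dots> = (\<Sum>j\<le>N. \<Sum>a\<in>U. \<bar>w n (j, a)\<bar>)" by (rule sum.swap)
    also have "\<dots> = 1" using w1[of n] by (simp add: sum.cartesian_product case_prod_beta)
    finally show ?thesis .
  qed
  have "(\<lambda>n. \<Sum>a\<in>U. \<bar>\<Sum>j\<le>N. w (s n) (j, a)\<bar>) \<longlonglongrightarrow> (\<Sum>a\<in>U. \<bar>u a\<bar>)"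
    unfolding u_def using wl by (intro tendsto_sum tendsto_rabs) auto
  then show False using u0 by (simp add: abs_eq LIMSEQ_const_iff)
qed

end

text \<open>\<open>A t\<close> has values in a trivial target; \<open>W t\<close> passes to a frame
  in which gluing permutes the coordinates up to sign, as it does for the model labels. The
  assumptions are collected in order to be refuted by \<open>no_equivariant_family\<close>.\<close>

locale equivariant_family = gluing V Xs \<sigma> \<sigma>X \<epsilon>
  for V :: "'v set" and Xs :: "'x set" and \<sigma> \<sigma>X \<epsilon> +
  fixes A :: "('v \<Rightarrow> real) \<Rightarrow> ('v, 'x) coord \<Rightarrow> 'x + 'v \<times> bool \<Rightarrow> real"
    and W :: "('v \<Rightarrow> real) \<Rightarrow> ('x + 'v \<times> bool \<Rightarrow> real) \<Rightarrow> 'x + 'v \<times> bool \<Rightarrow> real"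
  assumes W_add: "\<And>t x y k. W t (\<lambda>k. x k + y k) k = W t x k + W t y k"
    and W_scale: "\<And>t a x k. W t (\<lambda>k. a * x k) k = a * W t x k"
    and W_cong: "\<And>t x y k. (\<And>k. k \<in> Kt \<Longrightarrow> x k = y k) \<Longrightarrow> k \<in> Kt \<Longrightarrow> W t x k = W t y k"
    and W_inj: "\<And>t x k. t \<in> cube \<Longrightarrow> (\<And>k. k \<in> Kt \<Longrightarrow> W t x k = 0) \<Longrightarrow> k \<in> Kt \<Longrightarrow> x k = 0"
    and W_end: "\<And>t v x k. t \<in> cube \<Longrightarrow> v \<in> V \<Longrightarrow> t v = 0 \<Longrightarrow> k \<in> Kt \<Longrightarrow>
      W (end_swap v t) x k = sgK v k * W t x (permK v k)"
    and A_end: "\<And>t v c k. t \<in> cube \<Longrightarrow> v \<in> V \<Longrightarrow> t v = 0 \<Longrightarrow> c \<in> U \<Longrightarrow> k \<in> Kt \<Longrightarrow>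
      A (end_swap v t) c k = of_int (sg v c) * A t (perm v c) k"
    and A_inj: "\<And>t u. t \<in> cube \<Longrightarrow> (\<And>k. k \<in> Kt \<Longrightarrow> (\<Sum>c\<in>U. u c * A t c k) = 0) \<Longrightarrow> \<forall>c\<in>U. u c = 0"
    and WA_cont: "\<And>s t c k. (\<And>n. s n \<in> cube) \<Longrightarrow> t \<in> cube \<Longrightarrow> (\<And>v. (\<lambda>n. s n v) \<longlonglongrightarrow> t v) \<Longrightarrow>
      c \<in> U \<Longrightarrow> k \<in> Kt \<Longrightarrow> (\<lambda>n. W (s n) (A (s n) c) k) \<longlonglongrightarrow> W t (A t c) k"
begin

lemma W_zero: "W t (\<lambda>_. 0) k = 0"
  using W_scale[of t 0 "\<lambda>_. 0" k] by simp

lemma W_sum: "finite I \<Longrightarrow> W t (\<lambda>k. \<Sum>i\<in>I. a i * x i k) k = (\<Sum>i\<in>I. a i * W t (x i) k)"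
  by (induction I rule: finite_induct) (simp_all add: W_zero W_add W_scale)

definition unit_at :: "'x + 'v \<times> bool \<Rightarrow> 'x + 'v \<times> bool \<Rightarrow> real"
  where "unit_at k k' = of_bool (k = k')"

lemma sum_of_bool_eq:
  assumes "finite I" "k \<in> I"
  shows "(\<Sum>i\<in>I. f i * of_bool (i = k)) = (f k :: real)" "(\<Sum>i\<in>I. of_bool (i = k) * f i) = f k"
  using assms by (simp_all add: of_bool_def if_distrib if_distribR cong: if_cong)

lemma W_expand:
  assumes "k \<in> Kt"
  shows "W t x k = (\<Sum>k'\<in>Kt. x k' * W t (unit_at k') k)"
proof -
  have "W t x k = W t (\<lambda>k. \<Sum>k'\<in>Kt. x k' * unit_at k' k) k"
    by (rule W_cong[OF _ assms]) (simp add: unit_at_def sum_of_bool_eq finite_Kt)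
  then show ?thesis by (simp add: W_sum finite_Kt)
qed

lemma W_surj:
  assumes t: "t \<in> cube"
  shows "\<exists>x. \<forall>k\<in>Kt. W t x k = m k"
proof -
  \<comment> \<open>\<open>m\<close>, with index \<open>None\<close>, and the images of all unit
    vectors are too many to be independent; injectivity forces \<open>m\<close> to occur in the
    relation.\<close>
  define v where "v j = (case j of None \<Rightarrow> m | Some k' \<Rightarrow> W t (unit_at k'))" for j
  let ?J = "insert None (Some ` Kt)"
  have "card Kt < card ?J" using finite_Kt by (subst card_insert_disjoint) (auto simp: card_image)
  then obtain c where c: "\<exists>j\<in>?J. c j \<noteq> 0" "\<forall>k\<in>Kt. (\<Sum>j\<in>?J. c j * v j k) = 0"
    using nontrivial_kernel[of Kt ?J v] finite_Kt by auto
  have sum: "(\<Sum>j\<in>?J. c j * v j k) = c None * m k + W t (\<lambda>k. c (Some k)) k" if "k \<in> Kt" for k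
  proof -
    have "(\<Sum>j\<in>?J. c j * v j k) = c None * m k + (\<Sum>j\<in>Some ` Kt. c j * v j k)"
      using finite_Kt by (subst sum.insert) (auto simp: v_def)
    also have "(\<Sum>j\<in>Some ` Kt. c j * v j k) = W t (\<lambda>k. c (Some k)) k"
      unfolding W_expand[OF that, of t "\<lambda>k. c (Some k)"] by (subst sum.reindex) (auto simp: v_def)
    finally show ?thesis .
  qed
  have "c None \<noteq> 0"
  proof
    assume 0: "c None = 0"
    then have "W t (\<lambda>k. c (Some k)) k = 0" if "k \<in> Kt" for k using c(2) sum that by simp
    then have "c (Some k) = 0" if "k \<in> Kt" for k using W_inj[OF t, of "\<lambda>k. c (Some k)"] that by blast
    then show False using c(1) 0 by auto
  qed
  then have "W t (\<lambda>k. (- 1 / c None) * c (Some k)) k = m k" if "k \<in> Kt" for k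
    unfolding W_scale using c(2) sum[OF that] that by (simp add: field_simps)
  then show ?thesis by blast
qed

lemma sgK_sq [simp]: "sgK v k * (sgK v k * z) = z"
  using \<epsilon>_cases by (cases k) (auto simp: sgK_def, metis mult_minus1 mult_minus_right of_int_1 of_int_minus mult_1 minus_minus)

lemma permK_permK [simp]: "permK v (permK v k) = k"
  by (cases k) (auto simp: permK_def \<sigma>_\<sigma> \<sigma>X_\<sigma>X)

lemma sgK_permK [simp]: "sgK v (permK v k) = sgK v k"
  by (cases k) (auto simp: permK_def sgK_def \<epsilon>_\<sigma>X)

definition on_end :: "int \<Rightarrow> 'v \<Rightarrow> (('v, 'x) coord \<Rightarrow> int) \<Rightarrow> bool"
  where "on_end K v y \<longleftrightarrow> v \<in> V \<and> y \<in> vertices K \<and> glue K v y \<in> vertices K \<and> y (T v) \<in> {0, 2 * K}"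

text \<open>\<open>W_end\<close> and \<open>A_end\<close> speak of the end 0 only; the involution
  \<open>glue\<close> transfers their consequences to the end \<open>2 * K\<close>.\<close>

lemma on_end_cases:
  assumes "on_end K v y"
    and "\<And>y. on_end K v y \<Longrightarrow> y (T v) = 0 \<Longrightarrow> P y" and "\<And>y. P (glue K v y) \<Longrightarrow> P y"
  shows "P y"
proof (cases "y (T v) = 0")
  case False
  then have "on_end K v (glue K v y)" "glue K v y (T v) = 0"
    using assms(1) by (auto simp: on_end_def glue_def)
  then show ?thesis using assms(2,3) by blast
qed (use assms in blast)

lemma W_glue:
  assumes "on_end K v y" "K > 0" "k \<in> Kt"
  shows "W (pt K (glue K v y)) x k = sgK v k * W (pt K y) x (permK v k)"
  using assms(3)
proof (induction arbitrary: k rule: on_end_cases[OF assms(1)])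
  case (1 y)
  then have "pt K y \<in> cube" "v \<in> V" "pt K y v = 0"
    using pt_cube assms(2) by (auto simp: on_end_def pt_def)
  from W_end[OF this 1(3), of x] show ?case using 1(2) assms(2) by (simp add: pt_glue)
next
  case (2 y)
  have "v \<in> V" using assms(1) by (simp add: on_end_def)
  then have "permK v k \<in> Kt" using permK_Kt 2 by blast
  from 2(1)[OF this] show ?case by simp
qed

text \<open>The label before \<open>W\<close> is applied. Gluing leaves it unchanged, so one matrix
  used in all chains perturbs it without breaking the symmetry.\<close>

definition \<beta>A :: "int \<Rightarrow> (('v, 'x) coord \<Rightarrow> int) \<Rightarrow> 'x + 'v \<times> bool \<Rightarrow> real"
  where "\<beta>A K y k = (\<Sum>c\<in>U. of_int (y c) * A (pt K y) c k)"

lemma \<beta>A_glue: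
  assumes "on_end K v y" "K > 0" "k \<in> Kt"
  shows "\<beta>A K (glue K v y) k = \<beta>A K y k"
proof (induction rule: on_end_cases[OF assms(1)])
  case (1 y)
  then have v: "v \<in> V" and c: "pt K y \<in> cube" "pt K y v = 0"
    using pt_cube assms(2) by (auto simp: on_end_def pt_def)
  have "real_of_int (glue K v y a) * A (end_swap v (pt K y)) a k = of_int (y (perm v a)) * A (pt K y) (perm v a) k"
    if "a \<in> U" for a
    using A_end[OF c(1) v c(2) that assms(3)] that sg_cases[of v a] by (auto simp: glue_def U_def)
  then have "\<beta>A K (glue K v y) k = (\<Sum>a\<in>U. of_int (y (perm v a)) * A (pt K y) (perm v a) k)"
    unfolding \<beta>A_def pt_glue[where y = y and K = K, OF assms(2) 1(2)] by simp
  also have "\<dots> = \<beta>A K y k"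
    unfolding \<beta>A_def by (rule sum.reindex_bij_betw[OF bij_perm_U[OF v]])
  finally show ?case .
qed simp

lemma \<beta>A_neg: "\<beta>A K (\<lambda>c. neg_at c (y c)) k = - \<beta>A K y k"
proof -
  have "pt K (\<lambda>c. neg_at c (y c)) = pt K y" by (auto simp: pt_def neg_at_def fun_eq_iff)
  then show ?thesis by (auto simp: \<beta>A_def sum_negf[symmetric] neg_at_def U_def intro!: sum.cong)
qed

lemma \<beta>A_nonzero:
  assumes "y \<in> vertices K" "K > 0"
  shows "\<exists>k\<in>Kt. \<beta>A K y k \<noteq> 0"
proof (rule ccontr)
  assume "\<not> ?thesis"
  then have "\<forall>c\<in>U. real_of_int (y c) = 0"
    by (intro A_inj[OF pt_cube[OF assms]]) (simp add: \<beta>A_def)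
  then show False using assms(1) by (auto simp: vertices_def U_def)
qed

text \<open>The model label pulled back by \<open>W\<close>, which gives it the same symmetry as
  \<open>\<beta>A\<close>.\<close>

definition \<beta>M :: "(('v, 'x) coord \<Rightarrow> real) \<Rightarrow> int \<Rightarrow> (('v, 'x) coord \<Rightarrow> int) \<Rightarrow> 'x + 'v \<times> bool \<Rightarrow> real"
  where "\<beta>M h K y = (SOME x. \<forall>k\<in>Kt. W (pt K y) x k = model h K y k)"

lemma W_\<beta>M:
  assumes "y \<in> vertices K" "K > 0" "k \<in> Kt"
  shows "W (pt K y) (\<beta>M h K y) k = model h K y k"
  using someI_ex[OF W_surj[OF pt_cube[OF assms(1,2)], of "model h K y"]] assms(3) by (simp add: \<beta>M_def)

lemma W_eqI:
  assumes "t \<in> cube" "\<And>k. k \<in> Kt \<Longrightarrow> W t x k = a * W t y k" "k \<in> Kt"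
  shows "x k = a * y k"
proof -
  have "W t (\<lambda>k. x k + (- a) * y k) k = 0" if "k \<in> Kt" for k
    using assms(2)[OF that] by (simp only: W_add W_scale)
  from W_inj[OF assms(1) this assms(3)] show ?thesis by simp
qed

lemma \<beta>M_glue:
  assumes y: "on_end K v y" "K \<ge> 2" "k \<in> Kt"
  shows "\<beta>M h K (glue K v y) k = \<beta>M h K y k"
proof -
  have v: "v \<in> V" "y \<in> vertices K" "glue K v y \<in> vertices K" "y (T v) \<in> {0, 2 * K}"
    using y by (auto simp: on_end_def)
  have K: "K > 0" using y by simp
  have mg: "model h K (glue K v y) k = sgK v k * model h K y (permK v k)" for k
    by (rule model_glue) (use v y in auto)
  have "W (pt K (glue K v y)) (\<beta>M h K (glue K v y)) k = 1 * W (pt K (glue K v y)) (\<beta>M h K y) k" if k: "k \<in> Kt" for k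
    using W_\<beta>M[OF v(3) K k] mg[of k] W_\<beta>M[OF v(2) K permK_Kt[OF v(1) k]]
      W_glue[OF y(1) K k] by simp
  from W_eqI[OF pt_cube[OF v(3) K] this y(3)] show ?thesis by simp
qed

lemma \<beta>M_neg:
  assumes y: "y \<in> vertices K" "(\<lambda>c. neg_at c (y c)) \<in> vertices K" "K > 0" "k \<in> Kt"
  shows "\<beta>M h K (\<lambda>c. neg_at c (y c)) k = - \<beta>M h K y k"
proof -
  have pt: "pt K (\<lambda>c. neg_at c (y c)) = pt K y" by (auto simp: pt_def neg_at_def fun_eq_iff)
  have "W (pt K y) (\<beta>M h K (\<lambda>c. neg_at c (y c))) k = (-1) * W (pt K y) (\<beta>M h K y) k" if "k \<in> Kt" for k
    using W_\<beta>M[OF y(2,3) that, of h] W_\<beta>M[OF y(1,3) that, of h] by (simp add: pt model_neg)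
  from W_eqI[OF pt_cube[OF y(1,3)] this y(4)] show ?thesis by simp
qed

lemma \<beta>M_nonzero:
  assumes "heights h" "y \<in> vertices K" "K \<ge> 2"
  shows "\<exists>k\<in>Kt. \<beta>M h K y k \<noteq> 0"
proof (rule ccontr)
  assume "\<not> ?thesis"
  then have "W (pt K y) (\<beta>M h K y) k = 0" if "k \<in> Kt" for k
    using W_cong[of "\<beta>M h K y" "\<lambda>_. 0" k "pt K y"] that by (simp add: W_zero)
  then show False using model_nonzero[OF assms] W_\<beta>M[of y K _ h] assms by force
qed

theorem no_equivariant_family: False
proof -
  obtain h where h: "heights h" using heights_exist by blast
  define F where "F t c k = W t (A t c) k" for t c k
  have F_inj: "\<forall>c\<in>U. u c = 0" if t: "t \<in> cube" and z: "\<And>k. k \<in> Kt \<Longrightarrow> (\<Sum>c\<in>U. u c * F t c k) = 0" for t u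
  proof (rule A_inj[OF t])
    fix k assume "k \<in> Kt"
    moreover have "W t (\<lambda>k. \<Sum>c\<in>U. u c * A t c k) k = 0" if "k \<in> Kt" for k
      using z[OF that] by (simp add: W_sum[OF finite_U] F_def)
    ultimately show "(\<Sum>c\<in>U. u c * A t c k) = 0" by (rule W_inj[OF t, rotated])
  qed
  have F_cont: "(\<lambda>n. F (s n) c k) \<longlonglongrightarrow> F t c k" if "\<And>n. s n \<in> cube" "t \<in> cube"
     "\<And>v. (\<lambda>n. s n v) \<longlonglongrightarrow> t v" "c \<in> U" "k \<in> Kt" for s t c k
    unfolding F_def using that by (rule WA_cont)
  have "\<exists>K\<ge>2. \<forall>C\<in>chains K. \<forall>c. (\<forall>j\<in>{..N}. c j \<ge> 0) \<longrightarrow>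
     (\<forall>k\<in>Kt. (\<Sum>j\<le>N. c j * (\<Sum>a\<in>U. of_int (vertex C j a) * F (pt K (vertex C j)) a k)) = 0) \<longrightarrow> (\<forall>j\<in>{..N}. c j = 0)"
    by (rule fine_chains_no_kernel) (fact F_cont, fact F_inj)
  then obtain K where K: "K \<ge> 2" and noker: "\<forall>C\<in>chains K. \<forall>c. (\<forall>j\<in>{..N}. c j \<ge> 0) \<longrightarrow>
     (\<forall>k\<in>Kt. (\<Sum>j\<le>N. c j * (\<Sum>a\<in>U. of_int (vertex C j a) * F (pt K (vertex C j)) a k)) = 0) \<longrightarrow> (\<forall>j\<in>{..N}. c j = 0)"
    by (elim exE conjE)
  have K0: "K > 0" using K by simp
  define \<beta> where "\<beta> b y = (if b then \<beta>M h K y else \<beta>A K y)" for b y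
  define L0 where "L0 b C j k = W (pt K (vertex C j)) (\<beta> b (vertex C j)) k" for b C j k
  have L0_True: "L0 True C j k = model h K (vertex C j) k" if "C \<in> chains K" "k \<in> Kt" for C j k
    using W_\<beta>M[OF vertex_in_vertices[OF that(1)] K0 that(2)] by (simp add: L0_def \<beta>_def)
  have L0_False: "L0 False C j k = (\<Sum>a\<in>U. of_int (vertex C j a) * F (pt K (vertex C j)) a k)" for C j k
    by (simp add: L0_def \<beta>_def \<beta>A_def[abs_def] F_def W_sum[OF finite_U])
  have kerM: "(\<Sum>j\<le>N. c j * L0 True C j k) = (\<Sum>j\<le>N. c j * model h K (vertex C j) k)"
    if "C \<in> chains K" "k \<in> Kt" for c C k
    using L0_True[OF that] by simp
  have "\<exists>e>0. \<forall>w. (\<forall>j\<in>{..N}. \<forall>k\<in>Kt. \<bar>w j k - L0 False C j k\<bar> < e) \<longrightarrow> \<not> pos_dep Kt {..N} w" if C: "C \<in> chains K" for C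
  proof (rule not_pos_dep_robust)
    fix c assume "\<forall>j\<in>{..N}. 0 \<le> (c j :: real)" "\<forall>k\<in>Kt. (\<Sum>j\<le>N. c j * L0 False C j k) = 0"
    with bspec[OF noker C, THEN spec, of c] show "\<forall>j\<in>{..N}. c j = 0"
      unfolding L0_False by (elim impE) 
  qed auto
  then obtain e1 where e1: "e1 > 0" "\<And>C w. C \<in> chains K \<Longrightarrow> (\<forall>j\<in>{..N}. \<forall>k\<in>Kt. \<bar>w j k - L0 False C j k\<bar> < e1) \<Longrightarrow> \<not> pos_dep Kt {..N} w"
    using uniform_eps_finite[OF finite_chains, of K "{..N}" Kt "\<lambda>C. L0 False C" "\<lambda>C w. \<not> pos_dep Kt {..N} w"] by auto
  have "\<exists>e>0. \<forall>w. (\<forall>j\<in>{..N}. \<forall>k\<in>Kt. \<bar>w j k - L0 True C j k\<bar> < e) \<longrightarrow> (pos_dep Kt {..N} w \<longleftrightarrow> C = sorted_chain h)" if C: "C \<in> chains K" for C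
  proof (cases "C = sorted_chain h")
    case True
    obtain p where p: "\<And>j. j \<le> N \<Longrightarrow> p j > 0"
      "\<And>c. (\<forall>k\<in>Kt. (\<Sum>j\<le>N. c j * model h K (vertex C j) k) = 0) \<Longrightarrow> (\<exists>s. \<forall>j\<le>N. c j = s * p j)"
      using sorted_chain(2)[OF h K] True by blast
    have "\<exists>e>0. \<forall>w. (\<forall>j\<in>{..N}. \<forall>k\<in>Kt. \<bar>w j k - L0 True C j k\<bar> < e) \<longrightarrow> pos_dep Kt {..N} w"
    proof (rule pos_dep_robust[where p = p])
      fix c assume "\<forall>k\<in>Kt. (\<Sum>j\<le>N. c j * L0 True C j k) = 0"
      then have "\<forall>k\<in>Kt. (\<Sum>j\<le>N. c j * model h K (vertex C j) k) = 0" using kerM[OF C] by simp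
      from p(2)[OF this] show "\<exists>s. \<forall>j\<in>{..N}. c j = s * p j" by auto
    qed (use p(1) card_Kt finite_Kt in auto)
    then show ?thesis using True by simp
  next
    case False
    have "\<exists>e>0. \<forall>w. (\<forall>j\<in>{..N}. \<forall>k\<in>Kt. \<bar>w j k - L0 True C j k\<bar> < e) \<longrightarrow> \<not> pos_dep Kt {..N} w"
    proof (rule not_pos_dep_robust)
      fix c assume c: "\<forall>j\<in>{..N}. (c j::real) \<ge> 0" "\<forall>k\<in>Kt. (\<Sum>j\<le>N. c j * L0 True C j k) = 0"
      then show "\<forall>j\<in>{..N}. c j = 0"
        using model_kernel_unique_chain[OF h C K, of c] kerM[OF C] False by auto
    qed auto
    then show ?thesis using False by simp
  qed
  then obtain e2 where e2: "e2 > 0" "\<And>C w. C \<in> chains K \<Longrightarrow> (\<forall>j\<in>{..N}. \<forall>k\<in>Kt. \<bar>w j k - L0 True C j k\<bar> < e2) \<Longrightarrow> (pos_dep Kt {..N} w \<longleftrightarrow> C = sorted_chain h)"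
    using uniform_eps_finite[OF finite_chains, of K "{..N}" Kt "\<lambda>C. L0 True C" "\<lambda>C w. pos_dep Kt {..N} w \<longleftrightarrow> C = sorted_chain h"] by auto
  \<comment> \<open>Perturbed labels are \<open>W\<close> applied to the matrix \<open>P s\<close>
    times \<open>\<beta>\<close>, where \<open>s\<close> is a rank together with a labelling. Gluing
    acts through \<open>W\<close> alone, so the labels of common facets still correspond.
    \<open>P0\<close> is the identity matrix.\<close>
  define g where "g C s i k = W (pt K (vertex C (fst s))) (unit_at (fst i)) k * \<beta> (snd s) (vertex C (fst s)) (snd i)"
    for C s i k
  define P0 where "P0 i = (of_bool (fst i = snd i) :: real)" for i :: "('x + 'v \<times> bool) \<times> ('x + 'v \<times> bool)"
  have g_sum: "(\<Sum>i\<in>Kt \<times> Kt. M i * g C s i k) =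
      (\<Sum>k1\<in>Kt. (\<Sum>k2\<in>Kt. M (k1, k2) * \<beta> (snd s) (vertex C (fst s)) k2) * W (pt K (vertex C (fst s))) (unit_at k1) k)" for M C s k
    unfolding g_def sum_distrib_right sum.cartesian_product by (simp add: case_prod_beta algebra_simps)
  have g_P0: "(\<Sum>i\<in>Kt \<times> Kt. P0 i * g C (j, b) i k) = L0 b C j k" if "k \<in> Kt" for C j b k
  proof -
    have "(\<Sum>k2\<in>Kt. P0 (k1, k2) * \<beta> b (vertex C j) k2) = \<beta> b (vertex C j) k1" if "k1 \<in> Kt" for k1
      using that finite_Kt sum_of_bool_eq(2)[of Kt k1] by (simp add: P0_def eq_commute)
    then show ?thesis unfolding g_sum L0_def W_expand[OF that, of "pt K (vertex C j)" "\<beta> b (vertex C j)"] by simp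
  qed
  have \<beta>_nz: "\<exists>k\<in>Kt. \<beta> b y k \<noteq> 0" if "y \<in> vertices K" for b y
    using \<beta>A_nonzero[OF that K0] \<beta>M_nonzero[OF h that K] by (simp add: \<beta>_def)
  have rich: "\<exists>M. \<forall>k'\<in>Kt. (\<Sum>i\<in>Kt \<times> Kt. M i * g C s i k') = of_bool (k' = k)"
    if C: "C \<in> chains K" and k: "k \<in> Kt" for C s k
  proof -
    let ?y = "vertex C (fst s)"
    have y: "?y \<in> vertices K" by (rule vertex_in_vertices[OF C])
    obtain k2 where k2: "k2 \<in> Kt" "\<beta> (snd s) ?y k2 \<noteq> 0" using \<beta>_nz[OF y] by blast
    obtain x where x: "\<forall>k'\<in>Kt. W (pt K ?y) x k' = of_bool (k' = k)"
      using W_surj[OF pt_cube[OF y K0], of "\<lambda>k'. of_bool (k' = k)"] by blast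
    \<comment> \<open>A matrix of rank one that sends the nonzero vector \<open>\<beta>\<close> to
      the preimage \<open>x\<close> of a unit vector.\<close>
    define M where "M i = of_bool (snd i = k2) * (x (fst i) / \<beta> (snd s) ?y k2)" for i
    have "(\<Sum>k2\<in>Kt. M (k1, k2) * \<beta> (snd s) ?y k2) = x k1" for k1
    proof -
      have "(\<Sum>k2'\<in>Kt. M (k1, k2') * \<beta> (snd s) ?y k2') =
          (\<Sum>k2'\<in>Kt. of_bool (k2' = k2) * (x k1 / \<beta> (snd s) ?y k2 * \<beta> (snd s) ?y k2'))"
        by (rule sum.cong) (auto simp: M_def)
      also have "\<dots> = x k1 / \<beta> (snd s) ?y k2 * \<beta> (snd s) ?y k2"
        by (rule sum_of_bool_eq(2)[OF finite_Kt k2(1)])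
      also have "\<dots> = x k1" using k2(2) by simp
      finally show ?thesis .
    qed
    then have "(\<Sum>i\<in>Kt \<times> Kt. M i * g C s i k') = of_bool (k' = k)" if "k' \<in> Kt" for k'
      unfolding g_sum using x that W_expand[OF that, of "pt K ?y" x] by simp
    then show ?thesis by blast
  qed
  have "\<exists>P. (\<forall>C\<in>chains K. \<forall>s\<in>{..N} \<times> UNIV. \<forall>k\<in>Kt.
      \<bar>(\<Sum>i\<in>Kt \<times> Kt. P s i * g C s i k) - (\<Sum>i\<in>Kt \<times> Kt. P0 i * g C s i k)\<bar> < min e1 e2) \<and>
    (\<forall>C\<in>chains K. \<forall>J\<subseteq>{..N} \<times> UNIV. card J \<le> card Kt \<longrightarrow>
      lin_indep Kt J (\<lambda>s k. \<Sum>i\<in>Kt \<times> Kt. P s i * g C s i k))"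
    by (rule generic_labels) (use finite_Kt finite_chains e1(1) e2(1) rich in auto)
  then obtain P where P: "\<forall>C\<in>chains K. \<forall>s\<in>{..N} \<times> UNIV. \<forall>k\<in>Kt.
      \<bar>(\<Sum>i\<in>Kt \<times> Kt. P s i * g C s i k) - (\<Sum>i\<in>Kt \<times> Kt. P0 i * g C s i k)\<bar> < min e1 e2"
    and gp: "\<forall>C\<in>chains K. \<forall>J\<subseteq>{..N} \<times> UNIV. card J \<le> card Kt \<longrightarrow>
      lin_indep Kt J (\<lambda>s k. \<Sum>i\<in>Kt \<times> Kt. P s i * g C s i k)"
    by (elim exE conjE)
  define L where "L b C j k = (\<Sum>i\<in>Kt \<times> Kt. P (j, b) i * g C (j, b) i k)" for b C j k
  have close: "\<bar>L b C j k - L0 b C j k\<bar> < min e1 e2" if "C \<in> chains K" "j \<le> N" "k \<in> Kt" for b C j k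
  proof -
    have "(j, b) \<in> {..N} \<times> UNIV" using that by simp
    from bspec[OF bspec[OF bspec[OF P that(1)] this] that(3)] show ?thesis unfolding g_P0[OF that(3)] L_def .
  qed
  have "even (card {C \<in> chains K. pos_dep Kt {..N} (L True C)} + card {C \<in> chains K. pos_dep Kt {..N} (L False C)})"
  proof (rule parity_invariance[where \<phi> = "flip K"])
    fix i C assume i: "i \<le> N" and C: "C \<in> chains K"
    have ok: "flip_ok K i C" by (rule flip_ok) (use K C i in auto)
    show "flip K i C \<in> chains K \<and> flip K i (flip K i C) = C \<and> flip K i C \<noteq> C"
      using ok by (simp add: flip_ok_def)
    then have C': "flip K i C \<in> chains K" by simp
    fix k assume k: "k \<in> Kt"
    have sum_eq: "L b (flip K i C) j k = s * L b C j k'"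
      if "\<And>p. p \<in> Kt \<times> Kt \<Longrightarrow> g (flip K i C) (j, b) p k = s * g C (j, b) p k'" for b j s k'
      using that unfolding L_def sum_distrib_left by (intro sum.cong) auto
    show "\<exists>k'\<in>Kt. \<exists>s. \<forall>b. \<forall>j\<le>N. j \<noteq> i \<longrightarrow> L b (flip K i C) j k = s * L b C j k'"
      using ok unfolding flip_ok_def
    proof (elim conjE disjE)
      assume same: "\<forall>j\<le>N. j \<noteq> i \<longrightarrow> vertex (flip K i C) j = vertex C j"
      have "L b (flip K i C) j k = 1 * L b C j k" if "j \<le> N" "j \<noteq> i" for b j
        by (rule sum_eq) (use same that in \<open>auto simp: g_def\<close>)
      then show ?thesis using k by (intro bexI[of _ k] exI[of _ 1]) auto
    next
      assume neg: "\<forall>j\<le>N. j \<noteq> i \<longrightarrow> vertex (flip K i C) j = (\<lambda>c. neg_at c (vertex C j c)) \<and> vertex C j E = 0"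
      have "L b (flip K i C) j k = (-1) * L b C j k" if j: "j \<le> N" "j \<noteq> i" for b j
      proof (rule sum_eq)
        fix p assume p: "p \<in> Kt \<times> Kt"
        have eq: "vertex (flip K i C) j = (\<lambda>c. neg_at c (vertex C j c))" using neg j by blast
        have pt: "pt K (vertex (flip K i C) j) = pt K (vertex C j)"
          unfolding eq by (auto simp: pt_def neg_at_def fun_eq_iff)
        have "\<beta> b (vertex (flip K i C) j) (snd p) = - \<beta> b (vertex C j) (snd p)"
          using \<beta>A_neg \<beta>M_neg[OF vertex_in_vertices[OF C] _ K0, of j "snd p" h] vertex_in_vertices[OF C', of j] p
          unfolding eq \<beta>_def by auto
        then show "g (flip K i C) (j, b) p k = - 1 * g C (j, b) p k" by (simp add: g_def pt)
      qed
      then show ?thesis using k by (intro bexI[of _ k] exI[of _ "-1"]) auto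
    next
      assume "\<exists>v\<in>V. \<forall>j\<le>N. j \<noteq> i \<longrightarrow> vertex (flip K i C) j = glue K v (vertex C j) \<and> vertex C j (T v) \<in> {0, 2 * K}"
      then obtain v where v: "v \<in> V"
        and gl: "\<And>j. j \<le> N \<Longrightarrow> j \<noteq> i \<Longrightarrow> vertex (flip K i C) j = glue K v (vertex C j) \<and> vertex C j (T v) \<in> {0, 2 * K}"
        by blast
      have "L b (flip K i C) j k = sgK v k * L b C j (permK v k)" if j: "j \<le> N" "j \<noteq> i" for b j
      proof (rule sum_eq)
        fix p assume p: "p \<in> Kt \<times> Kt"
        have eq: "vertex (flip K i C) j = glue K v (vertex C j)" using gl[OF j] by blast
        have oe: "on_end K v (vertex C j)"
          using v gl[OF j] vertex_in_vertices[OF C, of j] vertex_in_vertices[OF C', of j] by (simp add: on_end_def)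
        have "\<beta> b (vertex (flip K i C) j) (snd p) = \<beta> b (vertex C j) (snd p)"
          using \<beta>A_glue[OF oe K0, of "snd p"] \<beta>M_glue[OF oe K, of "snd p" h] p unfolding eq \<beta>_def by auto
        then show "g (flip K i C) (j, b) p k = sgK v k * g C (j, b) p (permK v k)"
          using W_glue[OF oe K0 k] by (simp add: g_def eq)
      qed
      then show ?thesis using permK_Kt[OF v k] by (intro bexI[of _ "permK v k"] exI[of _ "sgK v k"]) auto
    qed
  next
    fix C J assume "C \<in> chains K" "J \<subseteq> {..N} \<times> (UNIV :: bool set)" "card J \<le> N"
    moreover have "(\<lambda>(j, b). L b C j) = (\<lambda>s k. \<Sum>i\<in>Kt \<times> Kt. P s i * g C s i k)"
      by (auto simp: L_def fun_eq_iff)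
    ultimately show "lin_indep Kt J (\<lambda>(j, b). L b C j)" using gp card_Kt by simp
  qed (use finite_Kt finite_chains card_Kt in auto)
  \<comment> \<open>The counts are 0 for the given family and 1 for the model, so their sum is
    odd.\<close>
  moreover have "{C \<in> chains K. pos_dep Kt {..N} (L False C)} = {}"
    using e1(2) close[of _ _ _ False] by auto
  moreover have "{C \<in> chains K. pos_dep Kt {..N} (L True C)} = {sorted_chain h}"
    using e2(2)[of _ "L True _"] close[of _ _ _ True] sorted_chain(1)[OF h K] by fastforce
  ultimately show False by simp
qed

end

section \<open>Robust forests and rotating configurations of points\<close>

text \<open>
  The points \<open>(x i, y i)\<close> stand for edges joining the \<open>x\<close>-value to the \<open>y\<close>-value in a bipartite graph
  whose vertices are only known up to an error \<open>\<eta>\<close>; no identification of vertices within this error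
  creates a cycle.
\<close>

definition robust_forest :: "real \<Rightarrow> 'i set \<Rightarrow> ('i \<Rightarrow> real) \<Rightarrow> ('i \<Rightarrow> real) \<Rightarrow> bool"
  where "robust_forest \<eta> I x y \<longleftrightarrow> (\<forall>(\<alpha> :: 'i \<Rightarrow> real) (\<beta> :: 'i \<Rightarrow> real) (c :: 'i \<Rightarrow> real).
    (\<forall>i\<in>I. \<forall>j\<in>I. \<alpha> i = \<alpha> j \<longrightarrow> \<bar>x i - x j\<bar> \<le> \<eta>) \<longrightarrow>
    (\<forall>i\<in>I. \<forall>j\<in>I. \<beta> i = \<beta> j \<longrightarrow> \<bar>y i - y j\<bar> \<le> \<eta>) \<longrightarrow>
    (\<forall>i\<in>I. sum c {j \<in> I. \<alpha> j = \<alpha> i} = 0) \<longrightarrow> (\<forall>i\<in>I. sum c {j \<in> I. \<beta> j = \<beta> i} = 0) \<longrightarrow>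
    (\<forall>i\<in>I. c i = 0))"

lemma robust_forestD:
  fixes \<alpha> \<beta> c :: "'i \<Rightarrow> real"
  assumes "robust_forest \<eta> I x y"
    and "\<And>i j. i \<in> I \<Longrightarrow> j \<in> I \<Longrightarrow> \<alpha> i = \<alpha> j \<Longrightarrow> \<bar>x i - x j\<bar> \<le> \<eta>"
    and "\<And>i j. i \<in> I \<Longrightarrow> j \<in> I \<Longrightarrow> \<beta> i = \<beta> j \<Longrightarrow> \<bar>y i - y j\<bar> \<le> \<eta>"
    and "\<And>i. i \<in> I \<Longrightarrow> sum c {j \<in> I. \<alpha> j = \<alpha> i} = 0"
    and "\<And>i. i \<in> I \<Longrightarrow> sum c {j \<in> I. \<beta> j = \<beta> i} = 0"
    and "i \<in> I"
  shows "c i = (0::real)"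
  using assms(1)[unfolded robust_forest_def, rule_format, of \<alpha> \<beta> c i] assms(2-) by blast

lemma robust_forest_swap: "robust_forest \<eta> I x y \<Longrightarrow> robust_forest \<eta> I y x"
  unfolding robust_forest_def by blast

lemma robust_forest_mono:
  assumes rf: "robust_forest \<eta> I x y" and le: "\<eta>' \<le> \<eta>"
  shows "robust_forest \<eta>' I x y"
  unfolding robust_forest_def
proof (intro allI impI ballI)
  fix \<alpha> \<beta> c :: "'a \<Rightarrow> real" and i
  assume a: "\<forall>i\<in>I. \<forall>j\<in>I. \<alpha> i = \<alpha> j \<longrightarrow> \<bar>x i - x j\<bar> \<le> \<eta>'"
    "\<forall>i\<in>I. \<forall>j\<in>I. \<beta> i = \<beta> j \<longrightarrow> \<bar>y i - y j\<bar> \<le> \<eta>'"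
    "\<forall>i\<in>I. sum c {j \<in> I. \<alpha> j = \<alpha> i} = 0" "\<forall>i\<in>I. sum c {j \<in> I. \<beta> j = \<beta> i} = 0" "i \<in> I"
  show "c i = 0"
  proof (rule robust_forestD[OF rf, of \<alpha> \<beta> c])
    show "\<bar>x i - x j\<bar> \<le> \<eta>" if "i \<in> I" "j \<in> I" "\<alpha> i = \<alpha> j" for i j using a(1) that le by fastforce
    show "\<bar>y i - y j\<bar> \<le> \<eta>" if "i \<in> I" "j \<in> I" "\<beta> i = \<beta> j" for i j using a(2) that le by fastforce
  qed (use a in auto)
qed

lemma robust_forest_image:
  assumes inj: "inj_on f I" and rf: "robust_forest \<eta> I (\<lambda>i. x (f i)) (\<lambda>i. y (f i))"
  shows "robust_forest \<eta> (f ` I) x y"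
  unfolding robust_forest_def
proof (intro allI impI ballI)
  fix \<alpha> \<beta> c :: "'b \<Rightarrow> real" and i
  assume a: "\<forall>i\<in>f ` I. \<forall>j\<in>f ` I. \<alpha> i = \<alpha> j \<longrightarrow> \<bar>x i - x j\<bar> \<le> \<eta>"
    "\<forall>i\<in>f ` I. \<forall>j\<in>f ` I. \<beta> i = \<beta> j \<longrightarrow> \<bar>y i - y j\<bar> \<le> \<eta>"
    "\<forall>i\<in>f ` I. sum c {j \<in> f ` I. \<alpha> j = \<alpha> i} = 0" "\<forall>i\<in>f ` I. sum c {j \<in> f ` I. \<beta> j = \<beta> i} = 0" "i \<in> f ` I"
  have s: "sum c {j \<in> f ` I. P j} = (\<Sum>j\<in>{j \<in> I. P (f j)}. c (f j))" for P
  proof -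
    have "{j \<in> f ` I. P j} = f ` {j \<in> I. P (f j)}" by auto
    moreover have "inj_on f {j \<in> I. P (f j)}" using inj by (rule inj_on_subset) auto
    ultimately show ?thesis by (simp add: sum.reindex)
  qed
  obtain i' where i': "i' \<in> I" "i = f i'" using a(5) by blast
  have "c (f i') = 0"
    by (rule robust_forestD[OF rf, of "\<lambda>i. \<alpha> (f i)" "\<lambda>i. \<beta> (f i)" "\<lambda>i. c (f i)"])
      (use a i' in \<open>auto simp: s\<close>)
  then show "c i = 0" by (simp add: i')
qed

lemma robust_forest_affine:
  assumes rf: "robust_forest \<eta> I x y" and s: "s > 0"
  shows "robust_forest (s * \<eta>) I (\<lambda>i. p + s * x i) (\<lambda>i. q + s * y i)"
proof -
  have "\<bar>p + s * a - (p + s * b)\<bar> \<le> s * \<eta> \<longleftrightarrow> \<bar>a - b\<bar> \<le> \<eta>" for p a b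
  proof -
    have "\<bar>p + s * a - (p + s * b)\<bar> = s * \<bar>a - b\<bar>"
      using s by (simp add: abs_mult right_diff_distrib[symmetric])
    then show ?thesis using s by simp
  qed
  then show ?thesis using rf unfolding robust_forest_def by simp
qed

text \<open>
  If the \<open>y\<close>-values of the two parts are far apart, the sum of \<open>c\<close> over each part vanishes. So merging
  all \<open>\<alpha>\<close>-classes of the first part that meet the second one gives a class of the first part with sum 0.
\<close>

lemma robust_forest_join:
  assumes fin: "finite I1" "finite I2" and disj: "I1 \<inter> I2 = {}"
    and rf1: "robust_forest \<eta>' I1 x y" and rf2: "robust_forest \<eta> I2 x y" and le: "\<eta> \<le> \<eta>'"
    and sep: "\<And>i j. i \<in> I1 \<Longrightarrow> j \<in> I2 \<Longrightarrow> \<bar>y i - y j\<bar> > \<eta>"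
    and near: "\<And>i i' j j'. i \<in> I1 \<Longrightarrow> i' \<in> I1 \<Longrightarrow> j \<in> I2 \<Longrightarrow> j' \<in> I2 \<Longrightarrow>
       \<bar>x i - x j\<bar> \<le> \<eta> \<Longrightarrow> \<bar>x i' - x j'\<bar> \<le> \<eta> \<Longrightarrow> \<bar>x i - x i'\<bar> \<le> \<eta>'"
  shows "robust_forest \<eta> (I1 \<union> I2) x y"
  unfolding robust_forest_def
proof (intro allI impI)
  fix \<alpha> \<beta> :: "'a \<Rightarrow> real" and c :: "'a \<Rightarrow> real"
  assume \<alpha>: "\<forall>i\<in>I1 \<union> I2. \<forall>j\<in>I1 \<union> I2. \<alpha> i = \<alpha> j \<longrightarrow> \<bar>x i - x j\<bar> \<le> \<eta>"
    and \<beta>: "\<forall>i\<in>I1 \<union> I2. \<forall>j\<in>I1 \<union> I2. \<beta> i = \<beta> j \<longrightarrow> \<bar>y i - y j\<bar> \<le> \<eta>"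
    and s\<alpha>: "\<forall>i\<in>I1 \<union> I2. sum c {j \<in> I1 \<union> I2. \<alpha> j = \<alpha> i} = 0"
    and s\<beta>: "\<forall>i\<in>I1 \<union> I2. sum c {j \<in> I1 \<union> I2. \<beta> j = \<beta> i} = 0"
  have \<beta>_ne: "\<beta> i \<noteq> \<beta> j" if "i \<in> I1" "j \<in> I2" for i j
    using \<beta> sep[OF that] that by fastforce
  have s\<beta>1: "sum c {j \<in> I1. \<beta> j = \<beta> i} = 0" if i: "i \<in> I1" for i
  proof -
    have "{j \<in> I1 \<union> I2. \<beta> j = \<beta> i} = {j \<in> I1. \<beta> j = \<beta> i}" using \<beta>_ne[OF i] by force
    then show ?thesis using bspec[OF s\<beta>, of i] i by simp
  qed
  have s\<beta>2: "sum c {j \<in> I2. \<beta> j = \<beta> i} = 0" if i: "i \<in> I2" for i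
  proof -
    have "{j \<in> I1 \<union> I2. \<beta> j = \<beta> i} = {j \<in> I2. \<beta> j = \<beta> i}" using \<beta>_ne[OF _ i] by force
    then show ?thesis using bspec[OF s\<beta>, of i] i by simp
  qed
  have "sum c I1 = (\<Sum>b\<in>\<beta> ` I1. sum c {j \<in> I1. \<beta> j = b})" by (rule sum.image_gen[OF fin(1)])
  also have "\<dots> = 0" by (rule sum.neutral) (use s\<beta>1 in auto)
  finally have tot: "sum c I1 = 0" .
  define M where "M = {i \<in> I1. \<exists>j\<in>I2. \<alpha> j = \<alpha> i}"
  have pure: "sum c {j \<in> I1. \<alpha> j = \<alpha> i} = 0" if i: "i \<in> I1 - M" for i
  proof -
    have "{j \<in> I1 \<union> I2. \<alpha> j = \<alpha> i} = {j \<in> I1. \<alpha> j = \<alpha> i}" using i by (auto simp: M_def)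
    then show ?thesis using bspec[OF s\<alpha>, of i] i by simp
  qed
  have M_closed: "i \<in> M \<longleftrightarrow> j \<in> M" if "i \<in> I1" "j \<in> I1" "\<alpha> i = \<alpha> j" for i j
    using that by (auto simp: M_def)
  have "sum c (I1 - M) = (\<Sum>b\<in>\<alpha> ` (I1 - M). sum c {j \<in> I1 - M. \<alpha> j = b})"
    using fin by (intro sum.image_gen) auto
  also have "\<dots> = 0"
  proof (rule sum.neutral, rule ballI)
    fix b assume "b \<in> \<alpha> ` (I1 - M)"
    then obtain i where i: "i \<in> I1 - M" "b = \<alpha> i" by blast
    have "{j \<in> I1 - M. \<alpha> j = b} = {j \<in> I1. \<alpha> j = \<alpha> i}" using i M_closed[of i] by auto
    then show "sum c {j \<in> I1 - M. \<alpha> j = b} = 0" using pure[OF i(1)] by simp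
  qed
  finally have "sum c (I1 - M) = 0" .
  then have sM: "sum c M = 0"
    using tot fin sum.subset_diff[of M I1 c] by (simp add: M_def)
  define i0 where "i0 = (SOME i. i \<in> M)"
  have i0: "i0 \<in> M" if "i \<in> M" for i using that unfolding i0_def by (rule someI)
  define \<alpha>' where "\<alpha>' i = (if i \<in> M then \<alpha> i0 else \<alpha> i)" for i
  have \<alpha>'_cases: "i \<in> M \<and> j \<in> M \<or> i \<notin> M \<and> j \<notin> M \<and> \<alpha> i = \<alpha> j" if ij: "i \<in> I1" "j \<in> I1" "\<alpha>' i = \<alpha>' j" for i j
    using ij i0[of i] i0[of j] M_closed[of i0 j] M_closed[of i0 i]
    by (auto simp: \<alpha>'_def M_def split: if_splits)
  have c1: "c i = 0" if "i \<in> I1" for i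
  proof (rule robust_forestD[OF rf1, of \<alpha>' \<beta> c])
    show "\<bar>x i - x j\<bar> \<le> \<eta>'" if ij: "i \<in> I1" "j \<in> I1" "\<alpha>' i = \<alpha>' j" for i j
    proof (cases "i \<in> M \<and> j \<in> M")
      case True
      then obtain i' j' where p: "i' \<in> I2" "\<alpha> i' = \<alpha> i" "j' \<in> I2" "\<alpha> j' = \<alpha> j" by (auto simp: M_def)
      then have "\<bar>x i - x i'\<bar> \<le> \<eta>" "\<bar>x j - x j'\<bar> \<le> \<eta>" using \<alpha> ij by auto
      then show ?thesis using near[OF ij(1,2) p(1,3)] by blast
    next
      case False
      then have "\<alpha> i = \<alpha> j" using \<alpha>'_cases[OF ij] by blast
      then show ?thesis using \<alpha> ij le by fastforce
    qed
    show "\<bar>y i - y j\<bar> \<le> \<eta>'" if "i \<in> I1" "j \<in> I1" "\<beta> i = \<beta> j" for i j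
      using \<beta> that le by fastforce
    show "sum c {j \<in> I1. \<alpha>' j = \<alpha>' i} = 0" if i: "i \<in> I1" for i
    proof (cases "i \<in> M")
      case True
      have "j \<in> I1 \<and> \<alpha>' j = \<alpha>' i" if "j \<in> M" for j
        using that True by (simp add: \<alpha>'_def) (simp add: M_def)
      then have "{j \<in> I1. \<alpha>' j = \<alpha>' i} = M" using \<alpha>'_cases[OF _ i] True by blast
      then show ?thesis using sM by simp
    next
      case False
      have "\<alpha>' j = \<alpha>' i \<longleftrightarrow> \<alpha> j = \<alpha> i" if j: "j \<in> I1" for j
      proof
        show "\<alpha> j = \<alpha> i" if "\<alpha>' j = \<alpha>' i" using \<alpha>'_cases[OF j i that] False by simp
        show "\<alpha>' j = \<alpha>' i" if "\<alpha> j = \<alpha> i" using M_closed[OF j i that] False that by (simp add: \<alpha>'_def)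
      qed
      then have "{j \<in> I1. \<alpha>' j = \<alpha>' i} = {j \<in> I1. \<alpha> j = \<alpha> i}" by blast
      then show ?thesis using pure[of i] i False by simp
    qed
  qed (use s\<beta>1 that in auto)
  have c2: "c i = 0" if "i \<in> I2" for i
  proof (rule robust_forestD[OF rf2, of \<alpha> \<beta> c])
    show "sum c {j \<in> I2. \<alpha> j = \<alpha> i} = 0" if "i \<in> I2" for i
    proof -
      have "sum c {j \<in> I1 \<union> I2. \<alpha> j = \<alpha> i} = sum c {j \<in> I2. \<alpha> j = \<alpha> i}"
        by (rule sum.mono_neutral_right) (use fin c1 in auto)
      then show ?thesis using bspec[OF s\<alpha>, of i] that by simp
    qed
  qed (use \<alpha> \<beta> s\<beta>2 that in auto)
  show "\<forall>i\<in>I1 \<union> I2. c i = 0" using c1 c2 by blast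
qed

section \<open>Words as addresses in a binary tree; \<open>sw v\<close> exchanges the subtrees below
  \<open>v\<close>\<close>

fun sw :: "bool list \<Rightarrow> bool list \<Rightarrow> bool list" where
  "sw v [] = []"
| "sw [] (b # l) = (\<not> b) # l"
| "sw (a # v) (b # l) = (if a = b then b # sw v l else b # l)"

lemma length_sw [simp]: "length (sw v l) = length l"
  by (induction v l rule: sw.induct) auto

lemma sw_sw [simp]: "sw v (sw v l) = l"
  by (induction v l rule: sw.induct) auto

lemma sw_self [simp]: "sw v v = v"
  by (induction v) auto

lemma sw_eq_iff [simp]: "sw v w = v \<longleftrightarrow> w = v"
  by (metis sw_self sw_sw)

text \<open>Unnormalised Haar functions, 1 and -1 on the two subtrees below \<open>w\<close>. With
  the constant they split the permutation representation on the leaves into a trivial part and a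
  signed permutation representation on the nodes, see \<open>haar_sw\<close>.\<close>

fun haar :: "bool list \<Rightarrow> bool list \<Rightarrow> real" where
  "haar w [] = 0"
| "haar [] (b # l) = (if b then -1 else 1)"
| "haar (a # w) (b # l) = (if a = b then haar w l else 0)"

lemma haar_sw: "haar w (sw v l) = (if w = v then -1 else 1) * haar (sw v w) l"
  by (induction v l arbitrary: w rule: sw.induct; case_tac w) auto

fun tree_level :: "nat \<Rightarrow> bool list set" where
  "tree_level k = {l. length l = k}"

lemma finite_tree_level: "finite (tree_level k)"
  using finite_lists_length_eq[of "UNIV :: bool set" k] by simp

lemma finite_below_level: "finite {w :: bool list. length w < k}"
  using finite_lists_length_le[of "UNIV :: bool set" k] by (rule finite_subset[rotated]) auto

lemma tree_level_Suc: "tree_level (Suc k) = Cons False ` tree_level k \<union> Cons True ` tree_level k"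
proof -
  have "l \<in> Cons False ` tree_level k \<union> Cons True ` tree_level k" if "length l = Suc k" for l
    using that by (cases l; cases "hd l") auto
  then show ?thesis by auto
qed

lemma card_tree_level: "card (tree_level k) = 2 ^ k"
  using card_lists_length_eq[of "UNIV :: bool set" k] by simp

lemma below_level_Suc: "{w :: bool list. length w < Suc k} =
    insert [] (Cons False ` {w. length w < k} \<union> Cons True ` {w. length w < k})"
proof -
  have "w = [] \<or> w \<in> Cons False ` {w. length w < k} \<union> Cons True ` {w. length w < k}" if "length w < Suc k" for w
    using that by (cases w; cases "hd w") auto
  then show ?thesis by auto
qed

lemma sum_below_level_Suc:
  "(\<Sum>w | length w < Suc k. f w) = f [] + ((\<Sum>w | length w < k. f (False # w)) + (\<Sum>w | length w < k. f (True # w)))"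
proof -
  have "(\<Sum>w | length w < Suc k. f w) = f [] + sum f (Cons False ` {w. length w < k} \<union> Cons True ` {w. length w < k})"
    unfolding below_level_Suc using finite_below_level[of k] by (subst sum.insert) auto
  also have "sum f (Cons False ` {w. length w < k} \<union> Cons True ` {w. length w < k}) =
      sum f (Cons False ` {w. length w < k}) + sum f (Cons True ` {w. length w < k})"
    using finite_below_level[of k] by (subst sum.union_disjoint) auto
  finally show ?thesis by (simp add: sum.reindex)
qed

lemma card_below_level: "card {w :: bool list. length w < k} = 2 ^ k - 1"
proof (induction k)
  case (Suc k)
  have "card {w :: bool list. length w < Suc k} = (\<Sum>w :: bool list | length w < Suc k. 1)" by simp
  also have "\<dots> = 1 + (2 ^ k - 1 + (2 ^ k - 1))" unfolding sum_below_level_Suc using Suc by simp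
  finally have "card {w :: bool list. length w < Suc k} = 1 + (2 ^ k - 1 + (2 ^ k - 1))" .
  moreover have "(1::nat) \<le> 2 ^ k" by simp
  ultimately show ?case unfolding power_Suc by linarith
qed simp

text \<open>On each subtree of the root the Haar function of the root is constant and joins
  \<open>u0\<close>; induction gives \<open>u0 + u [] = 0 = u0 - u []\<close>.\<close>

lemma haar_independent:
  assumes "\<And>l. length l = k \<Longrightarrow> (\<Sum>w | length w < k. u w * haar w l) + u0 = 0"
  shows "u0 = 0 \<and> (\<forall>w. length w < k \<longrightarrow> u w = 0)"
  using assms
proof (induction k arbitrary: u u0)
  case 0
  from 0[of "[]"] show ?case by simp
next
  case (Suc k)
  have step: "(if b then - u [] else u []) + u0 = 0 \<and> (\<forall>w. length w < k \<longrightarrow> u (b # w) = 0)" for b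
  proof (rule Suc.IH)
    fix l :: "bool list" assume "length l = k"
    then have "(\<Sum>w | length w < Suc k. u w * haar w (b # l)) + u0 = 0" using Suc.prems[of "b # l"] by simp
    then show "(\<Sum>w | length w < k. u (b # w) * haar w l) + ((if b then - u [] else u []) + u0) = 0"
      unfolding sum_below_level_Suc by (cases b) (auto simp: algebra_simps)
  qed
  have "u [] = 0" "u0 = 0" using step[of True] step[of False] by auto
  moreover have "u w = 0" if "length w < Suc k" for w
    using that step \<open>u [] = 0\<close> by (cases w) auto
  ultimately show ?case by blast
qed

text \<open>The tolerance for trees of depth k. A subtree is scaled by at least (eta k / 4) / 8 =
  eta k / 32, see \<open>shrink\<close>, which turns its tolerance eta k into the square of eta k
  over 32.\<close>

fun eta :: "nat \<Rightarrow> real" where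
  "eta 0 = 1"
| "eta (Suc k) = (eta k)\<^sup>2 / 32"

lemma eta_bounds: "0 < eta k \<and> eta k \<le> 1"
proof (induction k)
  case (Suc k)
  then have "(eta k)\<^sup>2 \<le> 1" by (simp add: power_le_one)
  then show ?case using Suc by simp
qed simp

text \<open>
  One cluster passes the other along an L-shaped path. Whenever the shadows of the two clusters on a
  coordinate axis (\<open>False\<close> for \<open>x\<close>) can overlap, one of them is shrunk by the factor \<open>e\<close>; the roles
  are exchanged half way, where both shadows are disjoint.
\<close>

definition displacement :: "bool \<Rightarrow> real \<Rightarrow> real"
  where "displacement a t = (if a then min 1 (3 - 4 * t) else max (-1) (1 - 4 * t))"

definition half :: "bool \<Rightarrow> real"
  where "half b = (if b then 1/2 else -1/2)"

text \<open>Cluster \<open>False\<close> has the factor 1/8 up to t = 3/8 and e/8 from 5/8 on,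
  cluster \<open>True\<close> the other way round, so the two factors are exchanged between t = 0
  and t = 1. With radius at most 1/8 the clusters stay apart when their centres are 1/2
  apart.\<close>

definition shrink :: "real \<Rightarrow> bool \<Rightarrow> real \<Rightarrow> real"
  where "shrink e b t = (1 - (1 - e) * max 0 (min 1 (4 * (if b then 1 - t else t) - 3/2))) / 8"

fun pos :: "bool \<Rightarrow> (bool list \<Rightarrow> real) \<Rightarrow> bool list \<Rightarrow> real" where
  "pos a \<theta> [] = 0"
| "pos a \<theta> (b # l) = half b * displacement a (\<theta> []) +
     shrink (eta (length l) / 4) b (\<theta> []) * pos a (\<lambda>v. \<theta> (b # v)) l"

text \<open>From 0 to 1 \<open>displacement\<close> goes from 1 to -1 and the factors
  \<open>shrink\<close> are exchanged, so the two clusters take each other's places.\<close>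

lemma pos_sw:
  assumes "\<theta> v = 0"
  shows "pos a (\<lambda>w. if w = v then 1 else \<theta> (sw v w)) l = pos a \<theta> (sw v l)"
  using assms
proof (induction v l arbitrary: \<theta> rule: sw.induct)
  case (2 b l)
  then show ?case by (cases b) (auto simp: half_def displacement_def shrink_def)
next
  case (3 c v b l)
  show ?case
  proof (cases "c = b")
    case True
    then have "pos a (\<lambda>w. if w = v then 1 else \<theta> (b # sw v w)) l = pos a (\<lambda>w. \<theta> (b # w)) (sw v l)"
      using "3.IH"[of "\<lambda>w. \<theta> (b # w)"] "3.prems" by simp
    then show ?thesis using True by (simp cong: if_cong)
  qed (auto cong: if_cong)
qed simp

lemma shrink_bounds:
  assumes "0 \<le> e" "e \<le> 1"
  shows "e / 8 \<le> shrink e b t" "shrink e b t \<le> 1 / 8"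
proof -
  define m where "m = max 0 (min 1 (4 * (if b then 1 - t else t) - 3/2))"
  have m: "0 \<le> m" "m \<le> 1" by (auto simp: m_def)
  have "(1 - e) * m \<le> (1 - e) * 1" using m assms by (intro mult_left_mono) auto
  moreover have "0 \<le> (1 - e) * m" using m assms by simp
  ultimately show "e / 8 \<le> shrink e b t" "shrink e b t \<le> 1 / 8" by (auto simp: shrink_def m_def[symmetric])
qed

lemma pos_bound:
  assumes "\<And>v. 0 \<le> \<theta> v \<and> \<theta> v \<le> 1"
  shows "\<bar>pos a \<theta> l\<bar> \<le> 1"
  using assms
proof (induction l arbitrary: \<theta>)
  case (Cons b l)
  let ?s = "shrink (eta (length l) / 4) b (\<theta> [])" and ?p = "pos a (\<lambda>v. \<theta> (b # v)) l"
  have s: "0 \<le> ?s" "?s \<le> 1 / 8"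
    using shrink_bounds[of "eta (length l) / 4" b "\<theta> []"] eta_bounds[of "length l"] by auto
  have "\<bar>?p\<bar> \<le> 1" using Cons by simp
  then have "\<bar>?s * ?p\<bar> \<le> 1/8 * 1" unfolding abs_mult using s by (intro mult_mono) auto
  moreover have "\<bar>half b * displacement a (\<theta> [])\<bar> \<le> 1/2"
    using Cons.prems[of "[]"] by (auto simp: half_def displacement_def)
  ultimately show ?case by simp
qed simp

text \<open>Up to t = 3/8 the subtrees are apart in y and \<open>True\<close> is small; after 5/8
  they are apart in x and \<open>False\<close> is small; in between they are apart in both. Each
  case is a use of \<open>robust_forest_join\<close>.\<close>

lemma pos_robust_forest:
  assumes "\<And>v. 0 \<le> \<theta> v \<and> \<theta> v \<le> 1"
  shows "robust_forest (eta k) (tree_level k) (pos False \<theta>) (pos True \<theta>)"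
  using assms
proof (induction k arbitrary: \<theta>)
  case 0
  have "{j \<in> tree_level 0. f j = f []} = {[]}" for f :: "bool list \<Rightarrow> real" by auto
  then show ?case unfolding robust_forest_def by (auto simp del: tree_level.simps simp: tree_level.simps[of 0])
next
  case (Suc k)
  define t where "t = \<theta> []"
  have t: "0 \<le> t" "t \<le> 1" using Suc.prems by (auto simp: t_def)
  define n where "n = eta k"
  have n: "0 < n" "n \<le> 1" using eta_bounds[of k] by (auto simp: n_def)
  define s where "s b = shrink (n / 4) b t" for b
  have s: "n / 32 \<le> s b" "s b \<le> 1 / 8" for b using shrink_bounds[of "n / 4" b t] n by (auto simp: s_def)
  have s0: "s b > 0" for b using s[of b] n by linarith
  have eta: "eta (Suc k) = n / 32 * n" by (simp add: n_def power2_eq_square)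
  have nn: "n / 32 * n \<le> n / 32" using n by (simp add: mult_left_le)
  define I where "I b = Cons b ` tree_level k" for b
  have fin: "finite (I b)" for b using finite_tree_level by (simp add: I_def)
  have disj: "I False \<inter> I True = {}" "I True \<inter> I False = {}" by (auto simp: I_def)
  have pos_I: "\<bar>pos a \<theta> i - half b * displacement a t\<bar> \<le> s b" if i: "i \<in> I b" for i a b
  proof -
    obtain l where l: "i = b # l" "length l = k" using i by (auto simp: I_def)
    have "\<bar>pos a (\<lambda>v. \<theta> (b # v)) l\<bar> \<le> 1" using Suc.prems by (intro pos_bound) auto
    then have "\<bar>s b * pos a (\<lambda>v. \<theta> (b # v)) l\<bar> \<le> s b * 1"
      unfolding abs_mult using s0[of b] by (intro mult_mono) auto
    then show ?thesis using l by (simp add: s_def t_def n_def)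
  qed
  have rf: "robust_forest (s b * n) (I b) (pos False \<theta>) (pos True \<theta>)" for b
    unfolding I_def
  proof (rule robust_forest_image)
    have "robust_forest n (tree_level k) (pos False (\<lambda>v. \<theta> (b # v))) (pos True (\<lambda>v. \<theta> (b # v)))"
      unfolding n_def using Suc.prems by (intro Suc.IH) auto
    from robust_forest_affine[OF this s0[of b], of "half b * displacement False t" "half b * displacement True t"]
    show "robust_forest (s b * n) (tree_level k) (\<lambda>i. pos False \<theta> (b # i)) (\<lambda>i. pos True \<theta> (b # i))"
      unfolding robust_forest_def by (simp add: s_def t_def n_def cong: conj_cong)
  qed simp
  have rf': "robust_forest (n / 32 * n) (I b) (pos False \<theta>) (pos True \<theta>)" for b
    by (rule robust_forest_mono[OF rf[of b]]) (use s[of b] n in \<open>auto intro: mult_right_mono\<close>)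
  have apart: "\<bar>pos a \<theta> i - pos a \<theta> j\<bar> > n / 32 * n"
    if "\<bar>displacement a t\<bar> \<ge> 1/2" "i \<in> I b" "j \<in> I (\<not> b)" for a b i j
  proof -
    have "\<bar>half b * displacement a t - half (\<not> b) * displacement a t\<bar> \<ge> 1/2"
      using that(1) by (cases b) (auto simp: half_def)
    then show ?thesis
      using pos_I[OF that(2), of a] pos_I[OF that(3), of a] s(2)[of b] s(2)[of "\<not> b"] n nn by linarith
  qed
  \<comment> \<open>The small cluster has diameter at most n/16 and each of the two errors is at
    most n/32. The sum n/8 is the tolerance of a cluster scaled by 1/8, which explains the quotient
    \<open>eta (length l) / 4\<close> in \<open>pos\<close>.\<close>
  have near: "\<bar>pos a \<theta> i - pos a \<theta> i'\<bar> \<le> n / 8"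
    if "s (\<not> b) \<le> n / 32" "j \<in> I (\<not> b)" "j' \<in> I (\<not> b)"
      "\<bar>pos a \<theta> i - pos a \<theta> j\<bar> \<le> n / 32 * n" "\<bar>pos a \<theta> i' - pos a \<theta> j'\<bar> \<le> n / 32 * n" for a b i i' j j'
    using pos_I[OF that(2), of a] pos_I[OF that(3), of a] that(1,4,5) nn by linarith
  have "robust_forest (n / 32 * n) (I False \<union> I True) (pos False \<theta>) (pos True \<theta>)"
  proof (cases "t \<le> 3/8")
    case True
    have sh: "s False = 1 / 8" "s True = n / 32" using True by (auto simp: s_def shrink_def)
    show ?thesis
    proof (rule robust_forest_join[OF fin fin disj(1) rf[of False] rf'[of True]])
      show "n / 32 * n \<le> s False * n" using sh n nn by simp
      show "\<bar>pos True \<theta> i - pos True \<theta> j\<bar> > n / 32 * n" if "i \<in> I False" "j \<in> I True" for i j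
        using apart[of True i False j] that True by (simp add: displacement_def)
      show "\<bar>pos False \<theta> i - pos False \<theta> i'\<bar> \<le> s False * n"
        if "i \<in> I False" "i' \<in> I False" "j \<in> I True" "j' \<in> I True"
          "\<bar>pos False \<theta> i - pos False \<theta> j\<bar> \<le> n / 32 * n" "\<bar>pos False \<theta> i' - pos False \<theta> j'\<bar> \<le> n / 32 * n" for i i' j j'
      proof -
        have sn: "s False * n = n / 8" using sh by simp
        show ?thesis unfolding sn by (rule near[of False j j' False i i']) (use that sh in simp_all)
      qed
    qed
  next
    case F: False
    show ?thesis
    proof (cases "t \<le> 5/8")
      case True
      have ap: "\<bar>pos a \<theta> i - pos a \<theta> j\<bar> > n / 32 * n" if "i \<in> I False" "j \<in> I True" for a i j
      proof -
        have "\<bar>displacement a t\<bar> \<ge> 1/2"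
          using True F by (cases a) (auto simp: displacement_def max_def min_def)
        then show ?thesis using apart[of a i False j] that by simp
      qed
      show ?thesis
      proof (rule robust_forest_join[OF fin fin disj(1) rf'[of False] rf'[of True] order_refl])
        show "\<bar>pos False \<theta> i - pos False \<theta> i'\<bar> \<le> n / 32 * n"
          if "i \<in> I False" "j \<in> I True" "\<bar>pos False \<theta> i - pos False \<theta> j\<bar> \<le> n / 32 * n" for i i' j
          using ap[OF that(1,2), of False] that(3) by linarith
      qed (use ap in blast)
    next
      case False
      have sh: "s True = 1 / 8" "s False = n / 32" using False by (auto simp: s_def shrink_def)
      \<comment> \<open>\<open>robust_forest_join\<close> separates in its second coordinate, so x
        and y change places along with the clusters.\<close>
      have "robust_forest (n / 32 * n) (I True \<union> I False) (pos True \<theta>) (pos False \<theta>)"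
      proof (rule robust_forest_join[OF fin fin disj(2) robust_forest_swap[OF rf[of True]] robust_forest_swap[OF rf'[of False]]])
        show "n / 32 * n \<le> s True * n" using sh n nn by simp
        show "\<bar>pos False \<theta> i - pos False \<theta> j\<bar> > n / 32 * n" if "i \<in> I True" "j \<in> I False" for i j
          using apart[of False i True j] that False by (simp add: displacement_def)
        show "\<bar>pos True \<theta> i - pos True \<theta> i'\<bar> \<le> s True * n"
          if "i \<in> I True" "i' \<in> I True" "j \<in> I False" "j' \<in> I False"
            "\<bar>pos True \<theta> i - pos True \<theta> j\<bar> \<le> n / 32 * n" "\<bar>pos True \<theta> i' - pos True \<theta> j'\<bar> \<le> n / 32 * n" for i i' j j'
        proof -
          have sn: "s True * n = n / 8" using sh by simp
          show ?thesis unfolding sn by (rule near[of True j j' True i i']) (use that sh in simp_all)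
        qed
      qed
      then show ?thesis by (simp add: robust_forest_swap Un_commute)
    qed
  qed
  then show ?case by (simp only: eta tree_level_Suc I_def)
qed

lemma pos_tendsto:
  assumes "\<And>v. (\<lambda>n. s n v) \<longlonglongrightarrow> \<theta> v"
  shows "(\<lambda>n. pos a (s n) l) \<longlonglongrightarrow> pos a \<theta> l"
  using assms
proof (induction l arbitrary: s \<theta>)
  case (Cons b l)
  have "(\<lambda>n. pos a (\<lambda>v. s n (b # v)) l) \<longlonglongrightarrow> pos a (\<lambda>v. \<theta> (b # v)) l"
    by (rule Cons.IH) (rule Cons.prems)
  moreover have "(\<lambda>n. displacement a (s n [])) \<longlonglongrightarrow> displacement a (\<theta> [])"
    unfolding displacement_def by (cases a) (auto intro!: tendsto_intros Cons.prems)
  moreover have "(\<lambda>n. shrink e b (s n [])) \<longlonglongrightarrow> shrink e b (\<theta> [])" for e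
    unfolding shrink_def by (cases b) (auto intro!: tendsto_intros Cons.prems)
  ultimately show ?case by (auto intro!: tendsto_intros)
qed simp

text \<open>The forest with one perfect binary tree of depth \<open>j\<close> for each \<open>j \<in> J\<close>.\<close>

definition leaves :: "nat set \<Rightarrow> (nat \<times> bool list) set"
  where "leaves J = (SIGMA j:J. tree_level j)"

definition nodes :: "nat set \<Rightarrow> (nat \<times> bool list) set"
  where "nodes J = (SIGMA j:J. {w. length w < j})"

definition fsw :: "nat \<times> bool list \<Rightarrow> nat \<times> bool list \<Rightarrow> nat \<times> bool list"
  where "fsw v w = (if fst v = fst w then (fst w, sw (snd v) (snd w)) else w)"

text \<open>Since \<open>pos\<close> is bounded by 1, the step 4 along the diagonal keeps different
  trees apart in both coordinates.\<close>

definition fpos :: "bool \<Rightarrow> (nat \<times> bool list \<Rightarrow> real) \<Rightarrow> nat \<times> bool list \<Rightarrow> real"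
  where "fpos a t l = 4 * real (fst l) + pos a (\<lambda>v. t (fst l, v)) (snd l)"

lemma fpos_fsw:
  assumes "t v = 0"
  shows "fpos a (\<lambda>w. if w = v then 1 else t (fsw v w)) l = fpos a t (fsw v l)"
proof (cases "fst l = fst v")
  case True
  have eq: "(\<lambda>w. if (fst v, w) = v then 1 else t (fsw v (fst v, w))) =
      (\<lambda>w. if w = snd v then 1 else t (fst v, sw (snd v) w))"
    by (auto simp: fun_eq_iff fsw_def prod_eq_iff)
  show ?thesis
    using pos_sw[of "\<lambda>w. t (fst v, w)" "snd v" a "snd l"] assms True
    unfolding fpos_def True eq by (simp add: fsw_def True)
next
  case False
  then have "(fst l, w) \<noteq> v" "fsw v (fst l, w) = (fst l, w)" for w by (auto simp: fsw_def)
  then show ?thesis using False by (simp add: fpos_def fsw_def)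
qed

lemma fpos_robust_forest:
  assumes J: "finite J" and t: "\<And>v. 0 \<le> t v \<and> t v \<le> 1"
  shows "robust_forest 0 (leaves J) (fpos False t) (fpos True t)"
  using J
proof (induction J rule: finite_induct)
  case empty
  show ?case by (simp add: robust_forest_def leaves_def)
next
  case (insert j J)
  have "robust_forest 0 (tree_level j) (pos False (\<lambda>v. t (j, v))) (pos True (\<lambda>v. t (j, v)))"
    by (rule robust_forest_mono[OF pos_robust_forest]) (use t eta_bounds[of j] in \<open>auto simp: less_imp_le\<close>)
  from robust_forest_affine[OF this zero_less_one, of "4 * real j" "4 * real j"]
  have "robust_forest 0 (Pair j ` tree_level j) (fpos False t) (fpos True t)"
    by (intro robust_forest_image) (auto simp: fpos_def inj_on_def)
  moreover have "finite (Pair j ` tree_level j)" "finite (leaves J)"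
    using finite_tree_level insert.hyps by (auto simp: leaves_def simp del: tree_level.simps)
  moreover have "Pair j ` tree_level j \<inter> leaves J = {}" using insert.hyps by (auto simp: leaves_def)
  moreover have "\<bar>fpos a t i - fpos a t i'\<bar> > 0" if i: "i \<in> Pair j ` tree_level j" "i' \<in> leaves J" for a i i'
  proof -
    have ne: "fst i = j" "fst i' \<noteq> j" using i insert.hyps by (auto simp: leaves_def)
    have "\<bar>fpos a t l - 4 * real (fst l)\<bar> \<le> 1" for l
      unfolding fpos_def using pos_bound[of "\<lambda>v. t (fst l, v)" a "snd l"] t by simp
    from this[of i] this[of i'] have "\<bar>fpos a t i - 4 * real j\<bar> \<le> 1" "\<bar>fpos a t i' - 4 * real (fst i')\<bar> \<le> 1"
      using ne by auto
    moreover have "\<bar>4 * real j - 4 * real (fst i')\<bar> \<ge> 4" using ne by linarith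
    ultimately show ?thesis by linarith
  qed
  ultimately have "robust_forest 0 (Pair j ` tree_level j \<union> leaves J) (fpos False t) (fpos True t)"
    using insert.IH by (intro robust_forest_join[where \<eta>' = 0]) force+
  moreover have "Pair j ` tree_level j \<union> leaves J = leaves (insert j J)" by (auto simp: leaves_def)
  ultimately show ?case by simp
qed

section \<open>Families over the configurations\<close>

text \<open>
  \<open>untwist \<theta> P\<close> trivialises the complex permutation bundle of the nodes of one tree: it turns functions
  \<open>P\<close> into functions that are compatible with the swaps at the glued faces.
\<close>

fun untwist :: "(bool list \<Rightarrow> real) \<Rightarrow> (bool list \<Rightarrow> complex) \<Rightarrow> bool list \<Rightarrow> complex" where
  "untwist \<theta> P [] = P []"
| "untwist \<theta> P (b # v) = untwist (\<lambda>u. \<theta> (b # u))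
     (\<lambda>u. P (False # u) + (if b then -1 else 1) * cis (- (pi * \<theta> [])) * P (True # u)) v"

lemma untwist_add: "untwist \<theta> (\<lambda>u. P u + Q u) v = untwist \<theta> P v + untwist \<theta> Q v"
proof (induction v arbitrary: \<theta> P Q)
  case (Cons b v)
  show ?case unfolding untwist.simps Cons.IH[symmetric] by (simp add: algebra_simps)
qed simp

lemma untwist_scale: "untwist \<theta> (\<lambda>u. a * P u) v = a * untwist \<theta> P v"
proof (induction v arbitrary: \<theta> P)
  case (Cons b v)
  show ?case unfolding untwist.simps Cons.IH[symmetric] by (simp add: algebra_simps)
qed simp

lemma untwist_cong: "(\<And>u. length u = length v \<Longrightarrow> P u = Q u) \<Longrightarrow> untwist \<theta> P v = untwist \<theta> Q v"
proof (induction v arbitrary: \<theta> P Q)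
  case (Cons b v)
  show ?case unfolding untwist.simps by (rule Cons.IH) (simp add: Cons.prems)
qed simp

text \<open>At each level two equations P + zQ = 0 and P - zQ = 0 with |z| = 1 are solved.\<close>

lemma untwist_inj:
  assumes "\<And>v. length v = k \<Longrightarrow> untwist \<theta> P v = 0" "length v = k"
  shows "P v = 0"
  using assms
proof (induction k arbitrary: \<theta> P v)
  case 0
  from "0.prems"(1)[of "[]"] "0.prems"(2) show ?case by simp
next
  case (Suc k)
  obtain b u where v: "v = b # u" "length u = k" using Suc.prems(2) by (cases v) auto
  have "P (False # u) + (if b then -1 else 1) * cis (- (pi * \<theta> [])) * P (True # u) = 0" for b
  proof (rule Suc.IH[of "\<lambda>u. \<theta> (b # u)"
        "\<lambda>u. P (False # u) + (if b then -1 else 1) * cis (- (pi * \<theta> [])) * P (True # u)", OF _ v(2)])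
    fix w :: "bool list" assume "length w = k"
    then show "untwist (\<lambda>u. \<theta> (b # u))
        (\<lambda>u. P (False # u) + (if b then -1 else 1) * cis (- (pi * \<theta> [])) * P (True # u)) w = 0"
      using Suc.prems(1)[of "b # w"] by simp
  qed
  from this[of False] this[of True]
  have *: "P (False # u) + cis (- (pi * \<theta> [])) * P (True # u) = 0"
    "P (False # u) - cis (- (pi * \<theta> [])) * P (True # u) = 0" by simp_all
  then have "2 * P (False # u) = 0" by (metis add_diff_cancel_left' add.commute diff_add_cancel eq_iff_diff_eq_0 mult_2)
  then have "P (False # u) = 0" by simp
  then have "P (True # u) = 0" using *(1) by simp
  then show ?case using v \<open>P (False # u) = 0\<close> by (cases b) auto
qed

text \<open>The phase at the swapped node is 1 at parameter 0 and -1 at parameter 1, so branch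
  \<open>b\<close> at one end is branch \<open>\<not> b\<close> at the other.\<close>

lemma untwist_sw:
  assumes "\<theta> v = 0"
  shows "untwist (\<lambda>w. if w = v then 1 else \<theta> (sw v w)) P w = untwist \<theta> P (sw v w)"
  using assms
proof (induction v w arbitrary: \<theta> P rule: sw.induct)
  case (2 b w)
  then show ?case by (cases b) (auto simp: cis_inverse[symmetric] complex_eq_iff cong: if_cong)
next
  case (3 c v b w)
  show ?case
  proof (cases "c = b")
    case True
    have "untwist (\<lambda>w. if w = v then 1 else \<theta> (b # sw v w)) Q w = untwist (\<lambda>w. \<theta> (b # w)) Q (sw v w)" for Q
      using "3.IH"[of "\<lambda>w. \<theta> (b # w)" Q] "3.prems" True by simp
    then show ?thesis using True by (simp cong: if_cong)
  qed (auto cong: if_cong)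
qed simp

lemma untwist_tendsto:
  assumes "\<And>v. (\<lambda>n. s n v) \<longlonglongrightarrow> \<theta> v" "\<And>v. (\<lambda>n. P n v) \<longlonglongrightarrow> Q v"
  shows "(\<lambda>n. untwist (s n) (P n) v) \<longlonglongrightarrow> untwist \<theta> Q v"
  using assms
proof (induction v arbitrary: s \<theta> P Q)
  case (Cons b v)
  show ?case unfolding untwist.simps
    by (rule Cons.IH) (auto intro!: tendsto_intros Cons.prems)
qed simp

lemma fsw_fsw [simp]: "fsw v (fsw v w) = w"
  by (auto simp: fsw_def)

lemma fsw_self [simp]: "fsw v v = v"
  by (simp add: fsw_def)

lemma fsw_eq_iff [simp]: "fsw v w = v \<longleftrightarrow> w = v"
  by (metis fsw_fsw fsw_self)

lemma fst_fsw [simp]: "fst (fsw v w) = fst w"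
  by (simp add: fsw_def)

lemma fsw_nodes: "w \<in> nodes J \<Longrightarrow> fsw v w \<in> nodes J"
  by (auto simp: fsw_def nodes_def)

lemma fsw_leaves: "l \<in> leaves J \<Longrightarrow> fsw v l \<in> leaves J"
  by (auto simp: fsw_def leaves_def)

lemma bij_fsw_leaves: "bij_betw (fsw v) (leaves J) (leaves J)"
  by (rule bij_betw_byWitness[where f' = "fsw v"]) (auto intro: fsw_leaves)

lemma finite_leaves: "finite J \<Longrightarrow> finite (leaves J)"
  unfolding leaves_def using finite_tree_level by (intro finite_SigmaI) auto

lemma finite_nodes: "finite J \<Longrightarrow> finite (nodes J)"
  unfolding nodes_def using finite_below_level by (intro finite_SigmaI) auto

definition untwistF :: "(nat \<times> bool list \<Rightarrow> real) \<Rightarrow> (nat \<times> bool list \<Rightarrow> complex) \<Rightarrow> nat \<times> bool list \<Rightarrow> complex"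
  where "untwistF t P w = untwist (\<lambda>u. t (fst w, u)) (\<lambda>u. P (fst w, u)) (snd w)"

lemma untwistF_fsw:
  assumes "t v = 0"
  shows "untwistF (\<lambda>w. if w = v then 1 else t (fsw v w)) P w = untwistF t P (fsw v w)"
proof (cases "fst w = fst v")
  case True
  have eq: "(\<lambda>u. if (fst v, u) = v then 1 else t (fsw v (fst v, u))) =
      (\<lambda>u. if u = snd v then 1 else t (fst v, sw (snd v) u))"
    by (auto simp: fun_eq_iff fsw_def prod_eq_iff)
  show ?thesis
    using untwist_sw[of "\<lambda>u. t (fst v, u)" "snd v" "\<lambda>u. P (fst v, u)" "snd w"] assms
    unfolding untwistF_def True eq by (simp add: fsw_def True)
next
  case False
  then have "(fst w, u) \<noteq> v" "fsw v (fst w, u) = (fst w, u)" for u by (auto simp: fsw_def)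
  then show ?thesis using False by (simp add: untwistF_def fsw_def)
qed

lemma untwistF_cong:
  assumes "w \<in> nodes J" "\<And>u. u \<in> nodes J \<Longrightarrow> P u = Q u"
  shows "untwistF t P w = untwistF t Q w"
  unfolding untwistF_def by (rule untwist_cong) (use assms in \<open>auto simp: nodes_def\<close>)

lemma untwistF_inj:
  assumes "\<And>w. w \<in> nodes J \<Longrightarrow> untwistF t P w = 0" "w \<in> nodes J"
  shows "P w = 0"
proof -
  obtain j u where w: "w = (j, u)" by (cases w)
  show ?thesis unfolding w
    by (rule untwist_inj[of "length u" "\<lambda>u. t (j, u)" "\<lambda>u. P (j, u)"])
      (use assms w in \<open>auto simp: nodes_def untwistF_def\<close>)
qed

definition haarF :: "nat \<times> bool list \<Rightarrow> nat \<times> bool list \<Rightarrow> real"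
  where "haarF w l = (if fst w = fst l then haar (snd w) (snd l) else 0)"

lemma haarF_fsw: "haarF w (fsw v l) = (if w = v then -1 else 1) * haarF (fsw v w) l"
  by (auto simp: haarF_def fsw_def haar_sw prod_eq_iff)

type_synonym node = "nat \<times> bool list"

text \<open>One unsigned coordinate for each tree and each component of the target space, and two
  signed coordinates per node, for the first two components.\<close>

type_synonym aux = "nat \<times> 3 + node \<times> bool"

definition auxs :: "nat set \<Rightarrow> aux set"
  where "auxs J = Inl ` (J \<times> UNIV) \<union> Inr ` (nodes J \<times> UNIV)"

definition aux_sw :: "node \<Rightarrow> aux \<Rightarrow> aux"
  where "aux_sw v x = (case x of Inl p \<Rightarrow> Inl p | Inr (w, b) \<Rightarrow> Inr (fsw v w, b))"

definition aux_sg :: "node \<Rightarrow> aux \<Rightarrow> int"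
  where "aux_sg v x = (case x of Inl p \<Rightarrow> 1 | Inr (w, b) \<Rightarrow> if w = v then -1 else 1)"

lemma gluing_forest:
  assumes "finite J" "nodes J \<noteq> {}"
  shows "gluing (nodes J) (auxs J) fsw aux_sw aux_sg"
proof
  show "finite (auxs J)" using assms finite_nodes by (simp add: auxs_def)
  show "aux_sw v (aux_sw v x) = x" for v x
  proof (cases x)
    case (Inr p)
    then show ?thesis by (cases p) (simp add: aux_sw_def)
  qed (simp add: aux_sw_def)
qed (use assms in \<open>auto simp: finite_nodes fsw_nodes aux_sw_def aux_sg_def auxs_def split: sum.splits\<close>)

definition comp_of :: "bool \<Rightarrow> 3"
  where "comp_of b = (if b then 1 else 2)"

text \<open>
  Three copies of the leaf functions, written in the Haar basis: the node functions of the third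
  copy become the \<open>D\<close>-coordinates, everything else is auxiliary.
\<close>

fun haar_basis :: "(node, aux) coord \<Rightarrow> node \<Rightarrow> 3 \<Rightarrow> real" where
  "haar_basis (T w) l c = 0"
| "haar_basis (D w) l c = haarF w l * of_bool (c = 3)"
| "haar_basis E l c = 0"
| "haar_basis (X (Inl p)) l c = of_bool (p = (fst l, c))"
| "haar_basis (X (Inr (w, b))) l c = haarF w l * of_bool (c = comp_of b)"

text \<open>The untwisted node bundle is used as it stands for the rotating planes. For the
  auxiliary coordinates it is multiplied by a phase that goes from 1 to -1 at the swapped node,
  which produces the signs \<open>aux_sg\<close>.\<close>

fun twist_frame :: "(node \<Rightarrow> real) \<Rightarrow> (aux + node \<times> bool \<Rightarrow> real) \<Rightarrow> aux + node \<times> bool \<Rightarrow> real" where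
  "twist_frame t \<beta> (Inl (Inl p)) = \<beta> (Inl (Inl p))"
| "twist_frame t \<beta> (Inl (Inr (w, b))) = (if b then Im else Re) (cis (pi * t w) *
     untwistF t (\<lambda>u. Complex (\<beta> (Inl (Inr (u, False)))) (\<beta> (Inl (Inr (u, True))))) w)"
| "twist_frame t \<beta> (Inr (w, b)) = (if b then Im else Re)
     (untwistF t (\<lambda>u. Complex (\<beta> (Inr (u, False))) (\<beta> (Inr (u, True)))) w)"

lemma Complex_add_scale:
  "Complex (a + b) (c + d) = Complex a c + Complex b d" "Complex (r * a) (r * c) = of_real r * Complex a c"
  by (simp_all add: complex_eq_iff)

lemma twist_frame_add: "twist_frame t (\<lambda>k. x k + y k) k = twist_frame t x k + twist_frame t y k"
  by (cases "(t, x, k)" rule: twist_frame.cases)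
    (simp_all add: untwistF_def Complex_add_scale untwist_add algebra_simps)

lemma twist_frame_scale: "twist_frame t (\<lambda>k. a * x k) k = a * twist_frame t x k"
  by (cases "(t, x, k)" rule: twist_frame.cases)
    (simp_all add: untwistF_def Complex_add_scale untwist_scale algebra_simps)

lemma twist_frame_tendsto:
  assumes "\<And>v. (\<lambda>n. s n v) \<longlonglongrightarrow> t v" "\<And>k. (\<lambda>n. x n k) \<longlonglongrightarrow> y k"
  shows "(\<lambda>n. twist_frame (s n) (x n) k) \<longlonglongrightarrow> twist_frame t y k"
proof -
  have Complex: "(\<lambda>n. Complex (f n) (g n)) \<longlonglongrightarrow> Complex a b" if "f \<longlonglongrightarrow> a" "g \<longlonglongrightarrow> b" for f g a b
    using that by (rule tendsto_Complex)
  have "(\<lambda>n. untwistF (s n) (\<lambda>u. Complex (x n (f u)) (x n (g u))) w) \<longlonglongrightarrow>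
      untwistF t (\<lambda>u. Complex (y (f u)) (y (g u))) w" for f g w
    unfolding untwistF_def by (intro untwist_tendsto Complex assms)
  moreover have "(\<lambda>n. cis (pi * s n w)) \<longlonglongrightarrow> cis (pi * t w)" for w
    by (intro tendsto_intros assms)
  ultimately show ?thesis
    by (cases "(t, y, k)" rule: twist_frame.cases) (auto intro!: tendsto_intros assms)
qed

lemma sum_nodes_haarF:
  assumes "finite J" "j \<in> J"
  shows "(\<Sum>w\<in>nodes J. g w * haarF w (j, l)) = (\<Sum>w | length w < j. g (j, w) * haar w l)"
proof -
  have "(\<Sum>w\<in>nodes J. g w * haarF w (j, l)) = (\<Sum>w\<in>Pair j ` {w. length w < j}. g w * haarF w (j, l))"
    by (rule sum.mono_neutral_right) (use finite_nodes assms in \<open>auto simp: nodes_def haarF_def\<close>)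
  also have "\<dots> = (\<Sum>w | length w < j. g (j, w) * haar w l)"
    by (subst sum.reindex) (auto simp: inj_on_def haarF_def)
  finally show ?thesis .
qed

text \<open>To be read with \<open>\<phi> t l i c\<close> as component \<open>c\<close> of the
  functional of chord \<open>l\<close> on the i-th basis vector. For J the set of binary digits of
  n, the bound on \<open>d\<close> is 4n - I(n).\<close>

theorem no_nondegenerate_family:
  fixes \<phi> :: "(node \<Rightarrow> real) \<Rightarrow> node \<Rightarrow> nat \<Rightarrow> 3 \<Rightarrow> real"
  assumes J: "finite J" and ne: "nodes J \<noteq> {}" and d: "d < 4 * card (nodes J) + 3 * card J"
    and \<phi>_end: "\<And>t v l i c. t v = 0 \<Longrightarrow> \<phi> (\<lambda>w. if w = v then 1 else t (fsw v w)) l i c = \<phi> t (fsw v l) i c"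
    and \<phi>_cont: "\<And>s t l i c. i < d \<Longrightarrow> (\<And>v. (\<lambda>n. s n v) \<longlonglongrightarrow> t v) \<Longrightarrow> (\<lambda>n. \<phi> (s n) l i c) \<longlonglongrightarrow> \<phi> t l i c"
    and \<phi>_indep: "\<And>t u l c. (\<And>v. 0 \<le> t v \<and> t v \<le> 1) \<Longrightarrow>
      (\<And>i. i < d \<Longrightarrow> (\<Sum>l\<in>leaves J. \<Sum>c\<in>UNIV. u l c * \<phi> t l i c) = 0) \<Longrightarrow> l \<in> leaves J \<Longrightarrow> u l c = 0"
  shows False
proof -
  interpret G: gluing "nodes J" "auxs J" fsw aux_sw aux_sg by (rule gluing_forest[OF J ne])
  have finX: "finite (auxs J)" by (rule G.finX)
  have "card (auxs J) = card (Inl ` (J \<times> UNIV) :: aux set) + card (Inr ` (nodes J \<times> UNIV) :: aux set)"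
    unfolding auxs_def by (rule card_Un_disjoint) (use J finite_nodes in auto)
  also have "\<dots> = 3 * card J + 2 * card (nodes J)"
    by (simp add: card_image card_cartesian_product)
  finally have N: "G.N = 4 * card (nodes J) + 3 * card J" by (simp add: G.N_def)
  obtain num where num: "bij_betw num G.Kt {..<G.N}"
    using ex_bij_betw_finite_nat[OF G.finite_Kt] G.card_Kt by (auto simp: atLeast0LessThan)
  have num_ex: "\<exists>k\<in>G.Kt. num k = i" if "i < G.N" for i
    using num that by (metis bij_betw_imp_surj_on imageE lessThan_iff)
  \<comment> \<open>As \<open>d\<close> is below N, row \<open>d\<close> is free for the added
    dimension \<open>E\<close>; any further rows are 0.\<close>
  define A where "A t a k = (if num k < d then \<Sum>l\<in>leaves J. \<Sum>c\<in>UNIV. haar_basis a l c * \<phi> t l (num k) c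
      else of_bool (num k = d \<and> a = E))" for t :: "node \<Rightarrow> real" and a :: "(node, aux) coord" and k
  have U: "G.U = insert E (D ` nodes J \<union> X ` auxs J)" by (auto simp: G.U_def G.Co_def)
  have sum_U: "(\<Sum>a\<in>G.U. f a) = (\<Sum>w\<in>nodes J. f (D w)) + f E + (\<Sum>x\<in>auxs J. f (X x))" for f :: "(node, aux) coord \<Rightarrow> real"
  proof -
    have "(\<Sum>a\<in>G.U. f a) = f E + (sum f (D ` nodes J) + sum f (X ` auxs J))"
      unfolding U using finX finite_nodes[OF J] by (subst sum.insert; (subst sum.union_disjoint)?) auto
    then show ?thesis by (simp add: sum.reindex inj_on_def)
  qed
  have sum_auxs: "(\<Sum>x\<in>auxs J. f x) = (\<Sum>p\<in>J \<times> UNIV. f (Inl p)) + (\<Sum>p\<in>nodes J \<times> UNIV. f (Inr p))" for f :: "aux \<Rightarrow> real"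
    unfolding auxs_def using J finite_nodes[OF J] by (subst sum.union_disjoint) (auto simp: sum.reindex)
  have basis_fsw: "haar_basis a (fsw v l) c = of_int (G.sg v a) * haar_basis (G.perm v a) l c" for a v l c
    by (cases "(a, l, c)" rule: haar_basis.cases) (auto simp: haarF_fsw aux_sw_def aux_sg_def)
  have basis_sum: "(\<Sum>a\<in>G.U. u a * haar_basis a (j, l) c) =
      (\<Sum>w | length w < j. (if c = 3 then u (D (j, w)) else u (X (Inr ((j, w), c = 1)))) * haar w l) + u (X (Inl (j, c)))"
    if "j \<in> J" for u :: "(node, aux) coord \<Rightarrow> real" and j l c
  proof -
    have c: "c = 1 \<or> c = 2 \<or> c = 3" using exhaust_3[of c] by blast
    have neq: "(1::3) \<noteq> 2" "(2::3) \<noteq> 3" "(1::3) \<noteq> 3" "(3::3) \<noteq> 1" "(3::3) \<noteq> 2" "(2::3) \<noteq> 1" by simp_all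
    have "(\<Sum>p\<in>J \<times> UNIV. u (X (Inl p)) * haar_basis (X (Inl p)) (j, l) c) = (\<Sum>p\<in>J \<times> UNIV. if p = (j, c) then u (X (Inl p)) else 0)"
      by (rule sum.cong) auto
    also have "\<dots> = u (X (Inl (j, c)))" using J that by simp
    finally have s1: "(\<Sum>p\<in>J \<times> UNIV. u (X (Inl p)) * haar_basis (X (Inl p)) (j, l) c) = u (X (Inl (j, c)))" .
    have s2: "(\<Sum>p\<in>nodes J \<times> UNIV. u (X (Inr p)) * haar_basis (X (Inr p)) (j, l) c) =
        (\<Sum>w\<in>nodes J. \<Sum>b\<in>UNIV. u (X (Inr (w, b))) * haarF w (j, l) * of_bool (c = comp_of b))"
      unfolding sum.cartesian_product by (rule sum.cong) auto
    have "(\<Sum>a\<in>G.U. u a * haar_basis a (j, l) c) =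
      (\<Sum>w\<in>nodes J. (if c = 3 then u (D w) else u (X (Inr (w, c = 1)))) * haarF w (j, l)) + u (X (Inl (j, c)))"
      unfolding sum_U sum_auxs s1 s2 using c neq
      by (auto simp: UNIV_bool comp_of_def sum.distrib[symmetric] intro!: sum.cong)
    then show ?thesis unfolding sum_nodes_haarF[OF J that] .
  qed
  have Kt: "w \<in> nodes J \<Longrightarrow> Inr (w, b) \<in> G.Kt" "w \<in> nodes J \<Longrightarrow> Inl (Inr (w, b)) \<in> G.Kt"
    "j \<in> J \<Longrightarrow> Inl (Inl (j, c)) \<in> G.Kt" for w b j c
    unfolding G.Kt_def by (auto simp: auxs_def)
  have Kt_cases: thesis if "k \<in> G.Kt" "\<And>w b. k = Inr (w, b) \<Longrightarrow> w \<in> nodes J \<Longrightarrow> thesis"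
     "\<And>w b. k = Inl (Inr (w, b)) \<Longrightarrow> w \<in> nodes J \<Longrightarrow> thesis"
     "\<And>j c. k = Inl (Inl (j, c)) \<Longrightarrow> j \<in> J \<Longrightarrow> thesis" for k thesis
    using that unfolding G.Kt_def by (auto simp: auxs_def)
  interpret E: equivariant_family "nodes J" "auxs J" fsw aux_sw aux_sg A twist_frame
  proof
    fix t :: "node \<Rightarrow> real" and x y :: "aux + node \<times> bool \<Rightarrow> real" and k :: "aux + node \<times> bool" and a :: real
    show "twist_frame t (\<lambda>k. x k + y k) k = twist_frame t x k + twist_frame t y k" by (rule twist_frame_add)
    show "twist_frame t (\<lambda>k. a * x k) k = a * twist_frame t x k" by (rule twist_frame_scale)
  next
    fix t :: "node \<Rightarrow> real" and x y :: "aux + node \<times> bool \<Rightarrow> real" and k :: "aux + node \<times> bool"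
    assume eq: "\<And>k. k \<in> G.Kt \<Longrightarrow> x k = y k" and k: "k \<in> G.Kt"
    have P: "x (Inr (w, b)) = y (Inr (w, b))" "x (Inl (Inr (w, b))) = y (Inl (Inr (w, b)))"
      if "w \<in> nodes J" for w b
      using eq[OF Kt(1)[OF that]] eq[OF Kt(2)[OF that]] by simp_all
    have "untwistF t (\<lambda>u. Complex (x (Inl (Inr (u, False)))) (x (Inl (Inr (u, True))))) w =
      untwistF t (\<lambda>u. Complex (y (Inl (Inr (u, False)))) (y (Inl (Inr (u, True))))) w"
      "untwistF t (\<lambda>u. Complex (x (Inr (u, False))) (x (Inr (u, True)))) w =
      untwistF t (\<lambda>u. Complex (y (Inr (u, False))) (y (Inr (u, True)))) w" if "w \<in> nodes J" for w
      by (intro untwistF_cong[OF that]; simp only: P)+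
    then show "twist_frame t x k = twist_frame t y k"
      using eq[OF k] by (cases rule: Kt_cases[OF k]) auto
  next
    fix t :: "node \<Rightarrow> real" and x :: "aux + node \<times> bool \<Rightarrow> real" and k :: "aux + node \<times> bool"
    assume z: "\<And>k. k \<in> G.Kt \<Longrightarrow> twist_frame t x k = 0" and k: "k \<in> G.Kt"
    have c0: "cis r * z = 0 \<longleftrightarrow> z = 0" for r z by simp
    have Pz: "untwistF t (\<lambda>u. Complex (x (Inr (u, False))) (x (Inr (u, True)))) w = 0" if "w \<in> nodes J" for w
      using z[OF Kt(1)[OF that, of False]] z[OF Kt(1)[OF that, of True]] by (simp add: complex_eq_iff)
    have Qz: "untwistF t (\<lambda>u. Complex (x (Inl (Inr (u, False)))) (x (Inl (Inr (u, True))))) w = 0" if "w \<in> nodes J" for w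
    proof -
      have "cis (pi * t w) * untwistF t (\<lambda>u. Complex (x (Inl (Inr (u, False)))) (x (Inl (Inr (u, True))))) w = 0"
        using z[OF Kt(2)[OF that, of False]] z[OF Kt(2)[OF that, of True]] by (simp add: complex_eq_iff)
      then show ?thesis unfolding c0 .
    qed
    have "Complex (x (Inr (w, False))) (x (Inr (w, True))) = 0" 
      "Complex (x (Inl (Inr (w, False)))) (x (Inl (Inr (w, True)))) = 0" if "w \<in> nodes J" for w
      using untwistF_inj[OF Pz that] untwistF_inj[OF Qz that] by auto
    then have "x (Inr (w, b)) = 0 \<and> x (Inl (Inr (w, b))) = 0" if "w \<in> nodes J" for w b
      using that by (cases b) (auto simp: complex_eq_iff)
    then show "x k = 0"
      using z[OF k] by (cases rule: Kt_cases[OF k]) auto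
  next
    fix t :: "node \<Rightarrow> real" and v :: node and x :: "aux + node \<times> bool \<Rightarrow> real" and k :: "aux + node \<times> bool"
    assume tv: "t v = 0"
    have "twist_frame (\<lambda>w. if w = v then 1 else t (fsw v w)) x k = G.sgK v k * twist_frame t x (G.permK v k)"
      unfolding G.sgK_def G.permK_def aux_sw_def aux_sg_def
      by (cases "(t, x, k)" rule: twist_frame.cases) (auto simp: untwistF_fsw[where t = t and v = v, OF tv] tv complex_eq_iff)
    then show "twist_frame (G.end_swap v t) x k = G.sgK v k * twist_frame t x (G.permK v k)"
      by (simp add: G.end_swap_def[abs_def])
  next
    fix t :: "node \<Rightarrow> real" and v :: node and a :: "(node, aux) coord" and k :: "aux + node \<times> bool"
    assume tv: "t v = 0"
    have \<phi>: "\<phi> (G.end_swap v t) l i c = \<phi> t (fsw v l) i c" for l i c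
      using \<phi>_end[where t = t and v = v, OF tv] by (simp add: G.end_swap_def[abs_def])
    \<comment> \<open>Reindexing the leaves moves the swap from \<open>\<phi>\<close> to the Haar
      basis, where it is a signed permutation.\<close>
    have "(\<Sum>l\<in>leaves J. \<Sum>c\<in>UNIV. haar_basis a l c * \<phi> t (fsw v l) i c) =
        (\<Sum>l\<in>leaves J. \<Sum>c\<in>UNIV. haar_basis a (fsw v (fsw v l)) c * \<phi> t (fsw v l) i c)" for i by simp
    also have "\<dots> i = (\<Sum>l\<in>leaves J. \<Sum>c\<in>UNIV. haar_basis a (fsw v l) c * \<phi> t l i c)" for i
      by (rule sum.reindex_bij_betw[OF bij_fsw_leaves, of "\<lambda>l. \<Sum>c\<in>UNIV. haar_basis a (fsw v l) c * \<phi> t l i c"])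
    finally have "(\<Sum>l\<in>leaves J. \<Sum>c\<in>UNIV. haar_basis a l c * \<phi> t (fsw v l) i c) =
        of_int (G.sg v a) * (\<Sum>l\<in>leaves J. \<Sum>c\<in>UNIV. haar_basis (G.perm v a) l c * \<phi> t l i c)" for i
      by (simp add: basis_fsw sum_distrib_left algebra_simps)
    then show "A (G.end_swap v t) a k = of_int (G.sg v a) * A t (G.perm v a) k"
      by (auto simp: A_def \<phi>)
  next
    fix t :: "node \<Rightarrow> real" and u :: "(node, aux) coord \<Rightarrow> real"
    assume t: "t \<in> cube" and ker: "\<And>k. k \<in> G.Kt \<Longrightarrow> (\<Sum>a\<in>G.U. u a * A t a k) = 0"
    have "d < G.N" using d N by simp
    then obtain kd where kd: "kd \<in> G.Kt" "num kd = d" using num_ex by blast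
    have "(\<Sum>a\<in>G.U. u a * A t a kd) = (\<Sum>a\<in>G.U. if a = E then u a else 0)"
      by (rule sum.cong) (auto simp: A_def kd)
    also have "\<dots> = u E" using G.finite_U by (simp add: G.U_def)
    finally have uE: "u E = 0" using ker[OF kd(1)] by simp
    have z: "(\<Sum>l\<in>leaves J. \<Sum>c\<in>UNIV. (\<Sum>a\<in>G.U. u a * haar_basis a l c) * \<phi> t l i c) = 0" if i: "i < d" for i
    proof -
      obtain k where k: "k \<in> G.Kt" "num k = i" using num_ex[of i] i \<open>d < G.N\<close> by auto
      have "0 = (\<Sum>a\<in>G.U. u a * (\<Sum>l\<in>leaves J. \<Sum>c\<in>UNIV. haar_basis a l c * \<phi> t l i c))"
        using ker[OF k(1)] i by (simp add: A_def k(2))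
      also have "\<dots> = (\<Sum>a\<in>G.U. \<Sum>l\<in>leaves J. \<Sum>c\<in>UNIV. u a * haar_basis a l c * \<phi> t l i c)"
        by (simp add: sum_distrib_left mult.assoc)
      also have "\<dots> = (\<Sum>l\<in>leaves J. \<Sum>a\<in>G.U. \<Sum>c\<in>UNIV. u a * haar_basis a l c * \<phi> t l i c)"
        by (rule sum.swap)
      also have "\<dots> = (\<Sum>l\<in>leaves J. \<Sum>c\<in>UNIV. \<Sum>a\<in>G.U. u a * haar_basis a l c * \<phi> t l i c)"
        by (rule sum.cong[OF refl]) (rule sum.swap)
      finally show ?thesis by (simp add: sum_distrib_right)
    qed
    have c0: "(\<Sum>a\<in>G.U. u a * haar_basis a l c) = 0" if "l \<in> leaves J" for l c
      by (rule \<phi>_indep[of t "\<lambda>l c. \<Sum>a\<in>G.U. u a * haar_basis a l c", OF _ z that]) (use t in \<open>auto simp: cube_def\<close>)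
    have key: "u (X (Inl (j, c))) = 0 \<and> (\<forall>w. length w < j \<longrightarrow> (if c = 3 then u (D (j, w)) else u (X (Inr ((j, w), c = 1)))) = 0)"
      if j: "j \<in> J" for j c
    proof (rule haar_independent)
      fix l :: "bool list" assume "length l = j"
      then have "(j, l) \<in> leaves J" using j by (simp add: leaves_def)
      from c0[OF this, of c] show "(\<Sum>w | length w < j. (if c = 3 then u (D (j, w)) else u (X (Inr ((j, w), c = 1)))) * haar w l) + u (X (Inl (j, c))) = 0"
        unfolding basis_sum[OF j] .
    qed
    have neq: "(1::3) \<noteq> 3" "(2::3) \<noteq> 3" "(2::3) \<noteq> 1" by simp_all
    have kD: "u (D (j, w)) = 0" "u (X (Inr ((j, w), b))) = 0" if "j \<in> J" "length w < j" for j w b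
      using key[OF that(1), of 3] key[OF that(1), of 1] key[OF that(1), of 2] that(2) neq by (cases b; auto)+
    have "u (D w) = 0" "u (X (Inr (w, b))) = 0" if "w \<in> nodes J" for w b
      using that kD by (cases w; simp add: nodes_def)+
    moreover have "u (X (Inl (j, c))) = 0" if "j \<in> J" for j c using key[OF that] by blast
    ultimately show "\<forall>a\<in>G.U. u a = 0" using uE unfolding U by (auto simp: auxs_def)
  next
    fix s :: "nat \<Rightarrow> node \<Rightarrow> real" and t :: "node \<Rightarrow> real" and a :: "(node, aux) coord" and k :: "aux + node \<times> bool"
    assume lim: "\<And>v. (\<lambda>n. s n v) \<longlonglongrightarrow> t v"
    have "(\<lambda>n. A (s n) a k) \<longlonglongrightarrow> A t a k" for k
      by (cases "num k < d") (auto simp: A_def intro!: tendsto_intros \<phi>_cont lim)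
    then show "(\<lambda>n. twist_frame (s n) (A (s n) a) k) \<longlonglongrightarrow> twist_frame t (A t a) k"
      by (intro twist_frame_tendsto lim)
  qed
  show False by (rule E.no_equivariant_family)
qed

section \<open>Chord diagrams\<close>

text \<open>Some vector of \<open>S\<close> shows that \<open>f i\<close> is not the combination of
  the others suggested by the dual vectors found so far. It is corrected to be killed by the others
  and normalised, and then serves to correct the old dual vectors.\<close>

lemma dual_functionals:
  fixes f :: "'i \<Rightarrow> 'a::real_vector \<Rightarrow> real"
  assumes "finite I" "subspace S" "\<And>i. linear (f i)"
    and "\<And>c i. (\<And>x. x \<in> S \<Longrightarrow> (\<Sum>i\<in>I. c i * f i x) = 0) \<Longrightarrow> i \<in> I \<Longrightarrow> c i = 0"
  shows "\<exists>h. \<forall>i\<in>I. h i \<in> S \<and> (\<forall>j\<in>I. f j (h i) = of_bool (i = j))"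
  using assms(1,4)
proof (induction I rule: finite_induct)
  case empty
  show ?case by simp
next
  case (insert i I)
  have "\<exists>h. \<forall>i\<in>I. h i \<in> S \<and> (\<forall>j\<in>I. f j (h i) = of_bool (i = j))"
  proof (rule insert.IH)
    fix c k assume c: "\<And>x. x \<in> S \<Longrightarrow> (\<Sum>i\<in>I. c i * f i x) = 0" and k: "k \<in> I"
    have "(\<Sum>j\<in>insert i I. (if j = i then 0 else c j) * f j x) = (\<Sum>j\<in>I. c j * f j x)" for x
      using insert.hyps by (subst sum.insert) (auto intro!: sum.cong)
    then have "(if k = i then 0 else c k) = 0" using insert.prems[of "\<lambda>j. if j = i then 0 else c j" k] c k by auto
    then show "c k = 0" using k insert.hyps by (auto split: if_splits)
  qed
  then obtain h where h: "\<And>j. j \<in> I \<Longrightarrow> h j \<in> S" "\<And>j k. j \<in> I \<Longrightarrow> k \<in> I \<Longrightarrow> f k (h j) = of_bool (j = k)"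
    by blast
  have "\<exists>x\<in>S. f i x \<noteq> (\<Sum>j\<in>I. f i (h j) * f j x)"
  proof (rule ccontr)
    assume "\<not> ?thesis"
    then have eq: "f i x = (\<Sum>j\<in>I. f i (h j) * f j x)" if "x \<in> S" for x using that by blast
    have "(\<Sum>j\<in>insert i I. (if j = i then 1 else - f i (h j)) * f j x) = f i x - (\<Sum>j\<in>I. f i (h j) * f j x)" for x
    proof -
      have "(\<Sum>j\<in>I. (if j = i then 1 else - f i (h j)) * f j x) = (\<Sum>j\<in>I. - (f i (h j) * f j x))"
        by (rule sum.cong) (use insert.hyps in auto)
      then show ?thesis using insert.hyps by (simp add: sum_negf)
    qed
    then have "(if i = i then 1 else - f i (h i)) = 0"
      using insert.prems[of "\<lambda>j. if j = i then 1 else - f i (h j)" i] eq by simp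
    then show False by simp
  qed
  then obtain x where x: "x \<in> S" "f i x \<noteq> (\<Sum>j\<in>I. f i (h j) * f j x)" by blast
  define g where "g = x - (\<Sum>j\<in>I. f j x *\<^sub>R h j)"
  have gS: "g \<in> S" unfolding g_def
    by (intro subspace_diff[OF assms(2)] subspace_sum[OF assms(2)] subspace_scale[OF assms(2)] x h)
  have fg: "f k g = f k x - (\<Sum>j\<in>I. f j x * f k (h j))" for k
    unfolding g_def by (simp add: linear_diff[OF assms(3)] linear_sum[OF assms(3)] linear_scale[OF assms(3)])
  have gi: "f i g \<noteq> 0" using x(2) by (simp add: fg mult.commute)
  have gI: "f k g = 0" if "k \<in> I" for k
  proof -
    have "(\<Sum>j\<in>I. f j x * f k (h j)) = (\<Sum>j\<in>I. if j = k then f j x else 0)"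
      by (rule sum.cong) (use h that in auto)
    then show ?thesis using that insert.hyps by (simp add: fg)
  qed
  define g' where "g' = (1 / f i g) *\<^sub>R g"
  have g': "g' \<in> S" "f i g' = 1" "\<And>k. k \<in> I \<Longrightarrow> f k g' = 0"
    using gS gi gI by (auto simp: g'_def linear_scale[OF assms(3)] intro: subspace_scale[OF assms(2)])
  define h' where "h' j = (if j = i then g' else h j - f i (h j) *\<^sub>R g')" for j
  have "h' j \<in> S" if "j \<in> insert i I" for j
    using that g'(1) h(1) by (auto simp: h'_def intro!: subspace_diff[OF assms(2)] subspace_scale[OF assms(2)])
  moreover have "f k (h' j) = of_bool (j = k)" if "j \<in> insert i I" "k \<in> insert i I" for j k
    using that g' h insert.hyps by (auto simp: h'_def linear_diff[OF assms(3)] linear_scale[OF assms(3)])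
  ultimately show ?case by blast
qed

lemma subspace_continuous_functions: "subspace continuous_functions"
  unfolding subspace_def continuous_functions_def
  by (auto simp: zero_fun_def plus_fun_def scaleR_fun_def intro!: continuous_intros)

lemma continuous_indicator_of_finite:
  fixes Q :: "real set"
  assumes "finite Q"
  shows "\<exists>f\<in>continuous_functions. f p = 1 \<and> (\<forall>q\<in>Q. q \<noteq> p \<longrightarrow> f q = 0)"
proof (intro bexI conjI ballI impI)
  let ?f = "\<lambda>t. \<Prod>q\<in>Q - {p}. (t - q) / (p - q)"
  show "?f \<in> continuous_functions"
    by (auto simp: continuous_functions_def intro!: continuous_intros)
  show "?f p = 1" by (rule prod.neutral) auto
  show "?f q = 0" if "q \<in> Q" "q \<noteq> p" for q
    by (rule prod_zero) (use that assms in auto)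
qed

lemma exp_ne_minus_exp: "exp a \<noteq> - exp b" for a b :: real
  using exp_gt_zero[of a] exp_gt_zero[of b] by linarith

text \<open>The two kinds of endpoints differ in sign and \<open>exp\<close> is injective, so the
  sum for \<open>p\<close> is, up to sign, the sum of \<open>c\<close> over a class of equal
  \<open>x\<close> or of equal \<open>y\<close>. These classes are admissible at tolerance
  0.\<close>

lemma forest_coefficients_zero:
  assumes fin: "finite I" and rf: "robust_forest 0 I x y"
    and z: "\<And>p. (\<Sum>i\<in>I. c i * (of_bool (exp (x i) = p) - of_bool (- exp (y i) = p))) = 0" and i: "i \<in> I"
  shows "c i = (0::real)"
proof (rule robust_forestD[OF rf, of x y c])
  have class_sum: "(\<Sum>i\<in>I. c i * of_bool (P i)) = sum c {i \<in> I. P i}" for P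
    using fin by (simp add: of_bool_def if_distrib sum.inter_filter cong: if_cong)
  fix k
  have "- exp (y i) \<noteq> exp (x k)" "exp (x i) \<noteq> - exp (y k)" for i
    by (metis exp_ne_minus_exp)+
  then have "(\<Sum>i\<in>I. c i * of_bool (x i = x k)) = 0" "- (\<Sum>i\<in>I. c i * of_bool (y i = y k)) = 0"
    using z[of "exp (x k)"] z[of "- exp (y k)"] unfolding sum_negf[symmetric] by simp_all
  then show "sum c {j \<in> I. x j = x k} = 0" "sum c {j \<in> I. y j = y k} = 0"
    unfolding class_sum by simp_all
qed (use i in auto)

text \<open>Endpoints on two opposite half lines make the chords edges of a bipartite graph. For a
  forest the differences of values at the endpoints are independent functionals; functions dual to
  them span a complement of the subalgebra and also show that the chords are distinct.\<close>

lemma independent_chord_diagram_of_forest: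
  assumes fin: "finite I" and rf: "robust_forest 0 I x y"
  shows "independent_chord_diagram (card I) ((\<lambda>i. {exp (x i), - exp (y i)}) ` I)"
proof -
  define f where "f i g = g (exp (x i)) - g (- exp (y i))" for i and g :: "real \<Rightarrow> real"
  let ?ch = "\<lambda>i. {exp (x i), - exp (y i)}"
  let ?D = "?ch ` I"
  note ne = exp_ne_minus_exp
  have lin: "linear (f i)" for i
    by (rule linearI) (simp_all add: f_def plus_fun_def scaleR_fun_def algebra_simps)
  have indep_c: "c i = 0" if c: "\<And>g. g \<in> continuous_functions \<Longrightarrow> (\<Sum>i\<in>I. c i * f i g) = 0" and i: "i \<in> I" for c i
  proof (rule forest_coefficients_zero[OF fin rf _ i])
    fix p
    let ?Q = "(\<lambda>i. exp (x i)) ` I \<union> (\<lambda>i. - exp (y i)) ` I"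
    obtain g where g: "g \<in> continuous_functions" "g p = 1" "\<And>q. q \<in> ?Q \<Longrightarrow> q \<noteq> p \<Longrightarrow> g q = 0"
      using continuous_indicator_of_finite[of ?Q p] fin by blast
    have "g q = of_bool (q = p)" if "q \<in> ?Q" for q using g(2,3) that by auto
    then have "(\<Sum>i\<in>I. c i * (of_bool (exp (x i) = p) - of_bool (- exp (y i) = p))) = (\<Sum>i\<in>I. c i * f i g)"
      by (intro sum.cong) (auto simp: f_def)
    then show "(\<Sum>i\<in>I. c i * (of_bool (exp (x i) = p) - of_bool (- exp (y i) = p))) = 0" using c[OF g(1)] by simp
  qed
  have "\<exists>h. \<forall>i\<in>I. h i \<in> continuous_functions \<and> (\<forall>j\<in>I. f j (h i) = of_bool (i = j))"
    by (rule dual_functionals[OF fin subspace_continuous_functions lin]) (fact indep_c)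
  then obtain h where h: "\<And>i. i \<in> I \<Longrightarrow> h i \<in> continuous_functions"
    "\<And>i j. i \<in> I \<Longrightarrow> j \<in> I \<Longrightarrow> f j (h i) = of_bool (i = j)"
    by blast
  have f_ch: "f i = f j" if "?ch i = ?ch j" for i j
    using that ne[of "x i" "y j"] ne[of "x j" "y i"] by (auto simp: f_def doubleton_eq_iff)
  have inj_ch: "inj_on ?ch I"
  proof (rule inj_onI)
    fix i j assume "i \<in> I" "j \<in> I" "?ch i = ?ch j"
    then have "f j (h i) = 1" using f_ch[of i j] h(2)[of i i] by simp
    then show "i = j" using h(2)[of i j] \<open>i \<in> I\<close> \<open>j \<in> I\<close> by (cases "i = j") auto
  qed
  have inj_h: "inj_on h I"
  proof (rule inj_onI)
    fix i j assume "i \<in> I" "j \<in> I" "h i = h j"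
    then show "i = j" using h(2)[of i i] h(2)[of j i] by (cases "i = j") auto
  qed
  have resp: "respects_chords ?D g \<longleftrightarrow> (\<forall>i\<in>I. f i g = 0)" for g
  proof
    assume g: "respects_chords ?D g"
    show "\<forall>i\<in>I. f i g = 0"
    proof
      fix i assume "i \<in> I"
      then have "?ch i \<in> ?D" by (rule imageI)
      then have "g (exp (x i)) = g (- exp (y i))" using g unfolding respects_chords_def by blast
      then show "f i g = 0" by (simp add: f_def)
    qed
  next
    assume z: "\<forall>i\<in>I. f i g = 0"
    show "respects_chords ?D g"
      unfolding respects_chords_def
    proof (intro allI impI)
      fix a b assume "{a, b} \<in> ?D"
      then obtain i where "i \<in> I" "{a, b} = ?ch i" by blast
      then show "g a = g b" using bspec[OF z, of i] by (auto simp: f_def doubleton_eq_iff)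
    qed
  qed
  have chord: "chord_diagram (card I) ?D"
    using fin card_image[OF inj_ch] ne by (auto simp: chord_diagram_def is_chord_def)
  let ?B = "h ` I"
  have span_B: "\<exists>u. z = (\<Sum>i\<in>I. u i *\<^sub>R h i)" if z: "z \<in> span ?B" for z
  proof -
    obtain u where "z = (\<Sum>b\<in>?B. u b *\<^sub>R b)" using z fin by (auto simp: span_finite)
    then show ?thesis by (auto simp: sum.reindex[OF inj_h])
  qed
  have f_comb: "f j (\<Sum>i\<in>I. u i *\<^sub>R h i) = u j" if "j \<in> I" for j u
  proof -
    have "f j (\<Sum>i\<in>I. u i *\<^sub>R h i) = (\<Sum>i\<in>I. if i = j then u i else 0)"
      unfolding linear_sum[OF lin] linear_scale[OF lin] by (rule sum.cong) (use h(2) that in auto)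
    then show ?thesis using that fin by simp
  qed
  have indep: "independent ?B"
  proof
    assume "dependent ?B"
    then obtain u where u: "\<exists>v\<in>?B. u v \<noteq> 0" "(\<Sum>v\<in>?B. u v *\<^sub>R v) = 0"
      using fin by (auto simp: dependent_finite)
    then have "(\<Sum>i\<in>I. u (h i) *\<^sub>R h i) = 0" by (simp add: sum.reindex[OF inj_h])
    then have "u (h j) = 0" if "j \<in> I" for j
      using f_comb[OF that, of "\<lambda>i. u (h i)"] linear_0[OF lin] by simp
    then show False using u(1) by blast
  qed
  have "span ?B \<inter> chord_subalgebra ?D = {0}"
  proof -
    have "z = 0" if z: "z \<in> span ?B" "z \<in> chord_subalgebra ?D" for z
    proof -
      obtain u where u: "z = (\<Sum>i\<in>I. u i *\<^sub>R h i)" using span_B[OF z(1)] by blast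
      have "u j = 0" if "j \<in> I" for j
        using f_comb[OF that, of u] z(2) that u by (simp add: chord_subalgebra_def resp)
      then show ?thesis using u by simp
    qed
    moreover have "0 \<in> chord_subalgebra ?D"
      using subspace_0[OF subspace_continuous_functions] linear_0[OF lin] by (simp add: chord_subalgebra_def resp)
    ultimately show ?thesis using span_zero by blast
  qed
  moreover have "{b + u | b u. b \<in> span ?B \<and> u \<in> chord_subalgebra ?D} = continuous_functions"
  proof (intro equalityI subsetI)
    fix g assume "g \<in> {b + u | b u. b \<in> span ?B \<and> u \<in> chord_subalgebra ?D}"
    then obtain b u where g: "g = b + u" "b \<in> span ?B" "u \<in> continuous_functions"
      by (auto simp: chord_subalgebra_def)
    have "span ?B \<subseteq> continuous_functions"
      using h(1) by (intro span_minimal subspace_continuous_functions) auto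
    then show "g \<in> continuous_functions" using g subspace_add[OF subspace_continuous_functions] by blast
  next
    fix g assume g: "g \<in> continuous_functions"
    define b where "b = (\<Sum>i\<in>I. f i g *\<^sub>R h i)"
    have b: "b \<in> span ?B" unfolding b_def by (intro span_sum span_scale span_base) auto
    have bc: "b \<in> continuous_functions" unfolding b_def
      by (intro subspace_sum[OF subspace_continuous_functions] subspace_scale[OF subspace_continuous_functions] h)
    have "g - b \<in> chord_subalgebra ?D"
      using subspace_diff[OF subspace_continuous_functions g bc] f_comb[of _ "\<lambda>i. f i g"]
      by (simp add: chord_subalgebra_def resp linear_diff[OF lin] b_def)
    moreover have "g = b + (g - b)" by simp
    ultimately show "g \<in> {b + u | b u. b \<in> span ?B \<and> u \<in> chord_subalgebra ?D}" using b by blast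
  qed
  ultimately have "has_codimension (chord_subalgebra ?D) continuous_functions (card I)"
    unfolding has_codimension_def
    using indep h(1) fin card_image[OF inj_h] by (intro exI[of _ ?B]) auto
  then show ?thesis using chord by (simp add: independent_chord_diagram_def)
qed

section \<open>Smooth maps and bumps in the direction of the knot space\<close>

abbreviation iter_deriv :: "nat \<Rightarrow> (real \<Rightarrow> 'v::real_normed_vector) \<Rightarrow> real \<Rightarrow> 'v"
  where "iter_deriv k \<equiv> (\<lambda>g y. vector_derivative g (at y)) ^^ k"

lemma smooth_iter_deriv:
  assumes "smooth f"
  shows "(iter_deriv k f has_vector_derivative iter_deriv (Suc k) f x) (at x)"
  using assms by (simp add: smooth_def vector_derivative_works)

lemma smoothI:
  assumes "\<And>k x. (F k has_vector_derivative F (Suc k) x) (at x)" "F 0 = f"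
  shows "smooth f"
proof -
  have "iter_deriv k f = F k" for k
  proof (induction k)
    case (Suc k)
    then show ?case by (simp add: vector_derivative_at[OF assms(1)])
  qed (simp add: assms(2))
  then show ?thesis unfolding smooth_def using assms(1) differentiableI_vector by metis
qed

lemma smooth_comb:
  assumes "smooth f" "smooth g"
  shows "smooth (\<lambda>t. a *\<^sub>R f t + b *\<^sub>R g t)"
proof (rule smoothI[where F = "\<lambda>k t. a *\<^sub>R iter_deriv k f t + b *\<^sub>R iter_deriv k g t"])
  show "((\<lambda>t. a *\<^sub>R iter_deriv k f t + b *\<^sub>R iter_deriv k g t) has_vector_derivative
      a *\<^sub>R iter_deriv (Suc k) f x + b *\<^sub>R iter_deriv (Suc k) g x) (at x)" for k x
    by (intro has_vector_derivative_add bounded_linear.has_vector_derivative[OF bounded_linear_scaleR_right]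
        smooth_iter_deriv assms)
qed simp

lemma smooth_rescale:
  assumes f: "smooth f" and L: "bounded_linear L"
  shows "smooth (\<lambda>t. L (f (q + r * t)))"
proof (rule smoothI[where F = "\<lambda>k t. L (r ^ k *\<^sub>R iter_deriv k f (q + r * t))"])
  fix k x
  have "((\<lambda>t. q + r * t) has_vector_derivative r) (at x)"
    by (auto intro!: derivative_eq_intros simp: has_real_derivative_iff_has_vector_derivative[symmetric])
  from vector_diff_chain_at[OF this smooth_iter_deriv[OF f]]
  have "((\<lambda>t. iter_deriv k f (q + r * t)) has_vector_derivative r *\<^sub>R iter_deriv (Suc k) f (q + r * x)) (at x)"
    by (simp add: o_def)
  then have "((\<lambda>t. r ^ k *\<^sub>R iter_deriv k f (q + r * t)) has_vector_derivative
      r ^ k *\<^sub>R (r *\<^sub>R iter_deriv (Suc k) f (q + r * x))) (at x)"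
    by (rule bounded_linear.has_vector_derivative[OF bounded_linear_scaleR_right])
  from bounded_linear.has_vector_derivative[OF L this]
  show "((\<lambda>t. L (r ^ k *\<^sub>R iter_deriv k f (q + r * t))) has_vector_derivative
      L (r ^ Suc k *\<^sub>R iter_deriv (Suc k) f (q + r * x))) (at x)"
    by (simp add: mult.commute)
qed simp

lemma smooth_continuous: "smooth f \<Longrightarrow> isCont f x"
  unfolding smooth_def by (drule spec[of _ 0]) (simp add: differentiable_imp_continuous_within)

text \<open>A nonzero element of the direction, rescaled so as to be concentrated near \<open>p\<close>, serves as a bump.\<close>

lemma bump_in_direction:
  fixes Q :: "real set" and c :: 3
  assumes \<psi>: "\<psi> \<in> direction (knot_space e)" "\<psi> \<noteq> 0" and Q: "finite Q"
  shows "\<exists>\<omega>\<in>direction (knot_space e). \<omega> p = axis c 1 \<and> (\<forall>q\<in>Q. q \<noteq> p \<longrightarrow> \<omega> q = 0)"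
proof -
  obtain f g where fg: "f \<in> knot_space e" "g \<in> knot_space e" "\<psi> = f - g"
    using \<psi>(1) by (auto simp: direction_def)
  obtain C1 C2 where C: "compact C1" "\<And>t. t \<notin> C1 \<Longrightarrow> f t = e t" "compact C2" "\<And>t. t \<notin> C2 \<Longrightarrow> g t = e t"
    using fg(1,2) unfolding knot_space_def by blast
  have sm: "smooth f" "smooth g" using fg by (auto simp: knot_space_def)
  have sm\<psi>: "smooth \<psi>"
    using smooth_comb[OF sm, of 1 "-1"] by (simp add: fg(3) fun_diff_def)
  have "bounded (C1 \<union> C2)" using C by (simp add: compact_imp_bounded)
  then obtain R where R: "\<And>t. t \<in> C1 \<union> C2 \<Longrightarrow> \<bar>t\<bar> \<le> R" unfolding bounded_real by blast
  have \<psi>0: "\<psi> t = 0" if "\<bar>t\<bar> > R" for t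
  proof -
    have "t \<notin> C1" "t \<notin> C2" using R[of t] that by auto
    then show ?thesis using C by (simp add: fg(3))
  qed
  obtain s where "\<psi> s \<noteq> 0" using \<psi>(2) by (auto simp: fun_eq_iff)
  then obtain c1 where c1: "\<psi> s $ c1 \<noteq> 0" by (metis vec_eq_iff zero_index)
  define \<delta> where "\<delta> = Min (insert 1 ((\<lambda>q. \<bar>q - p\<bar>) ` (Q - {p})))"
  have \<delta>: "\<delta> > 0" "\<And>q. q \<in> Q \<Longrightarrow> q \<noteq> p \<Longrightarrow> \<delta> \<le> \<bar>q - p\<bar>"
    using Q by (auto simp: \<delta>_def Min_gr_iff)
  \<comment> \<open>So large that points at distance \<open>\<delta>\<close> from \<open>p\<close>
    are sent beyond the support bound \<open>R\<close>, while \<open>p\<close> itself goes to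
    \<open>s\<close>.\<close>
  define r where "r = (\<bar>R\<bar> + \<bar>s\<bar> + 1) / \<delta>"
  have r: "r > 0" "r * \<delta> = \<bar>R\<bar> + \<bar>s\<bar> + 1" using \<delta>(1) by (auto simp: r_def intro!: divide_pos_pos)
  define L :: "real ^ 3 \<Rightarrow> real ^ 3" where "L v = (v $ c1 / \<psi> s $ c1) *\<^sub>R axis c 1" for v
  have L: "bounded_linear L"
    unfolding linear_conv_bounded_linear[symmetric] L_def
    by (rule linearI) (simp_all add: algebra_simps add_divide_distrib)
  define \<omega> where "\<omega> t = L (\<psi> ((s - r * p) + r * t))" for t
  have sm\<omega>: "smooth \<omega>" unfolding \<omega>_def by (rule smooth_rescale[OF sm\<psi> L])
  have far: "\<omega> t = 0" if "\<bar>t - p\<bar> \<ge> \<delta>" for t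
  proof -
    have "r * \<delta> \<le> r * \<bar>t - p\<bar>" using that r(1) by (intro mult_left_mono) auto
    also have "\<dots> = \<bar>r * (t - p)\<bar>" using r(1) by (simp add: abs_mult)
    finally have "\<bar>R\<bar> + \<bar>s\<bar> + 1 \<le> \<bar>r * (t - p)\<bar>" using r(2) by simp
    moreover have "(s - r * p) + r * t = s + r * (t - p)" by (simp add: algebra_simps)
    ultimately have "\<bar>(s - r * p) + r * t\<bar> > R" by linarith
    then show ?thesis using \<psi>0 by (simp add: \<omega>_def L_def)
  qed
  have "(\<lambda>t. f t + \<omega> t) \<in> knot_space e"
    unfolding knot_space_def
  proof (intro CollectI conjI exI[of _ "C1 \<union> {p - \<delta>..p + \<delta>}"] allI impI)
    show "smooth (\<lambda>t. f t + \<omega> t)" using smooth_comb[OF sm(1) sm\<omega>, of 1 1] by simp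
    show "compact (C1 \<union> {p - \<delta>..p + \<delta>})" using C by (intro compact_Un) auto
    show "f t + \<omega> t = e t" if "t \<notin> C1 \<union> {p - \<delta>..p + \<delta>}" for t
      using that C(2)[of t] far[of t] by (auto simp: abs_if split: if_splits)
  qed
  moreover have "\<omega> = (\<lambda>t. f t + \<omega> t) - f" by (auto simp: fun_eq_iff)
  ultimately have "\<omega> \<in> direction (knot_space e)" using fg(1) unfolding direction_def by blast
  moreover have "\<omega> p = axis c 1" using c1 by (simp add: \<omega>_def L_def)
  moreover have "\<omega> q = 0" if "q \<in> Q" "q \<noteq> p" for q using far \<delta>(2)[OF that] by blast
  ultimately show ?thesis by blast
qed

section \<open>Binary digits and the final contradiction\<close>

lemma sum_bits:
  fixes n :: nat
  shows "finite {i. bit n i}" "(\<Sum>i | bit n i. 2 ^ i) = n"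
proof -
  have sub: "{i. bit n i} \<subseteq> {0..<n}"
  proof
    fix i assume "i \<in> {i. bit n i}"
    then have "n div 2 ^ i \<noteq> 0" by (auto simp: bit_iff_odd intro: odd_pos)
    then have "2 ^ i \<le> n" by (meson div_less not_le)
    with less_exp have "i < n" by (rule less_le_trans)
    then show "i \<in> {0..<n}" by simp
  qed
  then show "finite {i. bit n i}" by (rule finite_subset) simp
  have "n = take_bit n n" by (simp add: take_bit_nat_eq_self)
  also have "\<dots> = (\<Sum>k = 0..<n. push_bit k (of_bool (bit n k)))" by (rule take_bit_sum)
  also have "\<dots> = (\<Sum>k = 0..<n. if bit n k then 2 ^ k else 0)"
    by (rule sum.cong) (auto simp: push_bit_eq_mult)
  also have "\<dots> = (\<Sum>i\<in>{i. bit n i}. 2 ^ i)"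
    using sub by (subst sum.inter_filter[symmetric]) (auto intro!: sum.cong)
  finally show "(\<Sum>i | bit n i. 2 ^ i) = n" by simp
qed

lemma card_leaves_bits: "card (leaves {i. bit n i}) = n"
  using sum_bits[of n] finite_tree_level card_tree_level
  unfolding leaves_def by (subst card_SigmaI) (auto simp del: tree_level.simps)

lemma card_nodes_bits: "card (nodes {i. bit n i}) + num_ones n = n"
proof -
  have "card (nodes {i. bit n i}) = (\<Sum>i | bit n i. 2 ^ i - 1)"
    using sum_bits(1)[of n] finite_below_level card_below_level
    unfolding nodes_def by (subst card_SigmaI) auto
  moreover have "(\<Sum>i | bit n i. (2::nat) ^ i - 1) + (\<Sum>i | bit n i. 1) = (\<Sum>i | bit n i. 2 ^ i)"
    unfolding sum.distrib[symmetric] by (rule sum.cong) auto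
  ultimately show ?thesis using sum_bits(2)[of n] by (simp add: num_ones_def)
qed

lemma fpos_tendsto:
  assumes "\<And>v. (\<lambda>n. s n v) \<longlonglongrightarrow> t v"
  shows "(\<lambda>n. fpos a (s n) l) \<longlonglongrightarrow> fpos a t l"
  unfolding fpos_def by (intro tendsto_intros pos_tendsto assms)

theorem proposition9:
  fixes e :: "real \<Rightarrow> real ^ 3" and n d :: nat and K' :: "(real \<Rightarrow> real ^ 3) set"
  assumes "linear e" and "inj e"
    and "4 * n - num_ones n > d" and "d \<ge> 3 * n"
    and "affine_subspace_of_dim d K' (knot_space e)"
  shows "\<exists>D. independent_chord_diagram n D \<and>
    \<not> generic_intersection (knot_space e) (chord_subspace e D) K'"
proof (rule ccontr)
  assume neg: "\<not> ?thesis"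
  define J where "J = {i. bit n i}"
  have J: "finite J" unfolding J_def by (rule sum_bits)
  have card_l: "card (leaves J) = n" unfolding J_def by (rule card_leaves_bits)
  have card_n: "card (nodes J) + card J = n" using card_nodes_bits[of n] by (simp add: J_def num_ones_def)
  have d: "d < 4 * card (nodes J) + 3 * card J"
    using assms(3) card_n by (simp add: num_ones_def J_def)
  \<comment> \<open>With m nodes the bounds read 3n <= d < 3n + m.\<close>
  have "card (nodes J) > 0" using d assms(4) card_n by linarith
  then have ne: "nodes J \<noteq> {}" by auto
  have n0: "n > 0" using \<open>card (nodes J) > 0\<close> card_n by linarith
  obtain B where B: "finite B" "card B = d" "independent B" "span B = direction K'"
    using assms(5) unfolding affine_subspace_of_dim_def has_dimension_def by blast
  have dir_sub: "direction K' \<subseteq> direction (knot_space e)"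
    using assms(5) unfolding affine_subspace_of_dim_def direction_def by blast
  have B_dir: "b \<in> direction (knot_space e)" if "b \<in> B" for b
    using that B(4) dir_sub span_base by blast
  \<comment> \<open>A basis vector exists because d >= 3n > 0; its rescalings are the bumps used
    below.\<close>
  obtain \<psi> where \<psi>: "\<psi> \<in> B" using B(2) assms(4) n0 by fastforce
  have \<psi>0: "\<psi> \<noteq> 0" using \<psi> B(3) dependent_zero by blast
  obtain b where b: "bij_betw b {..<d} B"
    using ex_bij_betw_nat_finite[OF B(1)] B(2) by (auto simp: atLeast0LessThan)
  have b_cont: "isCont (b i) x" if "i < d" for i x
  proof -
    have "b i \<in> B" using b that by (auto dest: bij_betwE)
    then obtain f g where "f \<in> knot_space e" "g \<in> knot_space e" "b i = f - g"
      using B_dir[of "b i"] by (auto simp: direction_def)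
    then show ?thesis by (simp add: fun_diff_def knot_space_def smooth_continuous)
  qed
  \<comment> \<open>Points of the plane become chords from the positive to the negative half line,
    so the endpoints never collide.\<close>
  define \<phi> where "\<phi> t l i c = (b i (exp (fpos False t l)) - b i (- exp (fpos True t l))) $ c"
    for t l i and c :: 3
  show False
  proof (rule no_nondegenerate_family[OF J ne d, of \<phi>])
    fix t :: "node \<Rightarrow> real" and v l i c
    assume "t v = 0"
    then show "\<phi> (\<lambda>w. if w = v then 1 else t (fsw v w)) l i c = \<phi> t (fsw v l) i c"
      by (simp add: \<phi>_def fpos_fsw)
  next
    fix s :: "nat \<Rightarrow> node \<Rightarrow> real" and t :: "node \<Rightarrow> real" and l i c
    assume "i < d" and lim: "\<And>v. (\<lambda>n. s n v) \<longlonglongrightarrow> t v"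
    then show "(\<lambda>n. \<phi> (s n) l i c) \<longlonglongrightarrow> \<phi> t l i c"
      unfolding \<phi>_def
      by (intro tendsto_intros isCont_tendsto_compose[OF b_cont] fpos_tendsto) auto
  next
    fix t :: "node \<Rightarrow> real" and u :: "node \<Rightarrow> 3 \<Rightarrow> real" and l0 c0
    assume t: "\<And>v. 0 \<le> t v \<and> t v \<le> 1" and l0: "l0 \<in> leaves J"
      and ker: "\<And>i. i < d \<Longrightarrow> (\<Sum>l\<in>leaves J. \<Sum>c\<in>UNIV. u l c * \<phi> t l i c) = 0"
    let ?x = "fpos False t" and ?y = "fpos True t"
    define D where "D = (\<lambda>l. {exp (?x l), - exp (?y l)}) ` leaves J"
    have rf: "robust_forest 0 (leaves J) ?x ?y" by (rule fpos_robust_forest[OF J t])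
    have fin: "finite (leaves J)" by (rule finite_leaves[OF J])
    have "independent_chord_diagram n D"
      using independent_chord_diagram_of_forest[OF fin rf] by (simp add: D_def card_l)
    then have "transversal_in (knot_space e) (chord_subspace e D) K'"
      using neg by (auto simp: generic_intersection_def)
    then have tr: "span (direction (chord_subspace e D) \<union> direction K') = direction (knot_space e)"
      by (simp add: transversal_in_def)
    \<comment> \<open>A relation among the functionals of the chords. It vanishes on both
      directions, hence by transversality on the whole direction of the knot space, where bumps
      isolate its coefficients.\<close>
    define F where "F g = (\<Sum>l\<in>leaves J. \<Sum>c\<in>UNIV. u l c * (g (exp (?x l)) - g (- exp (?y l))) $ c)"
      for g :: "real \<Rightarrow> real ^ 3"
    have linF: "linear F"
      by (rule linearI)
        (simp_all add: F_def scaleR_fun_def sum.distrib[symmetric] sum_distrib_left algebra_simps)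
    have F_chord: "F g = 0" if g: "g \<in> direction (chord_subspace e D)" for g
    proof -
      obtain f1 f2 where f: "f1 \<in> chord_subspace e D" "f2 \<in> chord_subspace e D" "g = f1 - f2"
        using g by (auto simp: direction_def)
      have "g (exp (?x l)) = g (- exp (?y l))" if "l \<in> leaves J" for l
      proof -
        have "{exp (?x l), - exp (?y l)} \<in> D" using that by (simp add: D_def)
        then show ?thesis using f unfolding chord_subspace_def respects_chords_def by simp
      qed
      then show ?thesis by (simp add: F_def)
    qed
    have "F g = 0" if g: "g \<in> B" for g
    proof -
      obtain i where "i < d" "g = b i" using g b by (metis bij_betw_imp_surj_on imageE lessThan_iff)
      then show ?thesis using ker[of i] by (simp add: F_def \<phi>_def)
    qed
    then have F_K': "F g = 0" if "g \<in> direction K'" for g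
      using linear_eq_0_on_span[OF linF, of B g] that B(4) by blast
    have F0: "F g = 0" if "g \<in> direction (knot_space e)" for g
      using linear_eq_0_on_span[OF linF, of "direction (chord_subspace e D) \<union> direction K'" g] F_chord F_K' that tr by blast
    let ?Q = "(\<lambda>l. exp (?x l)) ` leaves J \<union> (\<lambda>l. - exp (?y l)) ` leaves J"
    show "u l0 c0 = 0"
    proof (rule forest_coefficients_zero[OF fin rf _ l0])
      fix p
      obtain g where g: "g \<in> direction (knot_space e)" "g p = axis c0 1" "\<And>q. q \<in> ?Q \<Longrightarrow> q \<noteq> p \<Longrightarrow> g q = 0"
        using bump_in_direction[OF B_dir[OF \<psi>] \<psi>0, of ?Q p c0] fin by blast
      have "g q $ c = (if c = c0 then of_bool (q = p) else 0)" if "q \<in> ?Q" for q c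
        using g(2,3) that by (cases "q = p") (auto simp: axis_def)
      then have "(\<Sum>c\<in>UNIV. u l c * (g (exp (?x l)) - g (- exp (?y l))) $ c) =
          (\<Sum>c\<in>UNIV. if c = c0 then u l c * (of_bool (exp (?x l) = p) - of_bool (- exp (?y l) = p)) else 0)"
        if "l \<in> leaves J" for l
        using that by (intro sum.cong) auto
      then have "F g = (\<Sum>l\<in>leaves J. u l c0 * (of_bool (exp (?x l) = p) - of_bool (- exp (?y l) = p)))"
        unfolding F_def by simp
      then show "(\<Sum>l\<in>leaves J. u l c0 * (of_bool (exp (?x l) = p) - of_bool (- exp (?y l) = p))) = 0"
        using F0[OF g(1)] by simp
    qed
  qed
qed

end
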